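(* Let $d>1$ be an integer. There exists a minimal subshift $(X,\sigma)$ over a finite alphabet which has exactly $d$ ergodic measures, has no nonergodic generic measures, and satisfies $$\liminf_{n\to\infty}\frac{P_X(n)}{n}=d\qquad\text{and}\qquad\limsup_{n\to\infty}\frac{P_X(n)}{n}=d+1.$$
   Context: A subshift $(X,\sigma)$ is a closed subset $X\subset\mathcal{A}^{\mathbb{Z}}$, where $\mathcal{A}$ is a finite alphabet with the discrete topology and $\mathcal{A}^{\mathbb{Z}}$ has the product topology, that is invariant under the left shift $\sigma\colon\mathcal{A}^{\mathbb{Z}}\to\mathcal{A}^{\mathbb{Z}}$, $(\sigma x)(n)=x(n+1)$. It is minimal if for every $x\in X$ the orbit closure $\overline{\{\sigma^n x\colon n\in\mathbb{Z}\}}$ equals $X$. The complexity function $P_X(n)$ is the number of distinct words of length $n$ that occur as (contiguous) subwords of elements of $X$. Ergodic measures are ergodic $\sigma$-invariant Borel probability measures on $X$. Let $\mu$ be a $\sigma$-invariant Borel probability measure on $X$. A point $x\in X$ is generic for $\mu$ if for every continuous $f\colon X\to\mathbb{R}$, $$\lim_{N\to\infty}\frac1N\sum_{n=0}^{N-1}f(\sigma^n x)=\int f\,d\mu.$$ The measure $\mu$ is called generic if it has a generic point in $X$. *)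

theory Defs
  imports "HOL-Probability.Probability"
begin

text \<open>
  The alphabet of a subshift is a finite subset \<open>A\<close> of a type with the discrete topology.
  Bi-infinite sequences are functions \<open>int \<Rightarrow> 'a\<close>; their type-class topology is the product
  topology, and it induces on the set of sequences with values in \<open>A\<close> the product of the
  discrete topologies on \<open>A\<close>. As that set is closed, closedness of \<open>X\<close> means the same in it and in
  \<open>int \<Rightarrow> 'a\<close>. These facts are proved in the two lemmas below.
\<close>

lemma topology_of_full_shift:
  fixes A :: "'a::discrete_topology set"
  shows "subtopology euclidean (PiE UNIV (\<lambda>_::int. A)) =
    product_topology (\<lambda>_. discrete_topology A) UNIV"
proof -
  have "(euclidean :: 'a topology) = discrete_topology UNIV"
    by (simp add: topology_eq Topological_Spaces.open_discrete)
  then have "discrete_topology A = subtopology euclidean A"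
    by simp
  then show ?thesis
    unfolding euclidean_product_topology[symmetric] subtopology_product_topology by simp
qed

lemma closed_full_shift:
  fixes A :: "'a::discrete_topology set"
  shows "closed (PiE UNIV (\<lambda>_::int. A))"
proof -
  have "closedin euclidean A"
    unfolding closed_closedin[symmetric] closed_def by (rule Topological_Spaces.open_discrete)
  then have "closedin (product_topology (\<lambda>_::int. euclidean) UNIV) (PiE UNIV (\<lambda>_. A))"
    by (simp add: closedin_product_topology)
  then show ?thesis
    unfolding euclidean_product_topology closed_closedin .
qed

definition shift :: "(int \<Rightarrow> 'a) \<Rightarrow> int \<Rightarrow> 'a" where
  "shift x = (\<lambda>n. x (n + 1))"

text \<open>The iterate of the shift with an arbitrary integer exponent.\<close>

definition shift_int :: "int \<Rightarrow> (int \<Rightarrow> 'a) \<Rightarrow> int \<Rightarrow> 'a" where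
  "shift_int k x = (\<lambda>n. x (n + k))"

lemma shift_int_of_nat: "shift_int (int n) x = (shift ^^ n) x"
proof (induction n)
  case (Suc n)
  have "shift_int (int (Suc n)) x = shift (shift_int (int n) x)"
    by (simp add: shift_int_def shift_def ac_simps)
  then show ?case
    by (simp add: Suc.IH)
qed (simp add: shift_int_def)

lemma shift_int_minus: "(shift ^^ n) (shift_int (- int n) x) = x"
  by (auto simp: shift_int_of_nat[symmetric] shift_int_def)

definition subshift :: "'a::discrete_topology set \<Rightarrow> (int \<Rightarrow> 'a) set \<Rightarrow> bool" where
  "subshift A X \<longleftrightarrow>
     finite A \<and> (\<forall>x\<in>X. range x \<subseteq> A) \<and> closed X \<and> shift ` X = X"

definition minimal_subshift :: "'a::discrete_topology set \<Rightarrow> (int \<Rightarrow> 'a) set \<Rightarrow> bool" where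
  "minimal_subshift A X \<longleftrightarrow>
     subshift A X \<and> (\<forall>x\<in>X. closure {shift_int n x | n. True} = X)"

definition words :: "(int \<Rightarrow> 'a) set \<Rightarrow> nat \<Rightarrow> 'a list set" where
  "words X n = {map (\<lambda>j. x (i + int j)) [0..<n] | x i. x \<in> X}"

definition complexity :: "(int \<Rightarrow> 'a) set \<Rightarrow> nat \<Rightarrow> nat" where
  "complexity X n = card (words X n)"

text \<open>
  Measures on \<open>X\<close> are measures with underlying space \<open>X\<close> whose measurable sets are
  exactly the Borel subsets of \<open>X\<close>, so that distinct measures are distinct set functions.
\<close>

definition invariant_measure ::
    "(int \<Rightarrow> 'a::discrete_topology) set \<Rightarrow> (int \<Rightarrow> 'a) measure \<Rightarrow> bool" where
  "invariant_measure X M \<longleftrightarrow>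
     prob_space M \<and> sets M = sets (restrict_space borel X) \<and>
     (\<forall>B\<in>sets M. emeasure M (shift -` B \<inter> X) = emeasure M B)"

definition ergodic_measure ::
    "(int \<Rightarrow> 'a::discrete_topology) set \<Rightarrow> (int \<Rightarrow> 'a) measure \<Rightarrow> bool" where
  "ergodic_measure X M \<longleftrightarrow>
     invariant_measure X M \<and>
     (\<forall>B\<in>sets M. shift -` B \<inter> X = B \<longrightarrow> measure M B = 0 \<or> measure M B = 1)"

definition generic_point ::
    "(int \<Rightarrow> 'a::discrete_topology) set \<Rightarrow> (int \<Rightarrow> 'a) measure \<Rightarrow> (int \<Rightarrow> 'a) \<Rightarrow> bool" where
  "generic_point X M x \<longleftrightarrow>
     x \<in> X \<and>
     (\<forall>f :: (int \<Rightarrow> 'a) \<Rightarrow> real. continuous_on X f \<longrightarrow>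
        (\<lambda>N. 1 / real N * (\<Sum>n<N. f ((shift ^^ n) x))) \<longlonglongrightarrow> (\<integral>y. f y \<partial>M))"

definition generic_measure ::
    "(int \<Rightarrow> 'a::discrete_topology) set \<Rightarrow> (int \<Rightarrow> 'a) measure \<Rightarrow> bool" where
  "generic_measure X M \<longleftrightarrow> invariant_measure X M \<and> (\<exists>x. generic_point X M x)"

end

theory Submission
  imports Defs "HOL-Library.Sublist"
begin

text \<open>Write \<open>d = e + 1\<close>. The subshift is built from a single sequence of words \<open>v 0, v 1, \<dots>\<close>: the first \<open>d\<close>
words are the letters, and for run exponents \<open>q\<close> that grow very fast

  \<open>v (n + d) = v n ^ q (n, e) \<cdot> v (n + 1) ^ q (n, 0) \<cdot> \<dots> \<cdot> v (n + e) ^ q (n, e - 1) \<cdot> v n ^ q (n, e)\<close>.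

Each short run is much longer than the short runs before it, and the two outer runs are much longer
than all the short ones. A point of the subshift is a sequence
all of whose factors occur in some \<open>v m\<close>. For each \<open>n\<close> such a point is, at the scale of the words
\<open>v n, \<dots>, v (n + e)\<close>, a sequence of runs of these words in cyclic order; passing from \<open>n\<close> to
\<open>n + 1\<close> only replaces the word \<open>v n\<close> by \<open>v (n + d)\<close>, which consists of \<open>v n\<close> almost entirely.

Complexity. The lengths \<open>s n j\<close> of the runs in \<open>v (n + d)\<close> satisfy
\<open>s n 0 \<lless> \<dots> \<lless> s n e \<lless> s (n + 1) 0\<close>. A factor of length \<open>N \<le> s n 0\<close> meets at most one change
of word, and there are \<open>d\<close> kinds of changes, hence about \<open>d N\<close> such factors if \<open>N\<close> is large compared
with the words. If \<open>N\<close> lies between \<open>s n j\<close> and \<open>s n (j + 1)\<close>, the new factors are those that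
see the end of a run of \<open>v n\<close>, then some complete short runs, and the beginning of the run that
follows. Because the runs increase in length, only the last of these runs matters,
so there are about \<open>N\<close> new factors and not \<open>N\<close> for each short run. This is why the runs have increasing
lengths: the number of factors stays below \<open>(d + 1) N\<close> up to a small error (\<open>P_upper\<close>) and comes back
to \<open>d N\<close> at \<open>N = s n 0\<close> (\<open>P_upper_low\<close>). For the lower bounds one counts words with two continuations:
the suffixes of \<open>d\<close> consecutive words \<open>v m\<close> always have two (\<open>P_lower\<close>), and between \<open>s n 0\<close>
and \<open>s n e\<close> there is one more such word (\<open>P_lower_high\<close>).

Measures. As \<open>v (n + d)\<close> is almost a power of \<open>v n\<close>, the frequency of a word in \<open>v n\<close> converges along
each residue class of \<open>n\<close> modulo \<open>d\<close>. The limits are the values of \<open>d\<close> invariant measures \<open>mu 0, \<dots>, mu e\<close>.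
Averaging over windows of length \<open>s n 0\<close>, each of which is a concatenation of two periodic
pieces, shows that every invariant measure is a convex combination of these
(\<open>invariant_decomposition\<close>). The letter \<open>i\<close> has frequency at least \<open>5/6\<close> for \<open>mu i\<close> and at most \<open>1/6\<close> for the
other ones, so that \<open>mu i\<close> is an extreme point, hence ergodic. Conversely, an ergodic measure dominates
a multiple of some \<open>mu i\<close>, and is equal to it by a Hahn decomposition (\<open>ergodic_dominates\<close>).

Generic points. In a window \<open>[0, s n 0)\<close> of any point, either the first piece is already so long that it
contains many periods, or it is negligible compared with the second. In both cases
some initial segment of the point has nearly the frequencies of a single \<open>v (n + i)\<close>. Hence a
subsequence of the Birkhoff averages of any point tends to one of the \<open>mu i\<close>, and a generic measure is
one of them (\<open>generic_is_mu\<close>).\<close>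

section \<open>Windows and powers of words\<close>

definition win :: "(int \<Rightarrow> 'a) \<Rightarrow> int \<Rightarrow> nat \<Rightarrow> 'a list" where
  "win x z n = map (\<lambda>j. x (z + int j)) [0..<n]"

definition rep :: "nat \<Rightarrow> 'a list \<Rightarrow> 'a list" where
  "rep m u = concat (replicate m u)"

definition per :: "'a list \<Rightarrow> int \<Rightarrow> 'a" where
  "per u z = u ! nat (z mod int (length u))"

text \<open>The sequence \<open>\<dots> u u u c u' u' u' \<dots>\<close> with \<open>c\<close> at
positions \<open>0, \<dots>, length c - 1\<close>. Such sequences describe a change from one word
to another, irrespective of the lengths of the two runs.\<close>

definition het :: "'a list \<Rightarrow> 'a list \<Rightarrow> 'a list \<Rightarrow> int \<Rightarrow> 'a" where
  "het u c u' z =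
     (if z < 0 then per u z else if z < int (length c) then c ! nat z
      else per u' (z - int (length c)))"

lemma length_win [simp]: "length (win x z n) = n"
  by (simp add: win_def)

lemma nth_win [simp]: "j < n \<Longrightarrow> win x z n ! j = x (z + int j)"
  by (simp add: win_def)

lemma win_0 [simp]: "win x z 0 = []"
  by (simp add: win_def)

lemma win_cong: "(\<And>j. j < n \<Longrightarrow> x (z + int j) = y (z' + int j)) \<Longrightarrow> win x z n = win y z' n"
  by (simp add: win_def)

lemma win_eq_iff: "win x z n = win y z' n \<longleftrightarrow> (\<forall>j<n. x (z + int j) = y (z' + int j))"
  by (auto simp: list_eq_iff_nth_eq)

lemma win_add: "win x z (m + n) = win x z m @ win x (z + int m) n"
  by (rule nth_equalityI) (auto simp: nth_append ac_simps of_nat_diff)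

lemma sublist_win:
  assumes "sublist w (win x z n)"
  obtains k where "w = win x (z + int k) (length w)" "k + length w \<le> n"
proof -
  obtain p s where ps: "win x z n = p @ w @ s"
    using assms unfolding sublist_def by blast
  have len: "n = length p + length w + length s"
    using arg_cong[OF ps, of length] by simp
  have "w = win x (z + int (length p)) (length w)"
  proof (rule nth_equalityI)
    fix j assume j: "j < length w"
    have "win x z n ! (length p + j) = w ! j"
      unfolding ps using j by (simp add: nth_append)
    then show "w ! j = win x (z + int (length p)) (length w) ! j"
      using j len by (simp add: ac_simps)
  qed simp
  then show ?thesis using len by (intro that[of "length p"]) auto
qed

lemma win_sublist_win:
  assumes "z \<le> z'" "z' + int m \<le> z + int n"
  shows "sublist (win x z' m) (win x z n)"
proof -
  have n: "n = nat (z' - z) + (m + nat (z + int n - (z' + int m)))"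
    using assms by simp
  show ?thesis
    by (subst n, subst win_add, subst win_add) (use assms in \<open>auto simp: sublist_def\<close>)
qed

lemma rep_0 [simp]: "rep 0 u = []" and rep_Suc: "rep (Suc m) u = u @ rep m u"
  by (simp_all add: rep_def)

lemma rep_1 [simp]: "rep (Suc 0) u = u"
  by (simp add: rep_def)

lemma rep_add: "rep (m + n) u = rep m u @ rep n u"
  by (simp add: rep_def replicate_add)

lemma rep_Suc_right: "rep (Suc m) u = rep m u @ u"
  using rep_add[of m 1 u] by simp

lemma length_rep [simp]: "length (rep m u) = m * length u"
  by (induction m) (auto simp: rep_Suc)

lemma set_rep: "set (rep m u) \<subseteq> set u"
  by (auto simp: rep_def)

lemma nth_rep: "k < m * length u \<Longrightarrow> rep m u ! k = u ! (k mod length u)"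
proof (induction m arbitrary: k)
  case (Suc m)
  show ?case
  proof (cases "k < length u")
    case False
    then have "rep (Suc m) u ! k = rep m u ! (k - length u)"
      by (simp add: rep_Suc nth_append)
    also have "\<dots> = u ! ((k - length u) mod length u)"
      using Suc False by (intro Suc.IH) auto
    also have "(k - length u) mod length u = k mod length u"
      using False by (simp add: le_mod_geq)
    finally show ?thesis .
  qed (simp add: rep_Suc nth_append)
qed simp

lemma per_of_nat: "per u (int k) = u ! (k mod length u)"
  by (simp add: per_def flip: zmod_int)

lemma per_add_period: "per u (z + k * int (length u)) = per u z"
  by (simp add: per_def)

lemma rep_eq_win: "rep m u = win (per u) 0 (m * length u)"
  by (rule nth_equalityI) (auto simp: nth_rep per_of_nat)

lemma het_eq_win:
  "rep a u @ c @ rep b u' =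
     win (het u c u') (- int (a * length u)) (a * length u + (length c + b * length u'))"
proof -
  have 1: "win (het u c u') (- int (a * length u)) (a * length u) = rep a u"
    unfolding rep_eq_win
  proof (rule win_cong)
    fix j assume "j < a * length u"
    then have "int j < int (a * length u)" by linarith
    then have "het u c u' (- int (a * length u) + int j) = per u (- int (a * length u) + int j)"
      by (simp add: het_def del: of_nat_mult)
    also have "\<dots> = per u (0 + int j)"
      using per_add_period[of u "int j" "- int a"] by (simp add: algebra_simps)
    finally show "het u c u' (- int (a * length u) + int j) = per u (0 + int j)" .
  qed
  have 2: "win (het u c u') 0 (length c) = c"
    by (rule nth_equalityI) (auto simp: het_def)
  have 3: "win (het u c u') (int (length c)) (b * length u') = rep b u'"
    unfolding rep_eq_win by (rule win_cong) (simp add: het_def)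
  show ?thesis
    using 1 2 3 by (simp only: win_add) simp
qed

lemma sublist_het:
  assumes "sublist w (rep a u @ c @ rep b u')"
  obtains z where "w = win (het u c u') z (length w)"
  using assms unfolding het_eq_win by (elim sublist_win) blast

text \<open>A word that meets \<open>a\<close>, contains \<open>m\<close> and meets
\<open>b\<close> is at least two letters longer than \<open>m\<close>. This is the only reason why
long runs keep short factors simple.\<close>

lemma sublist_split:
  assumes "sublist w (a @ m @ b)" "length w \<le> length m"
  shows "sublist w (a @ m) \<or> sublist w (m @ b)"
proof -
  obtain p s where ps: "a @ m @ b = p @ w @ s"
    using assms(1) unfolding sublist_def by blast
  show ?thesis
  proof (cases "length a \<le> length p")
    case True
    have "drop (length a) (a @ m @ b) = drop (length a) (p @ w @ s)" by (simp only: ps)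
    then have "m @ b = drop (length a) p @ w @ s" using True by simp
    then show ?thesis unfolding sublist_def by blast
  next
    case False
    have le: "length p + length w \<le> length a + length m" using False assms(2) by simp
    have "take (length a + length m) (a @ m @ b) = take (length a + length m) (p @ w @ s)"
      by (simp only: ps)
    then have "a @ m = p @ w @ take (length a + length m - length p - length w) s"
      using le by simp
    then show ?thesis unfolding sublist_def by blast
  qed
qed

lemma sublist_appI1: "sublist w a \<Longrightarrow> sublist w (a @ b)"
  and sublist_appI2: "sublist w b \<Longrightarrow> sublist w (a @ b)"
  by (auto simp: sublist_append)

lemma sublist_rep_mono: "m \<le> n \<Longrightarrow> sublist (rep m u) (rep n u)"
  using rep_add[of m "n - m" u] by (simp add: sublist_appI1)

text \<open>A run of stage \<open>n\<close> is at least \<open>T n\<close> times as long as the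
words of this stage and the short runs before it together. The inverse of \<open>T\<close> must be
summable, since it bounds the change of frequencies from \<open>v n\<close> to \<open>v (n +
d)\<close>.\<close>

section \<open>The tower of words\<close>

definition T :: "nat \<Rightarrow> nat" where "T n = 4 ^ (n + 2)"

definition add_run :: "nat \<Rightarrow> nat \<Rightarrow> nat list \<Rightarrow> nat list \<Rightarrow> nat list" where
  "add_run t S c u = c @ rep (t * (length c + S)) u"

definition next_word :: "nat \<Rightarrow> nat list list \<Rightarrow> nat list" where
  "next_word t us =
     (let S = sum_list (map length us); c = foldl (add_run t S) [] (tl us);
          p = rep (t * (length c + S)) (hd us)
      in p @ c @ p)"

text \<open>The recursion has order \<open>d\<close>. It is therefore run on the list of the
\<open>d\<close> current words: the first one leaves, and the new word enters at the end.\<close>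

primrec state :: "nat \<Rightarrow> nat \<Rightarrow> nat list list" where
  "state e 0 = map (\<lambda>i. [i]) [0..<Suc e]"
| "state e (Suc n) = tl (state e n) @ [next_word (T n) (state e n)]"

locale tower =
  fixes e :: nat
  assumes e_pos: "e \<ge> 1"
begin

definition v :: "nat \<Rightarrow> nat list" where "v n = hd (state e n)"

definition S :: "nat \<Rightarrow> nat" where "S n = (\<Sum>i\<le>e. length (v (n + i)))"

text \<open>The first \<open>j\<close> short runs of stage \<open>n\<close>. For \<open>j =
e\<close> this is what separates the two long runs of \<open>v n\<close> in \<open>v (n +
d)\<close>; for smaller \<open>j\<close> it is what a factor of medium length can see of it
between two long runs.\<close>

primrec C :: "nat \<Rightarrow> nat \<Rightarrow> nat list" where
  "C n 0 = []"
| "C n (Suc j) = C n j @ rep (T n * (length (C n j) + S n)) (v (Suc (n + j)))"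

definition q :: "nat \<Rightarrow> nat \<Rightarrow> nat" where "q n j = T n * (length (C n j) + S n)"

lemma C_Suc: "C n (Suc j) = C n j @ rep (q n j) (v (Suc (n + j)))"
  by (simp add: q_def)

declare C.simps(2) [simp del]

lemma length_state: "length (state e n) = Suc e"
  by (induction n) auto

lemma state_nth: "i \<le> e \<Longrightarrow> state e n ! i = v (n + i)"
proof (induction i arbitrary: n)
  case 0
  then show ?case using length_state[of n] by (simp add: v_def hd_conv_nth length_greater_0_conv[symmetric] del: length_greater_0_conv)
next
  case (Suc i)
  then have "state e n ! Suc i = state e (Suc n) ! i"
    using length_state[of n] by (simp add: nth_append nth_tl)
  also have "\<dots> = v (Suc (n + i))" using Suc.IH[of "Suc n"] Suc.prems by (simp del: state.simps)
  finally show ?case by simp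
qed

lemma state_eq: "state e n = map v [n..<n + Suc e]"
  by (rule nth_equalityI) (auto simp: length_state state_nth less_Suc_eq_le simp del: upt_Suc)

lemma v_base: "i \<le> e \<Longrightarrow> v i = [i]"
  using state_nth[of i 0] by (simp add: less_Suc_eq_le del: upt_Suc)

text \<open>The new word starts and ends with a long run of \<open>v n\<close>. With these two
runs, the change from \<open>v (n + e)\<close> to \<open>v (n + d)\<close> looks like a change to
\<open>v n\<close>, and the change from \<open>v (n + d)\<close> to \<open>v (n + 1)\<close> looks
like a change from \<open>v n\<close>; so no new kind of change arises there.\<close>

lemma v_rec: "v (Suc (n + e)) = rep (q n e) (v n) @ C n e @ rep (q n e) (v n)"
proof -
  have "v (Suc (n + e)) = state e (Suc n) ! e"
    using state_nth[of e "Suc n"] by (simp del: state.simps)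
  also have "\<dots> = next_word (T n) (state e n)"
    using length_state[of n] by (simp add: nth_append)
  also have "\<dots> = rep (q n e) (v n) @ C n e @ rep (q n e) (v n)"
  proof -
    have S: "sum_list (map length (state e n)) = S n"
    proof -
      have "sum_list (map length (state e n)) = sum_list (map (\<lambda>i. length (v (n + i))) [0..<Suc e])"
        unfolding state_eq by (rule arg_cong[of _ _ sum_list], rule nth_equalityI) (auto simp del: upt_Suc)
      also have "\<dots> = S n"
        unfolding S_def by (simp add: sum_list_distinct_conv_sum_set atLeast0LessThan lessThan_Suc_atMost del: upt_Suc)
      finally show ?thesis .
    qed
    have C: "foldl (add_run (T n) (S n)) [] (map v [Suc n..<Suc n + j]) = C n j" for j
      by (induction j) (auto simp: add_run_def C.simps(2))
    have tl: "tl (state e n) = map v [Suc n..<Suc n + e]" "hd (state e n) = v n"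
      unfolding state_eq by (simp_all add: map_tl[symmetric] v_def hd_map del: upt_Suc)
    show ?thesis
      unfolding next_word_def Let_def S tl C q_def ..
  qed
  finally show ?thesis .
qed

lemma T_pos: "T n \<ge> 1" by (simp add: T_def)

lemma v_nonempty: "v n \<noteq> []"
proof (induction n rule: less_induct)
  case (less n)
  show ?case
  proof (cases "n \<le> e")
    case False
    define m where "m = n - Suc e"
    have n: "n = Suc (m + e)" using False by (simp add: m_def)
    have "v m \<noteq> []" by (rule less) (simp add: n)
    then have "length (v m) > 0" by simp
    moreover have "S m \<ge> length (v m)"
      unfolding S_def by (rule order_trans[OF _ member_le_sum[of 0]]) auto
    ultimately have "S m > 0" by linarith
    moreover have "T m > 0" using T_pos[of m] by linarith
    ultimately have "q m e > 0" by (simp add: q_def)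
    then show ?thesis using \<open>v m \<noteq> []\<close>
      unfolding n v_rec by (cases "q m e") (auto simp: rep_Suc)
  qed (simp add: v_base)
qed

lemma length_v_pos: "length (v n) \<ge> 1"
  using v_nonempty[of n] by (cases "v n") auto

lemma length_v_le_S: "i \<le> e \<Longrightarrow> length (v (n + i)) \<le> S n"
  unfolding S_def by (rule member_le_sum) auto

lemma S_pos: "S n \<ge> 1"
  using length_v_le_S[of 0 n] length_v_pos[of n] by simp

lemma q_pos: "q n j \<ge> 1"
  using T_pos[of n] S_pos[of n] by (simp add: q_def)

text \<open>The word whose run comes next after the connecting word \<open>C n j\<close>. For
\<open>j = e\<close> this is the second long run of \<open>v n\<close> itself.\<close>

definition B :: "nat \<Rightarrow> nat \<Rightarrow> nat list" where
  "B n j = (if j < e then v (Suc (n + j)) else v n)"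

definition s :: "nat \<Rightarrow> nat \<Rightarrow> nat" where "s n j = q n j * length (B n j)"

lemma length_B_pos: "length (B n j) \<ge> 1"
  by (simp add: B_def length_v_pos del: One_nat_def)

lemma q_le_s: "q n j \<le> s n j"
  using length_B_pos[of n j] by (simp add: s_def)

lemma s_ge_1: "s n j \<ge> 1"
  using q_le_s[of n j] q_pos[of n j] by linarith

lemma s_lower: "T n * (length (C n j) + S n) \<le> s n j"
  using q_le_s[of n j] by (simp add: q_def)

lemma length_C_Suc: "j < e \<Longrightarrow> length (C n (Suc j)) = length (C n j) + s n j"
  by (simp add: C_Suc s_def B_def)

lemma s_Suc:
  assumes "j < e"
  shows "T n * s n j \<le> s n (Suc j)"
proof -
  have "T n * s n j \<le> T n * (length (C n (Suc j)) + S n)"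
    by (rule mult_le_mono2) (simp add: length_C_Suc assms)
  also have "\<dots> \<le> s n (Suc j)" by (rule s_lower)
  finally show ?thesis .
qed

lemma s_mono: "j \<le> k \<Longrightarrow> k \<le> e \<Longrightarrow> s n j \<le> s n k"
proof (induction k)
  case (Suc k)
  show ?case
  proof (cases "j = Suc k")
    case False
    have "s n j \<le> s n k" using Suc.IH Suc.prems False by simp
    also have "\<dots> \<le> T n * s n k" using T_pos[of n] by simp
    also have "\<dots> \<le> s n (Suc k)" using s_Suc[of k n] Suc.prems by simp
    finally show ?thesis .
  qed simp
qed simp

lemma length_v_rec: "length (v (Suc (n + e))) = 2 * s n e + length (C n e)"
  unfolding v_rec by (simp add: s_def B_def)

lemma s_next: "s n e \<le> s (Suc n) 0" "2 * s n e \<le> S (Suc n)"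
proof -
  have *: "2 * s n e \<le> length (v (Suc (n + e)))" by (simp add: length_v_rec)
  also have "\<dots> \<le> S (Suc n)" using length_v_le_S[of e "Suc n"] by simp
  finally show "2 * s n e \<le> S (Suc n)" .
  also have "S (Suc n) \<le> T (Suc n) * S (Suc n)" using T_pos[of "Suc n"] by simp
  also have "\<dots> \<le> s (Suc n) 0" using s_lower[of "Suc n" 0] by simp
  finally show "s n e \<le> s (Suc n) 0" by simp
qed

lemma s_0_strict: "s n 0 < s (Suc n) 0"
proof -
  have "s n 0 \<le> s n e" by (rule s_mono) auto
  moreover have "s n e \<ge> 1" using q_pos[of n e] q_le_s[of n e] by linarith
  moreover have "S (Suc n) \<le> s (Suc n) 0"
  proof -
    have "S (Suc n) \<le> T (Suc n) * S (Suc n)" using T_pos[of "Suc n"] by simp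
    also have "\<dots> \<le> s (Suc n) 0" using s_lower[of "Suc n" 0] by simp
    finally show ?thesis .
  qed
  ultimately show ?thesis using s_next(2)[of n] by linarith
qed

section \<open>Factors at a given scale\<close>

definition Lang :: "nat list set" where "Lang = {w. \<exists>m. sublist w (v m)}"

lemma Lang_sublist: "sublist w u \<Longrightarrow> u \<in> Lang \<Longrightarrow> w \<in> Lang"
  unfolding Lang_def using sublist_order.order_trans by blast

lemma v_Lang: "v m \<in> Lang"
  unfolding Lang_def by auto

lemma C_prefix: "j \<le> k \<Longrightarrow> prefix (C n j) (C n k)"
proof (induction k)
  case (Suc k)
  then show ?case by (cases "j = Suc k") (auto simp: C_Suc intro: prefix_order.trans)
qed simp

lemma run_prefix: "j \<le> e \<Longrightarrow> prefix (rep (q n e) (v n) @ C n j @ rep (q n j) (B n j)) (v (Suc (n + e)))"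
proof (cases "j = e")
  case True
  then show ?thesis by (simp add: v_rec B_def)
next
  case False
  assume "j \<le> e"
  then have "prefix (C n (Suc j)) (C n e)" using False by (intro C_prefix) auto
  then have "prefix (C n j @ rep (q n j) (B n j)) (C n e)"
    using False \<open>j \<le> e\<close> by (simp add: C_Suc B_def)
  then show ?thesis unfolding v_rec by (auto simp: prefix_def)
qed

lemma v_sublist_step: "n < m \<Longrightarrow> m \<le> n + Suc e \<Longrightarrow> Suc e \<le> m \<Longrightarrow> sublist (v n) (v m)"
proof -
  assume a: "n < m" "m \<le> n + Suc e" "Suc e \<le> m"
  define k where "k = m - Suc e"
  have m: "m = Suc (k + e)" using a by (simp add: k_def)
  have base: "sublist u (rep (q i j) u)" for u i j
    using sublist_rep_mono[of 1 "q i j" u] q_pos[of i j] by simp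
  show ?thesis
  proof (cases "n = k")
    case True
    then show ?thesis unfolding m v_rec by (simp add: base sublist_appI1)
  next
    case False
    define j where "j = n - Suc k"
    have j: "n = k + Suc j" "j < e" using False a m by (auto simp: j_def)
    then have "B k j = v n" by (simp add: B_def)
    then have "sublist (v n) (rep (q k e) (v k) @ C k j @ rep (q k j) (B k j))"
      by (simp add: base sublist_appI2)
    moreover have "sublist \<dots> (v m)"
      unfolding m using j by (intro prefix_imp_sublist run_prefix) simp
    ultimately show ?thesis using sublist_order.order_trans by blast
  qed
qed

lemma v_sublist: "n < m \<Longrightarrow> Suc e \<le> m \<Longrightarrow> sublist (v n) (v m)"
proof (induction m rule: less_induct)
  case (less m)
  show ?case
  proof (cases "m \<le> n + Suc e")
    case True
    then show ?thesis using less.prems by (intro v_sublist_step) auto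
  next
    case False
    then have "sublist (v n) (v (m - 1))"
      using less.prems by (intro less.IH) auto
    moreover have "sublist (v (m - 1)) (v m)"
      using less.prems by (intro v_sublist_step) auto
    ultimately show ?thesis using sublist_order.order_trans by blast
  qed
qed

text \<open>The cyclic order \<open>v n \<rightarrow> v (n + 1) \<rightarrow> \<dots>
\<rightarrow> v (n + e) \<rightarrow> v n\<close> of the words of stage \<open>n\<close>.\<close>

definition succ_index :: "nat \<Rightarrow> nat \<Rightarrow> nat" where "succ_index n i = (if i < e then Suc (n + i) else n)"

text \<open>Factors that see at most one change of word at stage \<open>n\<close>.\<close>

definition normal :: "nat \<Rightarrow> nat list \<Rightarrow> bool" where
  "normal n w \<longleftrightarrow> (\<exists>i\<le>e. \<exists>a b. sublist w (rep a (v (n + i)) @ rep b (v (succ_index n i))))"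

text \<open>Factors that may see the first \<open>j\<close> short runs completely.\<close>

definition extra :: "nat \<Rightarrow> nat \<Rightarrow> nat list \<Rightarrow> bool" where
  "extra n j w \<longleftrightarrow> sublist w (rep (q n e) (v n) @ C n j @ rep (q n j) (B n j))"

lemma normalI: "i \<le> e \<Longrightarrow> sublist w (rep a (v (n + i)) @ rep b (v (succ_index n i))) \<Longrightarrow> normal n w"
  unfolding normal_def by blast

text \<open>A run that is at least as long as the factor can be cut, so the last short runs are
removed one after the other until the \<open>j\<close>-th run.\<close>

lemma extra_reduce:
  assumes "length w \<le> s n j" "j \<le> k" "k \<le> e" "extra n k w"
  shows "normal n w \<or> extra n j w"
  using assms
proof (induction k)
  case (Suc k)
  show ?case
  proof (cases "j = Suc k")
    case False
    have k: "k < e" "j \<le> k" using Suc.prems False by auto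
    have Bk: "B n k = v (Suc (n + k))" "B n (Suc k) = v (succ_index n (Suc k))"
      using k by (auto simp: B_def succ_index_def)
    have "length w \<le> length (rep (q n k) (B n k))"
      using s_mono[of j k n] k Suc.prems by (simp add: s_def)
    moreover have "sublist w ((rep (q n e) (v n) @ C n k) @ rep (q n k) (B n k) @ rep (q n (Suc k)) (B n (Suc k)))"
      using Suc.prems(4) k by (simp add: extra_def C_Suc Bk)
    ultimately have "sublist w ((rep (q n e) (v n) @ C n k) @ rep (q n k) (B n k)) \<or>
        sublist w (rep (q n k) (B n k) @ rep (q n (Suc k)) (B n (Suc k)))"
      by (intro sublist_split)
    then show ?thesis
    proof
      assume "sublist w ((rep (q n e) (v n) @ C n k) @ rep (q n k) (B n k))"
      then have "extra n k w" by (simp add: extra_def)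
      then show ?thesis using Suc k by simp
    next
      assume "sublist w (rep (q n k) (B n k) @ rep (q n (Suc k)) (B n (Suc k)))"
      then have "normal n w" unfolding Bk using k by (intro normalI[of "Suc k"]) auto
      then show ?thesis ..
    qed
  qed (use Suc.prems in auto)
qed auto

text \<open>A power of the new word is expanded. Each of its long runs of \<open>v n\<close> is a
place where the factor can be cut; what is left are the two ends, the pieces \<open>v n ^ q
\<cdot> C n e \<cdot> v n ^ q\<close> and the double runs of \<open>v n\<close>.\<close>

lemma expand_reduce:
  assumes w: "length w \<le> s n e"
    and A: "\<And>w. sublist w (A @ rep (q n e) (v n)) \<Longrightarrow> normal n w \<or> extra n e w"
    and Z: "\<And>w. sublist w (rep (q n e) (v n) @ Z) \<Longrightarrow> normal n w \<or> extra n e w"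
    and "sublist w (A @ rep b (v (Suc (n + e))) @ Z)" "b \<ge> 1"
  shows "normal n w \<or> extra n e w"
  using \<open>b \<ge> 1\<close> A assms(4)
proof (induction b arbitrary: A rule: dec_induct)
  case base
  let ?p = "rep (q n e) (v n)"
  have len: "length w \<le> length ?p" using w by (simp add: s_def B_def)
  have "sublist w (A @ ?p @ (C n e @ ?p @ Z))" using base by (simp add: v_rec)
  then consider "sublist w (A @ ?p)" | "sublist w ((?p @ C n e) @ ?p @ Z)"
    using sublist_split[OF _ len] by fastforce
  then show ?case
  proof cases
    case 2
    then consider "sublist w ((?p @ C n e) @ ?p)" | "sublist w (?p @ Z)"
      using sublist_split[OF _ len] by blast
    then show ?thesis using Z by cases (auto simp: extra_def B_def)
  qed (use base in blast)
next
  case (step b)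
  let ?p = "rep (q n e) (v n)"
  have len: "length w \<le> length ?p" using w by (simp add: s_def B_def)
  have "sublist w (A @ ?p @ (C n e @ ?p @ rep b (v (Suc (n + e))) @ Z))"
    using step.prems by (simp add: v_rec rep_Suc)
  then consider "sublist w (A @ ?p)" | "sublist w ((?p @ C n e) @ ?p @ (rep b (v (Suc (n + e))) @ Z))"
    using sublist_split[OF _ len] by fastforce
  then show ?case
  proof cases
    case 2
    then consider "sublist w ((?p @ C n e) @ ?p)" | "sublist w (?p @ rep b (v (Suc (n + e))) @ Z)"
      using sublist_split[OF _ len] by blast
    then show ?thesis
    proof cases
      case 2
      show ?thesis
      proof (rule step.IH[OF _ 2])
        fix w assume "sublist w (?p @ ?p)"
        then have "sublist w (rep (q n e + q n e) (v (n + 0)) @ rep 0 (v (succ_index n 0)))"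
          by (simp add: rep_add)
        then show "normal n w \<or> extra n e w" using normalI[of 0] by blast
      qed
    qed (auto simp: extra_def B_def)
  qed (use step in blast)
qed

text \<open>Among the \<open>d\<close> changes of stage \<open>n + 1\<close> all but those next to
\<open>v (n + d)\<close> are changes of stage \<open>n\<close>. The two other ones are
expanded.\<close>

lemma normal_Suc:
  assumes "normal (Suc n) w" "length w \<le> s n j" "j \<le> e"
  shows "normal n w \<or> extra n j w"
proof -
  have len: "length w \<le> s n e" using assms(2) s_mono[of j e n] assms(3) by linarith
  have simple: "normal n w" if "sublist w (rep a (v (n + i)))" "i \<le> e" for a i w
    using that normalI[of i w a n 0] by simp
  have "normal n w \<or> extra n e w"
  proof -
    obtain i a b where i: "i \<le> e" and w: "sublist w (rep a (v (Suc (n + i))) @ rep b (v (succ_index (Suc n) i)))"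
      using assms(1) unfolding normal_def add_Suc by blast
    consider (1) "Suc i < e" | (2) "Suc (n + i) = n + e" "i < e" | (3) "i = e" using i by linarith
    then show ?thesis
    proof cases
      case 1
      then show ?thesis
        using w normalI[of "Suc i" w a n b] by (simp add: succ_index_def)
    next
      case 2
      then have w: "sublist w (rep a (v (n + e)) @ rep b (v (Suc (n + e))))"
        using w by (simp only: succ_index_def if_True add_Suc 2)
      show ?thesis
      proof (cases "b = 0")
        case True
        then show ?thesis using w simple[of w a e] by simp
      next
        case False
        show ?thesis
        proof (rule expand_reduce[OF len, of "rep a (v (n + e))" "[]" b])
          show "normal n w \<or> extra n e w" if "sublist w (rep a (v (n + e)) @ rep (q n e) (v n))" for w
            using that normalI[of e w a n "q n e"] by (simp add: succ_index_def)
          show "normal n w \<or> extra n e w" if "sublist w (rep (q n e) (v n) @ [])" for w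
            using simple[of w "q n e" 0] that by simp
          show "sublist w (rep a (v (n + e)) @ rep b (v (Suc (n + e))) @ [])"
            using w by simp
        qed (use False in simp)
      qed
    next
      case 3
      show ?thesis
      proof (cases "a = 0")
        case True
        then show ?thesis using w 3 simple[of w b 1] e_pos by (simp add: succ_index_def)
      next
        case False
        show ?thesis
        proof (rule expand_reduce[OF len, of "[]" "rep b (v (Suc n))" a])
          show "normal n w \<or> extra n e w" if "sublist w (rep (q n e) (v n) @ rep b (v (Suc n)))" for w
            using that normalI[of 0 w "q n e" n b] e_pos by (simp add: succ_index_def)
          show "normal n w \<or> extra n e w" if "sublist w ([] @ rep (q n e) (v n))" for w
            using simple[of w "q n e" 0] that by simp
          show "sublist w ([] @ rep a (v (Suc (n + e))) @ rep b (v (Suc n)))"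
            using w 3 by (simp add: succ_index_def)
        qed (use False in simp)
      qed
    qed
  qed
  then show ?thesis using extra_reduce[of w n j e] assms by blast
qed

lemma Lang_large: 
  assumes "w \<in> Lang" obtains m where "m \<ge> n" "sublist w (v m)"
proof -
  obtain m where m: "sublist w (v m)" using assms unfolding Lang_def by blast
  have "sublist (v m) (v (Suc (m + n + e)))" by (rule v_sublist) auto
  from sublist_order.order_trans[OF m this] show ?thesis
    by (rule that[of "Suc (m + n + e)", rotated]) simp
qed

lemma extra_0: "extra n 0 w \<Longrightarrow> normal n w"
  unfolding extra_def using e_pos normalI[of 0 w "q n e" n "q n 0"] by (simp add: B_def succ_index_def)

text \<open>In the stage \<open>m\<close> the word \<open>v m\<close> itself has no change at all.
From there one descends to stage \<open>n\<close>; the factor stays short compared with the runs,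
because \<open>s k 0\<close> increases with \<open>k\<close>.\<close>

theorem Lang_normal:
  assumes "w \<in> Lang" "length w \<le> s n 0"
  shows "normal n w"
proof -
  obtain m where m: "m \<ge> n" "sublist w (v m)" using Lang_large[OF assms(1)] .
  have "length w \<le> s n 0 \<longrightarrow> normal n w"
    using m(1)
  proof (induction rule: inc_induct)
    case base
    show ?case using normalI[of 0 w 1 m 0] m(2) by simp
  next
    case (step k)
    show ?case
    proof
      assume *: "length w \<le> s k 0"
      then have "normal (Suc k) w" using step.IH s_0_strict[of k] by simp
      then show "normal k w" using normal_Suc[of k w 0] * extra_0 by blast
    qed
  qed
  then show ?thesis using assms(2) by blast
qed

theorem Lang_normal_or_extra:
  assumes "w \<in> Lang" "length w \<le> s n j" "j \<le> e"
  shows "normal n w \<or> extra n j w"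
proof -
  have "length w \<le> s (Suc n) 0"
    using assms s_mono[of j e n] s_next(1)[of n] by linarith
  then show ?thesis using normal_Suc[of n w j] Lang_normal[of w "Suc n"] assms by blast
qed

end

section \<open>Upper bounds for the complexity\<close>

definition periodic_words :: "'a list \<Rightarrow> nat \<Rightarrow> 'a list set" where
  "periodic_words u N = {win (per u) z N | z. True}"

lemma periodic_words_eq: "u \<noteq> [] \<Longrightarrow> periodic_words u N = (\<lambda>z. win (per u) z N) ` {a..<a + int (length u)}"
proof
  assume u: "u \<noteq> []"
  show "periodic_words u N \<subseteq> (\<lambda>z. win (per u) z N) ` {a..<a + int (length u)}"
  proof
    fix w assume "w \<in> periodic_words u N"
    then obtain z where w: "w = win (per u) z N" by (auto simp: periodic_words_def)
    define L where "L = int (length u)"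
    have L: "L > 0" using u by (simp add: L_def)
    \<comment> \<open>The representative of \<open>z\<close> modulo the period in the interval
      that starts at \<open>a\<close>.\<close>
    define z' where "z' = a + (z - a) mod L"
    have "z' = z + (- ((z - a) div L)) * L"
      unfolding z'_def by (simp add: minus_div_mult_eq_mod[symmetric] algebra_simps)
    then have "per u (z' + int j) = per u (z + int j)" for j
      using per_add_period[of u "z + int j" "- ((z - a) div L)"] by (simp only: L_def) (simp only: ac_simps)
    then have "w = win (per u) z' N" unfolding w by (intro win_cong) simp
    moreover have "z' \<in> {a..<a + L}" using L by (simp add: z'_def)
    ultimately show "w \<in> (\<lambda>z. win (per u) z N) ` {a..<a + int (length u)}" by (simp add: L_def)
  qed
qed (auto simp: periodic_words_def)

lemma periodic_words_card: "u \<noteq> [] \<Longrightarrow> finite (periodic_words u N) \<and> card (periodic_words u N) \<le> length u"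
  unfolding periodic_words_eq[where a = 0] using card_image_le[of "{0..<0 + int (length u)}" "\<lambda>z. win (per u) z N"] by simp

lemma per_rotate: "per (a @ b) z = per (b @ a) (z - int (length a))"
proof (cases "a @ b = []")
  case False
  define L where "L = int (length a + length b)"
  have L: "L > 0" "length (a @ b) = nat L" "int (length (b @ a)) = L" "int (length (a @ b)) = L"
    using False by (cases a; cases b; simp add: L_def; linarith)+
  define k where "k = z mod L"
  have k: "0 \<le> k" "k < L" using L by (auto simp: k_def)
  have eq: "(z - int (length a)) mod L = (k - int (length a)) mod L"
    by (simp add: k_def mod_simps)
  show ?thesis
  proof (cases "k < int (length a)")
    case True
    have "(k - int (length a)) mod L = (k - int (length a) + L) mod L" by simp
    also have "\<dots> = k - int (length a) + L" using k True by (intro mod_pos_pos_trivial) (auto simp: L_def)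
    finally have "(z - int (length a)) mod L = k + int (length b)" using eq by (simp add: L_def)
    then show ?thesis
      using True k unfolding per_def L(3,4) k_def[symmetric]
      by (simp add: nth_append nat_add_distrib nat_less_iff)
  next
    case False
    then have "(k - int (length a)) mod L = k - int (length a)"
      using k by (intro mod_pos_pos_trivial) (auto simp: L_def)
    then have "(z - int (length a)) mod L = k - int (length a)" using eq by simp
    then show ?thesis
      using False k unfolding per_def L(3,4) k_def[symmetric]
      by (auto simp: nth_append nat_diff_distrib L_def)
  qed
qed (simp add: per_def)

lemma periodic_words_rotate: "periodic_words (a @ b) N = periodic_words (b @ a) N"
proof -
  have "periodic_words (a @ b) N \<subseteq> periodic_words (b @ a) N" for a b :: "'a list"
  proof
    fix w assume "w \<in> periodic_words (a @ b) N"
    then obtain z where "w = win (per (a @ b)) z N" by (auto simp: periodic_words_def)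
    also have "\<dots> = win (per (b @ a)) (z - int (length a)) N"
      by (rule win_cong) (subst per_rotate, simp add: algebra_simps)
    finally show "w \<in> periodic_words (b @ a) N" by (auto simp: periodic_words_def)
  qed
  then show ?thesis by blast
qed

lemma per_tail_run:
  assumes "int (length c) \<le> z" "z < int (length c + m * length x)"
  shows "per (c @ rep m x) z = per x (z - int (length c))"
proof -
  have z: "z mod int (length (c @ rep m x)) = z" using assms by (intro mod_pos_pos_trivial) auto
  obtain k where k: "z = int (length c) + int k" using assms(1) zle_iff_zadd by blast
  then have "k < m * length x" using assms(2) by (simp flip: of_nat_mult)
  then show ?thesis unfolding per_def[of "c @ _"] z using k
    by (simp add: nth_append nat_add_distrib nth_rep per_of_nat)
qed

text \<open>Apart from factors inside the run of \<open>x\<close>, a factor of the periodic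
sequence has to meet \<open>c\<close>, which leaves \<open>N + length c\<close> positions. If
\<open>N\<close> exceeds the run, the period \<open>length c + m * length x\<close> is a bound
that is small enough. The estimate is used for \<open>v (n + d)\<close> at lengths
\<open>N\<close> that are smaller than this word.\<close>

lemma periodic_words_run_card:
  assumes x: "x \<noteq> []" and m: "m \<ge> 1"
  shows "card (periodic_words (c @ rep m x) N) \<le> N + length c + length x"
proof -
  let ?u = "c @ rep m x"
  have u: "?u \<noteq> []" using x m by (cases m) (auto simp: rep_Suc)
  show ?thesis
  proof (cases "m * length x \<le> N")
    case True
    then show ?thesis using periodic_words_card[OF u, of N] by simp
  next
    case False
    let ?l = "int (length c)" and ?r = "int (m * length x)"
    \<comment> \<open>The period is read from the beginning of the run of \<open>x\<close>, so
      that the windows inside this run come first.\<close>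
    have "periodic_words ?u N \<subseteq> periodic_words x N \<union> (\<lambda>z. win (per ?u) z N) ` {?l + ?r - int N<..<?l + ?r + ?l}"
    proof
      fix w assume "w \<in> periodic_words ?u N"
      then obtain z where z: "w = win (per ?u) z N" "z \<in> {?l..<?l + (?l + ?r)}"
        unfolding periodic_words_eq[OF u, of N ?l] by auto
      show "w \<in> periodic_words x N \<union> (\<lambda>z. win (per ?u) z N) ` {?l + ?r - int N<..<?l + ?r + ?l}"
      proof (cases "z \<le> ?l + ?r - int N")
        case True
        have "w = win (per x) (z - ?l) N"
          unfolding z(1)
        proof (rule win_cong)
          fix j assume "j < N"
          then have "per ?u (z + int j) = per x (z + int j - ?l)"
            using True z(2) by (intro per_tail_run) auto
          then show "per ?u (z + int j) = per x (z - ?l + int j)" by (simp add: algebra_simps)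
        qed
        then show ?thesis by (auto simp: periodic_words_def)
      next
        case False
        then show ?thesis using z by auto
      qed
    qed
    then have "card (periodic_words ?u N) \<le> card (periodic_words x N \<union> (\<lambda>z. win (per ?u) z N) ` {?l + ?r - int N<..<?l + ?r + ?l})"
      using periodic_words_card[OF x, of N] by (intro card_mono) auto
    also have "\<dots> \<le> card (periodic_words x N) + card {?l + ?r - int N<..<?l + ?r + ?l}"
      using card_Un_le card_image_le[of "{?l + ?r - int N<..<?l + ?r + ?l}"]
      by (meson add_left_mono finite_greaterThanLessThan_int order_trans)
    also have "\<dots> \<le> length x + (N + length c)"
      using periodic_words_card[OF x, of N] by (intro add_mono) auto
    finally show ?thesis by simp
  qed
qed

lemma win_het_neg: "z + int N \<le> 0 \<Longrightarrow> win (het u c u') z N = win (per u) z N"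
  by (rule win_cong) (simp add: het_def)

lemma win_het_pos:
  "int (length c) \<le> z \<Longrightarrow> win (het u c u') z N = win (per u') (z - int (length c)) N"
  by (rule win_cong) (simp add: het_def algebra_simps)

text \<open>A window that starts inside the last run before a change does not see what precedes
that run.\<close>

lemma win_het_last_run:
  assumes "int (length c) \<le> z"
  shows "win (het u0 (c @ rep a u) u') z N = win (het u [] u') (z - int (length c + a * length u)) N"
proof (rule win_cong)
  fix j
  let ?y = "z + int j - int (length c)"
  have y: "?y \<ge> 0" using assms by simp
  show "het u0 (c @ rep a u) u' (z + int j) = het u [] u' (z - int (length c + a * length u) + int j)"
  proof (cases "?y < int (a * length u)")
    case True
    obtain k where k: "?y = int k" using y nonneg_int_cases by blast
    then have zk: "z + int j = int (length c + k)" by simp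
    have ka: "k < a * length u" using True k by (simp only: of_nat_less_iff)
    have "het u0 (c @ rep a u) u' (z + int j) = (c @ rep a u) ! (length c + k)"
      unfolding het_def zk using ka by (simp del: of_nat_add)
    also have "\<dots> = per u (int k)"
      using ka by (simp add: nth_append nth_rep per_of_nat)
    also have "\<dots> = per u (int k + (- int a) * int (length u))"
      by (rule per_add_period[symmetric])
    also have "\<dots> = het u [] u' (z - int (length c + a * length u) + int j)"
    proof -
      have eq: "z - int (length c + a * length u) + int j = int k + (- int a) * int (length u)"
        using k by simp
      have "\<dots> < 0" using True k by simp
      then show ?thesis unfolding eq by (simp only: het_def if_True)
    qed
    finally show ?thesis .
  next
    case False
    then show ?thesis using y by (simp add: het_def algebra_simps)
  qed
qed

lemma card_image_int_interval:
  "finite ((f :: int \<Rightarrow> 'a) ` {- int N<..<int M}) \<and> card (f ` {- int N<..<int M}) \<le> N + M"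
  using card_image_le[of "{- int N<..<int M}" f] by simp

context tower
begin

lemma sublist_two_het:
  assumes "sublist w (rep a u @ rep b u')"
  obtains z where "w = win (het u [] u') z (length w)"
  using sublist_het[of w a u "[]" b u'] assms by auto

definition transition_words :: "nat \<Rightarrow> nat \<Rightarrow> nat \<Rightarrow> nat list set" where
  "transition_words n i N = (\<lambda>z. win (het (v (n + i)) [] (v (succ_index n i))) z N) ` {- int N<..<int 0}"

text \<open>The start positions stop at the last short run: windows that start later see only one
change. This keeps the number of these words at \<open>N + length (C n j)\<close>, with the
connecting word without its longest run.\<close>

definition extra_words :: "nat \<Rightarrow> nat \<Rightarrow> nat \<Rightarrow> nat list set" where
  "extra_words n j N = (\<lambda>z. win (het (v n) (C n (Suc j)) (B n (Suc j))) z N) ` {- int N<..<int (length (C n j))}"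

definition Cover :: "nat \<Rightarrow> nat \<Rightarrow> nat list set" where
  "Cover n N = (\<Union>i\<le>e. transition_words n i N) \<union> (\<Union>i\<le>e. periodic_words (v (n + i)) N)"

lemma succ_periodic_in_Cover: "i \<le> e \<Longrightarrow> win (per (v (succ_index n i))) z N \<in> Cover n N"
proof -
  assume "i \<le> e"
  then have "\<exists>i'\<le>e. succ_index n i = n + i'"
    unfolding succ_index_def by (cases "i < e") (auto intro: exI[of _ "Suc i"] exI[of _ 0])
  then show ?thesis unfolding Cover_def periodic_words_def by fastforce
qed

lemma Cover_het:
  assumes "i \<le> e"
  shows "win (het (v (n + i)) [] (v (succ_index n i))) z N \<in> Cover n N"
proof -
  consider "z + int N \<le> 0" | "z \<ge> 0" | "z \<in> {- int N<..<int 0}" by force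
  then show ?thesis
  proof cases
    case 1
    then show ?thesis using assms by (auto simp: win_het_neg Cover_def periodic_words_def)
  next
    case 2
    then show ?thesis using succ_periodic_in_Cover[OF assms] by (simp add: win_het_pos)
  next
    case 3
    then show ?thesis using assms unfolding Cover_def transition_words_def by blast
  qed
qed

lemma normal_Cover: "normal n w \<Longrightarrow> w \<in> Cover n (length w)"
  unfolding normal_def by (metis sublist_two_het Cover_het)

lemma extra_Cover:
  assumes "extra n (Suc j) w" "Suc j \<le> e"
  shows "w \<in> Cover n (length w) \<union> extra_words n j (length w)"
proof -
  let ?N = "length w"
  obtain z where z: "w = win (het (v n) (C n (Suc j)) (B n (Suc j))) z ?N"
    using assms(1) unfolding extra_def by (elim sublist_het)
  consider "z + int ?N \<le> 0" | "z \<ge> int (length (C n j))" | "z \<in> {- int ?N<..<int (length (C n j))}"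
    by force
  then show ?thesis
  proof cases
    case 1
    have "w = win (per (v (n + 0))) z ?N" using trans[OF z win_het_neg[OF 1]] by simp
    then show ?thesis unfolding Cover_def periodic_words_def by blast
  next
    case 2
    have "B n (Suc j) = v (succ_index n (Suc j))" by (simp add: B_def succ_index_def)
    then have "w = win (het (v (n + Suc j)) [] (v (succ_index n (Suc j))))
        (z - int (length (C n j) + q n j * length (v (n + Suc j)))) ?N"
      using z win_het_last_run[OF 2] by (simp add: C_Suc)
    then have "w \<in> Cover n ?N"
      by (rule ssubst[where P = "\<lambda>x. x \<in> Cover n ?N"]) (rule Cover_het[OF assms(2)])
    then show ?thesis ..
  next
    case 3
    then show ?thesis using z unfolding extra_words_def by blast
  qed
qed

definition LangN :: "nat \<Rightarrow> nat list set" where "LangN N = {w \<in> Lang. length w = N}"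

definition P :: "nat \<Rightarrow> nat" where "P N = card (LangN N)"

lemma Cover_card:
  assumes "\<And>i. i \<le> e \<Longrightarrow> card (periodic_words (v (n + i)) N) \<le> f i"
  shows "finite (Cover n N)" "card (Cover n N) \<le> Suc e * N + (\<Sum>i\<le>e. f i)"
proof -
  show "finite (Cover n N)"
    unfolding Cover_def transition_words_def using periodic_words_card[OF v_nonempty] by auto
  have "card (\<Union>i\<le>e. transition_words n i N) \<le> (\<Sum>i\<le>e. card (transition_words n i N))"
    by (rule card_UN_le) simp
  also have "\<dots> \<le> (\<Sum>i\<le>e. N)"
    unfolding transition_words_def using card_image_int_interval[of _ N 0] by (intro sum_mono) auto
  finally have 1: "card (\<Union>i\<le>e. transition_words n i N) \<le> Suc e * N" by simp
  have "card (\<Union>i\<le>e. periodic_words (v (n + i)) N) \<le> (\<Sum>i\<le>e. card (periodic_words (v (n + i)) N))"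
    by (rule card_UN_le) simp
  also have "\<dots> \<le> (\<Sum>i\<le>e. f i)" using assms by (intro sum_mono) auto
  finally show "card (Cover n N) \<le> Suc e * N + (\<Sum>i\<le>e. f i)"
    unfolding Cover_def using 1 card_Un_le add_mono order_trans by meson
qed

lemma P_upper_normal: "N \<le> s n 0 \<Longrightarrow> P N \<le> Suc e * N + S n"
proof -
  assume N: "N \<le> s n 0"
  have "LangN N \<subseteq> Cover n N"
    using Lang_normal[of _ n] normal_Cover N by (auto simp: LangN_def)
  moreover note Cover_card[of n N "\<lambda>i. length (v (n + i))"]
  ultimately show ?thesis
    unfolding P_def S_def using periodic_words_card[OF v_nonempty] by (meson card_mono order_trans)
qed

lemma P_upper_extra:
  assumes "N \<le> s n (Suc j)" "Suc j \<le> e"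
  shows "P N \<le> Suc (Suc e) * N + S n + length (C n j)"
proof -
  have "LangN N \<subseteq> Cover n N \<union> extra_words n j N"
    using Lang_normal_or_extra[of _ n "Suc j"] normal_Cover extra_Cover assms
    by (fastforce simp: LangN_def)
  moreover have E: "finite (extra_words n j N)" "card (extra_words n j N) \<le> N + length (C n j)"
    unfolding extra_words_def using card_image_int_interval by blast+
  have V: "finite (Cover n N)" "card (Cover n N) \<le> Suc e * N + S n"
    unfolding S_def using Cover_card[of n N "\<lambda>i. length (v (n + i))"] periodic_words_card[OF v_nonempty] by auto
  ultimately have "P N \<le> card (Cover n N \<union> extra_words n j N)"
    unfolding P_def using E by (intro card_mono) auto
  also have "\<dots> \<le> card (Cover n N) + card (extra_words n j N)" by (rule card_Un_le)
  finally show ?thesis using E V by simp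
qed

lemma periodic_words_v_card: "card (periodic_words (v (Suc (n + e))) N) \<le> N + length (C n e) + length (v n)"
proof -
  have "periodic_words (v (Suc (n + e))) N = periodic_words (C n e @ rep (q n e + q n e) (v n)) N"
    unfolding v_rec by (subst periodic_words_rotate) (simp add: rep_add)
  then show ?thesis using periodic_words_run_card[OF v_nonempty, of "q n e + q n e"] q_pos[of n e] by simp
qed

text \<open>For \<open>N\<close> between \<open>s n e\<close> and the length of \<open>v (n +
d)\<close> the number of conjugates of \<open>v (n + d)\<close> would be too large as a bound for
the periodic factors; here \<open>periodic_words_v_card\<close> is needed.\<close>

lemma P_upper_between:
  assumes "N \<le> s (Suc n) 0"
  shows "P N \<le> Suc (Suc e) * N + S n + length (C n e)"
proof -
  define f where "f i = (if i = e then N + length (C n e) + length (v n) else length (v (Suc n + i)))" for i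
  have sub: "LangN N \<subseteq> Cover (Suc n) N"
    using Lang_normal[of _ "Suc n"] normal_Cover assms by (auto simp: LangN_def)
  have "card (periodic_words (v (Suc n + i)) N) \<le> f i" if "i \<le> e" for i
    using periodic_words_v_card[of n N] periodic_words_card[OF v_nonempty, of "Suc n + i" N] by (auto simp: f_def)
  note c = Cover_card[of "Suc n" N f, OF this]
  have "P N \<le> Suc e * N + (\<Sum>i\<le>e. f i)"
    unfolding P_def using c sub by (meson card_mono order_trans)
  also have "(\<Sum>i\<le>e. f i) = (\<Sum>i<e. length (v (n + Suc i))) + (N + length (C n e) + length (v n))"
    by (simp add: lessThan_Suc_atMost[symmetric] f_def)
  also have "(\<Sum>i<e. length (v (n + Suc i))) + length (v n) = S n"
    unfolding S_def using sum.lessThan_Suc_shift[of "\<lambda>i. length (v (n + i))" e]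
    by (simp add: lessThan_Suc_atMost)
  then have "(\<Sum>i<e. length (v (n + Suc i))) + (N + length (C n e) + length (v n)) = S n + N + length (C n e)"
    by simp
  finally show ?thesis by simp
qed

lemma s_step_choice:
  assumes "s n 0 \<le> N" "N < s (Suc n) 0"
  obtains j where "j < e" "s n j \<le> N" "N \<le> s n (Suc j)" | "s n e \<le> N"
proof -
  have "(\<exists>j<k. s n j \<le> N \<and> N \<le> s n (Suc j)) \<or> s n k \<le> N" if "k \<le> e" for k
    using that
  proof (induction k)
    case (Suc k)
    then consider "\<exists>j<k. s n j \<le> N \<and> N \<le> s n (Suc j)" | "s n k \<le> N" by fastforce
    then show ?case
    proof cases
      case 2
      then show ?thesis by (cases "N \<le> s n (Suc k)") auto
    qed (metis less_SucI)
  qed (use assms in auto)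
  then show ?thesis using that by blast
qed

lemma T_mono: "m \<le> n \<Longrightarrow> T m \<le> T n"
  by (simp add: T_def)

lemma n_less_T: "n < T n"
proof -
  have "n < 2 ^ n" by (rule less_exp)
  also have "\<dots> \<le> (4::nat) ^ n" by (rule power_mono) auto
  also have "\<dots> \<le> T n" by (simp add: T_def)
  finally show ?thesis .
qed

lemma n_le_s: "n \<le> s n 0"
proof -
  have "n \<le> T n * 1" using n_less_T[of n] by simp
  also have "\<dots> \<le> T n * (length (C n 0) + S n)" using S_pos[of n] by (intro mult_le_mono2) simp
  also have "\<dots> \<le> s n 0" by (rule s_lower)
  finally show ?thesis .
qed

text \<open>The bounds for the different ranges of \<open>N\<close> all have the error term
\<open>S m + length (C m j)\<close>, and the run lengths were chosen so large that it is at most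
\<open>s m j / T m\<close>.\<close>

theorem P_upper:
  assumes "s n 0 \<le> N"
  shows "T n * P N \<le> (T n * Suc (Suc e) + 1) * N"
proof -
  have "\<exists>m. n \<le> m \<and> s m 0 \<le> N \<and> N < s (Suc m) 0"
  proof -
    define m where "m = (GREATEST m. s m 0 \<le> N)"
    have bd: "\<And>m. s m 0 \<le> N \<Longrightarrow> m \<le> N" using n_le_s order_trans by blast
    have 1: "s m 0 \<le> N" unfolding m_def by (rule GreatestI_nat[of _ n N]) (use assms bd in auto)
    have 2: "k \<le> m" if "s k 0 \<le> N" for k
      unfolding m_def by (rule Greatest_le_nat[of _ k N]) (use that bd in auto)
    have "\<not> s (Suc m) 0 \<le> N" using 2[of "Suc m"] by auto
    then show ?thesis using 1 2[OF assms] by (intro exI[of _ m]) simp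
  qed
  then obtain m where m: "n \<le> m" "s m 0 \<le> N" "N < s (Suc m) 0" by blast
  obtain j where j: "s m j \<le> N" "P N \<le> Suc (Suc e) * N + S m + length (C m j)"
  proof (rule s_step_choice[OF m(2,3)])
    fix j assume "j < e" "s m j \<le> N" "N \<le> s m (Suc j)"
    then show thesis using P_upper_extra[of N m j] that by simp
  next
    assume "s m e \<le> N"
    then show thesis using P_upper_between[of N m] that m by simp
  qed
  have "T n * P N \<le> T n * (Suc (Suc e) * N) + T n * (length (C m j) + S m)"
    using mult_le_mono2[OF j(2), of "T n"] by (simp add: distrib_left ac_simps)
  also have "T n * (length (C m j) + S m) \<le> T m * (length (C m j) + S m)"
    using T_mono[OF m(1)] by (rule mult_le_mono1)
  also have "\<dots> \<le> N" using s_lower[of m j] j(1) by (rule order_trans)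
  finally show ?thesis by (simp add: algebra_simps)
qed

lemma P_upper_low: "T n * P (s n 0) \<le> (T n * Suc e + 1) * s n 0"
proof -
  have "T n * P (s n 0) \<le> T n * (Suc e * s n 0 + S n)"
    using P_upper_normal[of "s n 0" n] by (intro mult_le_mono2) simp
  also have "\<dots> = T n * (Suc e * s n 0) + T n * S n" by (simp add: distrib_left)
  also have "T n * S n \<le> s n 0" using s_lower[of n 0] by simp
  finally show ?thesis by (simp add: algebra_simps)
qed

end

section \<open>Words with two continuations\<close>

definition tail_of :: "nat \<Rightarrow> 'a list \<Rightarrow> 'a list" where
  "tail_of N u = drop (length u - N) u"

lemma length_tail_of: "N \<le> length u \<Longrightarrow> length (tail_of N u) = N"
  by (simp add: tail_of_def)

lemma tail_of_append: "length b \<le> N \<Longrightarrow> tail_of N (a @ b) = tail_of (N - length b) a @ b"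
  by (simp add: tail_of_def)

lemma last_tail_of: "N \<ge> 1 \<Longrightarrow> u \<noteq> [] \<Longrightarrow> last (tail_of N u) = last u"
  by (cases u) (auto simp: tail_of_def last_drop)

lemma sublist_tail_of_hd:
  assumes "u' \<noteq> []"
  shows "sublist (tail_of N u @ [hd u']) (u @ u')"
proof -
  have "u @ u' = take (length u - N) u @ (tail_of N u @ [hd u']) @ tl u'"
    using assms by (simp add: tail_of_def)
  then show ?thesis unfolding sublist_def by blast
qed

lemma hd_rep: "m \<ge> 1 \<Longrightarrow> u \<noteq> [] \<Longrightarrow> hd (rep m u) = hd u"
  by (cases m) (auto simp: rep_Suc)

lemma last_rep: "m \<ge> 1 \<Longrightarrow> u \<noteq> [] \<Longrightarrow> last (rep m u) = last u"
  by (cases m) (auto simp: rep_Suc_right)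

lemma rep_nonempty: "m \<ge> 1 \<Longrightarrow> u \<noteq> [] \<Longrightarrow> rep m u \<noteq> []"
  by (cases m) (auto simp: rep_Suc)

context tower
begin

text \<open>The first and the last letter of a word tell its residue class modulo
\<open>d\<close>. Hence the words of one stage differ in the very first letter and in the last
one, and a change of word is a branching.\<close>

lemma hd_last_v: "hd (v n) = n mod Suc e \<and> last (v n) = n mod Suc e"
proof (induction n rule: less_induct)
  case (less n)
  show ?case
  proof (cases "n \<le> e")
    case False
    define m where "m = n - Suc e"
    have n: "n = Suc (m + e)" using False by (simp add: m_def)
    have ne: "rep (q m e) (v m) \<noteq> []" using rep_nonempty q_pos v_nonempty by blast
    have "n mod Suc e = m mod Suc e"
      unfolding n using mod_add_self2[of m "Suc e"] by simp
    moreover have "hd (v m) = m mod Suc e \<and> last (v m) = m mod Suc e"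
      by (rule less) (simp add: n)
    ultimately show ?thesis
      unfolding n v_rec using ne hd_rep[OF q_pos v_nonempty, of m e m] last_rep[OF q_pos v_nonempty, of m e m]
      by (simp add: hd_append)
  qed (simp add: v_base)
qed

lemma set_v: "set (v n) \<subseteq> {..e}"
proof (induction n rule: less_induct)
  case (less n)
  show ?case
  proof (cases "n \<le> e")
    case False
    define m where "m = n - Suc e"
    have n: "n = Suc (m + e)" using False by (simp add: m_def)
    have "set (C m j) \<subseteq> {..e}" if "j \<le> e" for j
      using that
    proof (induction j)
      case (Suc j)
      have "set (v (Suc (m + j))) \<subseteq> {..e}" using Suc.prems by (intro less) (simp add: n)
      then have "set (rep (q m j) (v (Suc (m + j)))) \<subseteq> {..e}" by (rule order_trans[OF set_rep])
      then show ?case using Suc by (simp add: C_Suc)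
    qed simp
    moreover have "set (rep (q m e) (v m)) \<subseteq> {..e}"
      using less[of m] set_rep[of "q m e" "v m"] n by auto
    ultimately show ?thesis unfolding n v_rec by simp
  qed (simp add: v_base)
qed

lemma set_Lang: "w \<in> Lang \<Longrightarrow> set w \<subseteq> {..e}"
  unfolding Lang_def using set_v set_mono_sublist by blast

lemma finite_LangN: "finite (LangN N)"
  by (rule finite_subset[OF _ finite_lists_length_eq[of "{..e}" N]]) (auto simp: LangN_def dest: set_Lang)

lemma q_ge: "q n j \<ge> T n" "q n j \<ge> S n"
proof -
  have "T n * 1 \<le> T n * (length (C n j) + S n)" using S_pos[of n] by (intro mult_le_mono2) simp
  then show "q n j \<ge> T n" by (simp add: q_def)
  have "1 * S n \<le> T n * (length (C n j) + S n)" using T_pos[of n] by (intro mult_le_mono) auto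
  then show "q n j \<ge> S n" by (simp add: q_def)
qed

lemma q_0_less: "q n 0 < q (Suc n) e"
proof -
  have "q n 0 \<le> s n 0" by (rule q_le_s)
  also have "\<dots> \<le> s n e" by (rule s_mono) auto
  also have "\<dots> < 2 * s n e" using q_le_s[of n e] q_pos[of n e] by simp
  also have "\<dots> \<le> S (Suc n)" by (rule s_next)
  also have "\<dots> \<le> q (Suc n) e" by (rule q_ge)
  finally show ?thesis .
qed

lemma q_ge_2: "q n j \<ge> 2"
proof -
  have "T n \<ge> 2" using power_increasing[of 1 "n + 2" "4::nat"] by (simp add: T_def)
  then show ?thesis using q_ge(1)[of n j] by linarith
qed

lemma run_Lang: "j \<le> e \<Longrightarrow> rep (q n e) (v n) @ C n j @ rep (q n j) (B n j) \<in> Lang"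
  using run_prefix[of j n] v_Lang Lang_sublist by blast

lemma v_square_Lang: "v n @ v n \<in> Lang"
proof -
  have "sublist (rep 2 (v n)) (rep (q n e) (v n))" by (rule sublist_rep_mono[OF q_ge_2])
  moreover have "rep 2 (v n) = v n @ v n" by (simp add: numeral_2_eq_2 rep_Suc)
  moreover have "sublist (rep (q n e) (v n)) (rep (q n e) (v n) @ C n 0 @ rep (q n 0) (B n 0))" by simp
  ultimately show ?thesis using run_Lang[of 0 n] Lang_sublist by (metis zero_le)
qed

lemma run_run_sublist:
  assumes "1 \<le> a" "1 \<le> b"
  shows "sublist (u @ u') (rep a u @ rep b u')"
proof -
  obtain a' b' where "a = Suc a'" "b = Suc b'" using assms by (metis One_nat_def Suc_le_D)
  then have "rep a u @ rep b u' = rep a' u @ (u @ u') @ rep b' u'"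
    by (simp only: rep_Suc_right[of a'] rep_Suc[of b'] append.assoc)
  then show ?thesis unfolding sublist_def by blast
qed

lemma v_next_Lang: "v n @ v (Suc n) \<in> Lang"
proof -
  have "sublist (v n @ v (Suc n)) (rep (q n e) (v n) @ C n 0 @ rep (q n 0) (B n 0))"
    using run_run_sublist[OF q_pos q_pos, of "v n" "v (Suc n)" n e n 0] e_pos by (simp add: B_def)
  then show ?thesis using run_Lang[of 0 n] Lang_sublist by blast
qed

lemma Lang_extend: "w \<in> Lang \<Longrightarrow> \<exists>a. w @ [a] \<in> Lang"
proof -
  assume "w \<in> Lang"
  then obtain m p s where "v m = p @ w @ s" unfolding Lang_def sublist_def by blast
  moreover obtain a t where "s @ v m = a # t" using v_nonempty[of m] by (cases "s @ v m") auto
  ultimately have "v m @ v m = p @ (w @ [a]) @ t" by simp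
  then have "sublist (w @ [a]) (v m @ v m)" unfolding sublist_def by blast
  then show ?thesis using v_square_Lang Lang_sublist by blast
qed

text \<open>Every word has a continuation, and the words of \<open>R\<close> have two.\<close>

lemma right_special_count:
  assumes R: "R \<subseteq> LangN N" and sp: "\<And>w. w \<in> R \<Longrightarrow> \<exists>a b. a \<noteq> b \<and> w @ [a] \<in> Lang \<and> w @ [b] \<in> Lang"
  shows "P N + card R \<le> P (Suc N)"
proof -
  define f where "f w = (SOME a. w @ [a] \<in> Lang)" for w
  have f: "w @ [f w] \<in> Lang" if "w \<in> Lang" for w
    unfolding f_def using Lang_extend[OF that] by (rule someI_ex)
  have "\<exists>b. b \<noteq> f w \<and> w @ [b] \<in> Lang" if "w \<in> R" for w
    using sp[OF that] by metis
  then obtain g where g: "\<And>w. w \<in> R \<Longrightarrow> g w \<noteq> f w \<and> w @ [g w] \<in> Lang" by metis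
  let ?F = "(\<lambda>w. w @ [f w]) ` LangN N" and ?G = "(\<lambda>w. w @ [g w]) ` R"
  have fin: "finite R" using R finite_LangN finite_subset by blast
  have "?F \<union> ?G \<subseteq> LangN (Suc N)" using f g R by (auto simp: LangN_def)
  then have "card (?F \<union> ?G) \<le> P (Suc N)" unfolding P_def using finite_LangN by (intro card_mono) auto
  moreover have "card (?F \<union> ?G) = card ?F + card ?G"
    using g fin finite_LangN by (intro card_Un_disjoint) fastforce+
  moreover have "card ?F = P N" unfolding P_def by (intro card_image) (auto simp: inj_on_def)
  moreover have "card ?G = card R" by (intro card_image) (auto simp: inj_on_def)
  ultimately show ?thesis by simp
qed

lemma Suc_mod_neq: "n mod Suc e \<noteq> Suc n mod Suc e"
proof
  assume "n mod Suc e = Suc n mod Suc e"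
  then show False using e_pos by (auto simp: mod_Suc split: if_splits)
qed

lemma length_v_ge: "n \<le> m \<Longrightarrow> n \<le> length (v (Suc (m + e)))"
proof -
  assume "n \<le> m"
  also have "m \<le> s m 0" by (rule n_le_s)
  also have "\<dots> \<le> s m e" by (rule s_mono) auto
  also have "\<dots> \<le> length (v (Suc (m + e)))" by (simp add: length_v_rec)
  finally show ?thesis .
qed

text \<open>After \<open>v m\<close> there may come \<open>v m\<close> again or \<open>v (m +
1)\<close>, which begin with different letters.\<close>

lemma tail_of_v_special:
  assumes "N \<le> length (v m)"
  shows "tail_of N (v m) \<in> LangN N"
    "\<exists>a b. a \<noteq> b \<and> tail_of N (v m) @ [a] \<in> Lang \<and> tail_of N (v m) @ [b] \<in> Lang"
proof -
  show "tail_of N (v m) \<in> LangN N"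
    unfolding LangN_def using assms v_Lang[of m]
    by (auto simp: length_tail_of tail_of_def intro: Lang_sublist[OF sublist_drop])
  have "tail_of N (v m) @ [hd (v m)] \<in> Lang" "tail_of N (v m) @ [hd (v (Suc m))] \<in> Lang"
    using sublist_tail_of_hd[OF v_nonempty] v_square_Lang v_next_Lang Lang_sublist by blast+
  moreover have "hd (v m) \<noteq> hd (v (Suc m))" using hd_last_v Suc_mod_neq by simp
  ultimately show "\<exists>a b. a \<noteq> b \<and> tail_of N (v m) @ [a] \<in> Lang \<and> tail_of N (v m) @ [b] \<in> Lang" by blast
qed

lemma mod_inj: "i \<le> e \<Longrightarrow> j \<le> e \<Longrightarrow> (m + i) mod Suc e = (m + j) mod Suc e \<Longrightarrow> i = j"
proof (induction m)
  case (Suc m)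
  then show ?case
    by (intro Suc.IH) (auto simp: mod_Suc split: if_splits)
qed simp

definition suffix_words :: "nat \<Rightarrow> nat \<Rightarrow> nat list set" where
  "suffix_words m N = (\<lambda>i. tail_of N (v (m + i))) ` {..e}"

lemma suffix_words_card: "N \<ge> 1 \<Longrightarrow> card (suffix_words m N) = Suc e"
proof -
  assume N: "N \<ge> 1"
  have "inj_on (\<lambda>i. tail_of N (v (m + i))) {..e}"
  proof (rule inj_onI)
    fix i j assume ij: "i \<in> {..e}" "j \<in> {..e}" and "tail_of N (v (m + i)) = tail_of N (v (m + j))"
    then have "last (v (m + i)) = last (v (m + j))" using last_tail_of[OF N v_nonempty] by metis
    then show "i = j" using ij mod_inj[of i j m] hd_last_v by simp
  qed
  then show ?thesis unfolding suffix_words_def by (simp add: card_image)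
qed

lemma suffix_words_special:
  assumes "m \<ge> Suc (N + e)"
  shows "suffix_words m N \<subseteq> LangN N"
    "\<And>w. w \<in> suffix_words m N \<Longrightarrow> \<exists>a b. a \<noteq> b \<and> w @ [a] \<in> Lang \<and> w @ [b] \<in> Lang"
proof -
  have "N \<le> length (v (m + i))" for i
    using length_v_ge[of N "m + i - Suc e"] assms by simp
  then show "suffix_words m N \<subseteq> LangN N"
    "\<And>w. w \<in> suffix_words m N \<Longrightarrow> \<exists>a b. a \<noteq> b \<and> w @ [a] \<in> Lang \<and> w @ [b] \<in> Lang"
    unfolding suffix_words_def using tail_of_v_special by blast+
qed

lemma P_Suc: "N \<ge> 1 \<Longrightarrow> P N + Suc e \<le> P (Suc N)"
  using right_special_count[OF suffix_words_special[OF order_refl], of N] suffix_words_card by simp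

theorem P_lower: "N \<ge> 1 \<Longrightarrow> Suc e * N \<le> P N"
proof (induction N rule: dec_induct)
  case base
  have "(\<lambda>i. [i]) ` {..e} \<subseteq> LangN 1"
    using v_base v_Lang by (auto simp: LangN_def) (metis)
  then have "card ((\<lambda>i. [i]) ` {..e}) \<le> P 1"
    unfolding P_def using finite_LangN by (intro card_mono)
  then show ?case by (simp add: card_image inj_on_def)
qed (use P_Suc in fastforce)

text \<open>A suffix of a run of \<open>v n\<close> followed by a short run of \<open>v (n +
1)\<close>. It is the point where one does not yet know whether this run is a short one, inside
\<open>v (n + d)\<close>, or a long one.\<close>

definition fork_word :: "nat \<Rightarrow> nat \<Rightarrow> nat list" where
  "fork_word n N = tail_of N (rep (q n e) (v n) @ rep (q n 0) (v (Suc n)))"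

lemma s_0_eq: "s n 0 = q n 0 * length (v (Suc n))"
  using e_pos by (simp add: s_def B_def)

lemma v_suffix_power: "t \<ge> 1 \<Longrightarrow> \<exists>y. v (n + t * Suc e) = y @ rep (q n e) (v n)"
proof (induction t rule: dec_induct)
  case base
  show ?case using v_rec[of n] by auto
next
  case (step t)
  let ?m = "n + t * Suc e"
  have "v (n + Suc t * Suc e) = v (Suc (?m + e))" by (rule arg_cong[of _ _ v]) simp
  also have "\<dots> = (rep (q ?m e) (v ?m) @ C ?m e @ rep (q ?m e - 1) (v ?m)) @ v ?m"
    using rep_Suc_right[of "q ?m e - 1" "v ?m"] q_pos[of ?m e] by (simp add: v_rec)
  finally show ?case using step by (metis append.assoc)
qed

lemma fork_word_special:
  assumes "N \<le> s n e"
  shows "fork_word n N \<in> LangN N"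
    "\<exists>a b. a \<noteq> b \<and> fork_word n N @ [a] \<in> Lang \<and> fork_word n N @ [b] \<in> Lang"
proof -
  let ?u = "rep (q n e) (v n) @ rep (q n 0) (v (Suc n))"
  have len: "N \<le> length ?u" using assms by (simp add: s_def B_def)
  have 1: "?u @ B n 1 \<in> Lang"
  proof -
    have "C n 1 = rep (q n 0) (v (Suc n))" by (simp add: C_Suc)
    moreover have "prefix (B n 1) (rep (q n 1) (B n 1))"
      using q_pos[of n 1] by (cases "q n 1") (auto simp: rep_Suc)
    ultimately have "prefix (?u @ B n 1) (rep (q n e) (v n) @ C n 1 @ rep (q n 1) (B n 1))"
      by simp
    then show ?thesis using run_Lang[of 1 n] e_pos Lang_sublist by blast
  qed
  have 2: "?u @ v (Suc n) \<in> Lang"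
  proof -
    obtain a where a: "v (Suc (n + e)) = a @ rep (q n e) (v n)"
      unfolding v_rec by (metis append.assoc)
    have "prefix (rep (Suc (q n 0)) (v (Suc n))) (v (Suc (Suc n + e)))"
    proof -
      have "q n 0 < q (Suc n) e" by (rule q_0_less)
      then have "q (Suc n) e = Suc (q n 0) + (q (Suc n) e - Suc (q n 0))" by simp
      then have "rep (q (Suc n) e) (v (Suc n)) =
          rep (Suc (q n 0)) (v (Suc n)) @ rep (q (Suc n) e - Suc (q n 0)) (v (Suc n))"
        using rep_add[of "Suc (q n 0)" "q (Suc n) e - Suc (q n 0)" "v (Suc n)"] by (simp only:)
      then have "prefix (rep (Suc (q n 0)) (v (Suc n))) (rep (q (Suc n) e) (v (Suc n)))"
        by (rule prefixI)
      then show ?thesis unfolding v_rec by (rule prefix_prefix)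
    qed
    then obtain b where b: "v (Suc (Suc (n + e))) = rep (Suc (q n 0)) (v (Suc n)) @ b"
      unfolding add_Suc prefix_def by blast
    have "v (Suc (n + e)) @ v (Suc (Suc (n + e))) = a @ (?u @ v (Suc n)) @ b"
      unfolding a b rep_Suc_right append.assoc ..
    then have "sublist (?u @ v (Suc n)) (v (Suc (n + e)) @ v (Suc (Suc (n + e))))"
      unfolding sublist_def by blast
    then show ?thesis using v_next_Lang Lang_sublist by blast
  qed
  have "sublist (fork_word n N) ?u" unfolding fork_word_def tail_of_def by blast
  moreover have "?u \<in> Lang" using 2 Lang_sublist by blast
  ultimately show "fork_word n N \<in> LangN N"
    unfolding LangN_def using length_tail_of[OF len] Lang_sublist by (auto simp: fork_word_def)
  have "fork_word n N @ [hd (B n 1)] \<in> Lang"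
    unfolding fork_word_def using Lang_sublist[OF sublist_tail_of_hd 1] v_nonempty by (auto simp: B_def)
  moreover have "fork_word n N @ [hd (v (Suc n))] \<in> Lang"
    unfolding fork_word_def using Lang_sublist[OF sublist_tail_of_hd 2] v_nonempty by auto
  moreover have "hd (B n 1) \<noteq> hd (v (Suc n))"
  proof (cases "1 < e")
    case True
    then show ?thesis using Suc_mod_neq[of "Suc n"] hd_last_v by (auto simp: B_def)
  next
    case False
    then show ?thesis using Suc_mod_neq[of n] hd_last_v by (auto simp: B_def)
  qed
  ultimately show "\<exists>a b. a \<noteq> b \<and> fork_word n N @ [a] \<in> Lang \<and> fork_word n N @ [b] \<in> Lang" by blast
qed

text \<open>The suffix words with the same last letter end with a run of \<open>v (n + 1)\<close>
that is longer than \<open>s n 0\<close>; the fork word has the last letter of \<open>v n\<close>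
before its short run.\<close>

lemma fork_word_notin_suffix_words:
  assumes N: "s n 0 < N" "N \<le> s n e" and t: "t \<ge> 1"
  shows "fork_word n N \<notin> suffix_words (Suc n + t * Suc e) N"
proof
  assume "fork_word n N \<in> suffix_words (Suc n + t * Suc e) N"
  then obtain i where i: "i \<le> e" "fork_word n N = tail_of N (v (Suc n + t * Suc e + i))"
    unfolding suffix_words_def by blast
  have ne: "rep (q n e) (v n) \<noteq> []" "rep (q n 0) (v (Suc n)) \<noteq> []"
    using rep_nonempty q_pos v_nonempty by blast+
  have "last (fork_word n N) = Suc n mod Suc e"
    unfolding fork_word_def using N ne last_rep[OF q_pos v_nonempty, of n 0 "Suc n"] hd_last_v
    by (simp add: last_tail_of)
  moreover have "last (fork_word n N) = (Suc n + i) mod Suc e"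
    unfolding i(2) using N v_nonempty hd_last_v mod_mult_self1[of "Suc n + i" t "Suc e"]
    by (simp add: last_tail_of ac_simps)
  ultimately have "i = 0" using mod_inj[of 0 i "Suc n"] i(1) by simp
  obtain y where y: "v (Suc n + t * Suc e) = y @ rep (q (Suc n) e) (v (Suc n))"
    using v_suffix_power[OF t] by blast
  note q = q_0_less[of n]
  define r where "r = q (Suc n) e - q n 0"
  have r: "q (Suc n) e = r + q n 0" "r \<ge> 1" using q by (auto simp: r_def)
  have lenq: "length (rep (q n 0) (v (Suc n))) \<le> N" using N by (simp add: s_0_eq)
  have "fork_word n N = tail_of (N - s n 0) (rep (q n e) (v n)) @ rep (q n 0) (v (Suc n))"
    unfolding fork_word_def using tail_of_append[OF lenq] by (simp add: s_0_eq)
  moreover have "v (Suc n + t * Suc e + i) = (y @ rep r (v (Suc n))) @ rep (q n 0) (v (Suc n))"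
    unfolding \<open>i = 0\<close> add_0_right y r(1) rep_add append.assoc ..
  then have "fork_word n N = tail_of (N - s n 0) (y @ rep r (v (Suc n))) @ rep (q n 0) (v (Suc n))"
    unfolding i(2) using tail_of_append[OF lenq, of "y @ rep r (v (Suc n))"]
    by (simp only: s_0_eq length_rep)
  ultimately have "tail_of (N - s n 0) (rep (q n e) (v n)) = tail_of (N - s n 0) (y @ rep r (v (Suc n)))"
    by simp
  then have "last (rep (q n e) (v n)) = last (y @ rep r (v (Suc n)))"
    using N ne rep_nonempty[OF r(2) v_nonempty] last_tail_of[of "N - s n 0"]
    by (metis Nil_is_append_conv Suc_leI One_nat_def zero_less_diff)
  then have "n mod Suc e = Suc n mod Suc e"
    using rep_nonempty[OF r(2) v_nonempty, of "Suc n"] last_rep[OF q_pos v_nonempty, of n e n] last_rep[OF r(2) v_nonempty, of "Suc n"] hd_last_v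
    by simp
  then show False using Suc_mod_neq by blast
qed

lemma P_Suc_extra:
  assumes N: "s n 0 < N" "N \<le> s n e"
  shows "P N + Suc (Suc e) \<le> P (Suc N)"
proof -
  \<comment> \<open>The index \<open>?m\<close> is in the residue class of \<open>n + 1\<close>
    and large enough for the words to be longer than \<open>N\<close>.\<close>
  define t where "t = Suc (N + e)"
  let ?m = "Suc n + t * Suc e" 
  have "?m \<ge> Suc (N + e)" by (simp add: t_def)
  note G = suffix_words_special[OF this]
  have "P N + card (insert (fork_word n N) (suffix_words ?m N)) \<le> P (Suc N)"
  proof (rule right_special_count)
    show "insert (fork_word n N) (suffix_words ?m N) \<subseteq> LangN N" using G(1) fork_word_special(1)[OF N(2)] by blast
    show "\<exists>a b. a \<noteq> b \<and> w @ [a] \<in> Lang \<and> w @ [b] \<in> Lang" if "w \<in> insert (fork_word n N) (suffix_words ?m N)" for w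
      using that G(2) fork_word_special(2)[OF N(2)] by blast
  qed
  moreover have "fork_word n N \<notin> suffix_words ?m N" using fork_word_notin_suffix_words[OF N, of t] by (simp add: t_def)
  then have "card (insert (fork_word n N) (suffix_words ?m N)) = Suc (Suc e)"
    using suffix_words_card[of N ?m] N finite_subset[OF G(1) finite_LangN] by simp
  ultimately show ?thesis by simp
qed

text \<open>From \<open>s n 0\<close> to \<open>s n e\<close> the number of factors grows by
\<open>d + 1\<close> in each step, and \<open>s n 0\<close> is negligible compared with \<open>s n
e\<close>.\<close>

theorem P_lower_high: "Suc (Suc e) * s n e \<le> P (s n e) + Suc (s n 0)"
proof (cases "s n 0 < s n e")
  case True
  have "Suc (Suc e) * N \<le> P N + Suc (s n 0)" if "Suc (s n 0) \<le> N" "N \<le> s n e" for N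
    using that
  proof (induction N rule: dec_induct)
    case base
    then show ?case using P_lower[of "Suc (s n 0)"] by simp
  next
    case (step N)
    then show ?case using P_Suc_extra[of n N] by simp
  qed
  then show ?thesis using True by simp
next
  case False
  then have "s n e = s n 0" using s_mono[of 0 e n] by simp
  moreover have "s n e \<ge> 1" using q_le_s[of n e] q_pos[of n e] by linarith
  ultimately show ?thesis using P_lower[of "s n e"] by simp
qed

lemma s_0_e: "T n * s n 0 \<le> s n e"
  using s_Suc[of 0 n] s_mono[of 1 e n] e_pos by (simp add: order_trans)

section \<open>Lower and upper growth rates\<close>

lemma T_lim: "(\<lambda>n. c / real (T n)) \<longlonglongrightarrow> 0"
proof -
  have "(\<lambda>n. c / 16 * (1/4)^n) \<longlonglongrightarrow> c / 16 * 0"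
    by (intro tendsto_mult tendsto_const LIMSEQ_realpow_zero) auto
  then show ?thesis by (simp add: T_def power_add field_simps)
qed

lemma liminf_P: "liminf (\<lambda>n. ereal (real (P n) / real n)) = ereal (real (Suc e))"
proof (rule antisym)
  let ?f = "\<lambda>n. real (P n) / real n"
  have sm: "strict_mono (\<lambda>n. s n 0)" by (simp add: strict_mono_Suc_iff s_0_strict)
  have pos: "s n 0 \<ge> 1" for n using q_le_s[of n 0] q_pos[of n 0] by linarith
  have "?f (s n 0) \<le> real (Suc e) + 1 / real (T n)" for n
  proof -
    have "real (T n * P (s n 0)) \<le> real ((T n * Suc e + 1) * s n 0)"
      using P_upper_low of_nat_le_iff by blast
    then show ?thesis using pos[of n] T_pos[of n] by (simp add: field_simps)
  qed
  then have "eventually (\<lambda>n. ereal (?f (s n 0)) \<le> ereal (real (Suc e) + 1 / real (T n))) sequentially"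
    by simp
  then have "liminf (\<lambda>n. ereal (?f (s n 0))) \<le> liminf (\<lambda>n. ereal (real (Suc e) + 1 / real (T n)))"
    by (rule Liminf_mono)
  also have "(\<lambda>n. ereal (real (Suc e) + 1 / real (T n))) \<longlonglongrightarrow> ereal (real (Suc e) + 0)"
    by (intro tendsto_intros T_lim)
  then have "liminf (\<lambda>n. ereal (real (Suc e) + 1 / real (T n))) = ereal (real (Suc e))"
    using lim_imp_Liminf by force
  finally have "liminf (\<lambda>n. ereal (?f (s n 0))) \<le> ereal (real (Suc e))" .
  moreover have "liminf (\<lambda>n. ereal (?f n)) \<le> liminf (\<lambda>n. ereal (?f (s n 0)))"
    using liminf_subseq_mono[OF sm, of "\<lambda>n. ereal (?f n)"] by (simp add: o_def)
  ultimately show "liminf (\<lambda>n. ereal (?f n)) \<le> ereal (real (Suc e))" by (rule order_trans[rotated])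
next
  have "eventually (\<lambda>n. ereal (real (Suc e)) \<le> ereal (real (P n) / real n)) sequentially"
    using eventually_ge_at_top[of 1]
  proof eventually_elim
    case (elim n)
    then have "real (Suc e * n) \<le> real (P n)" using P_lower[of n] of_nat_le_iff by blast
    then show ?case using elim by (simp add: field_simps)
  qed
  then show "ereal (real (Suc e)) \<le> liminf (\<lambda>n. ereal (real (P n) / real n))"
    by (rule Liminf_bounded)
qed

lemma limsup_P: "limsup (\<lambda>n. ereal (real (P n) / real n)) = ereal (real (Suc e) + 1)"
proof (rule antisym)
  let ?f = "\<lambda>n. real (P n) / real n"
  have pos: "s n j \<ge> 1" for n j using q_le_s[of n j] q_pos[of n j] by linarith
  have "limsup (\<lambda>N. ereal (?f N)) \<le> ereal (real (Suc e) + 1 + 1 / real (T n))" for n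
  proof (rule Limsup_bounded)
    show "eventually (\<lambda>N. ereal (?f N) \<le> ereal (real (Suc e) + 1 + 1 / real (T n))) sequentially"
      using eventually_ge_at_top[of "s n 0"]
    proof eventually_elim
      case (elim N)
      then have "real (T n * P N) \<le> real ((T n * Suc (Suc e) + 1) * N)"
        using P_upper of_nat_le_iff by blast
      then show ?case using pos[of n 0] elim T_pos[of n] by (simp add: field_simps)
    qed
  qed
  moreover have "(\<lambda>n. ereal (real (Suc e) + 1 + 1 / real (T n))) \<longlonglongrightarrow> ereal (real (Suc e) + 1 + 0)"
    by (intro tendsto_intros T_lim)
  ultimately show "limsup (\<lambda>n. ereal (?f n)) \<le> ereal (real (Suc e) + 1)"
    using LIMSEQ_le_const by fastforce
next
  let ?f = "\<lambda>n. real (P n) / real n"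
  have pos: "s n j \<ge> 1" for n j using q_le_s[of n j] q_pos[of n j] by linarith
  have sm: "strict_mono (\<lambda>n. s n e)"
    unfolding strict_mono_Suc_iff
  proof
    fix n
    have "s n e < 2 * s n e" using pos[of n e] by simp
    also have "\<dots> \<le> S (Suc n)" by (rule s_next)
    also have "\<dots> \<le> q (Suc n) e" by (rule q_ge)
    also have "\<dots> \<le> s (Suc n) e" by (rule q_le_s)
    finally show "s n e < s (Suc n) e" .
  qed
  have "real (Suc e) + 1 - 2 / real (T n) \<le> ?f (s n e)" for n
  proof -
    have "real (Suc (Suc e) * s n e) \<le> real (P (s n e) + Suc (s n 0))"
      using P_lower_high of_nat_le_iff by blast
    then have "real (Suc (Suc e)) * real (s n e) \<le> real (P (s n e)) + real (Suc (s n 0))"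
      by (simp only: of_nat_mult of_nat_add)
    moreover have "real (Suc (s n 0)) \<le> 2 * real (s n 0)" using pos[of n 0] by simp
    moreover have "real (T n) * real (s n 0) \<le> real (s n e)"
      using s_0_e[of n] by (metis of_nat_le_iff of_nat_mult)
    then have "real (s n 0) \<le> real (s n e) / real (T n)" using T_pos[of n] by (simp add: field_simps)
    ultimately have "real (Suc (Suc e)) * real (s n e) - 2 * (real (s n e) / real (T n)) \<le> real (P (s n e))"
      by linarith
    then have "(real (Suc (Suc e)) * real (s n e) - 2 * (real (s n e) / real (T n))) / real (s n e) \<le> ?f (s n e)"
      by (intro divide_right_mono) auto
    moreover have "(real (Suc (Suc e)) * real (s n e) - 2 * (real (s n e) / real (T n))) / real (s n e)
       = real (Suc e) + 1 - 2 / real (T n)" using pos[of n e] T_pos[of n] by (simp add: field_simps)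
    ultimately show ?thesis by simp
  qed
  then have "eventually (\<lambda>n. ereal (real (Suc e) + 1 - 2 / real (T n)) \<le> ereal (?f (s n e))) sequentially"
    by simp
  then have "limsup (\<lambda>n. ereal (real (Suc e) + 1 - 2 / real (T n))) \<le> limsup (\<lambda>n. ereal (?f (s n e)))"
    by (rule Limsup_mono)
  moreover have "(\<lambda>n. ereal (real (Suc e) + 1 - 2 / real (T n))) \<longlonglongrightarrow> ereal (real (Suc e) + 1 - 0)"
    by (intro tendsto_intros T_lim)
  then have "limsup (\<lambda>n. ereal (real (Suc e) + 1 - 2 / real (T n))) = ereal (real (Suc e) + 1)"
    using lim_imp_Limsup by force
  moreover have "limsup (\<lambda>n. ereal (?f (s n e))) \<le> limsup (\<lambda>n. ereal (?f n))"
    using limsup_subseq_mono[OF sm, of "\<lambda>n. ereal (?f n)"] by (simp add: o_def)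
  ultimately show "ereal (real (Suc e) + 1) \<le> limsup (\<lambda>n. ereal (?f n))" by simp
qed

end

section \<open>The subshift and its minimality\<close>

lemma clopen_coordinate: "open {x :: int \<Rightarrow> nat. x z = a}"
proof -
  have "{x :: int \<Rightarrow> nat. x z = a} = (\<lambda>x. x z) -` {a}" by auto
  moreover have "open ((\<lambda>x :: int \<Rightarrow> nat. x z) -` {a})"
    by (rule open_vimage[OF Topological_Spaces.open_discrete continuous_on_product_coordinates])
  ultimately show ?thesis by simp
qed

lemma open_win: "open {x :: int \<Rightarrow> nat. win x z N \<in> Q}"
proof -
  have "open {x :: int \<Rightarrow> nat. win x z N = w}" for w
  proof (cases "length w = N")
    case True
    have "{x :: int \<Rightarrow> nat. win x z N = w} = (\<Inter>j\<in>{..<N}. {x. x (z + int j) = w ! j})"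
      using True by (auto simp: list_eq_iff_nth_eq)
    then show ?thesis by (simp add: open_INT clopen_coordinate)
  next
    case False
    then have "{x :: int \<Rightarrow> nat. win x z N = w} = {}" by auto
    then show ?thesis by simp
  qed
  moreover have "{x :: int \<Rightarrow> nat. win x z N \<in> Q} = (\<Union>w\<in>Q. {x. win x z N = w})" by auto
  ultimately show ?thesis by auto
qed

lemma closed_win: "closed {x :: int \<Rightarrow> nat. win x z N \<in> Q}"
proof -
  have "- {x :: int \<Rightarrow> nat. win x z N \<in> Q} = {x. win x z N \<in> - Q}" by auto
  then show ?thesis unfolding closed_def using open_win by metis
qed

lemma open_contains_win:
  fixes U :: "(int \<Rightarrow> nat) set"
  assumes "open U" "y \<in> U"
  obtains N where "{x. win x (- int N) (2 * N + 1) = win y (- int N) (2 * N + 1)} \<subseteq> U"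
proof -
  have "openin (product_topology (\<lambda>_. euclidean) UNIV) U" using assms(1) by (simp add: open_fun_def)
  from product_topology_open_contains_basis[OF this assms(2)]
  obtain Y where Y: "y \<in> PiE UNIV Y" "finite {i. Y i \<noteq> topspace euclidean}" "PiE UNIV Y \<subseteq> U"
    by auto
  define F where "F = {i. Y i \<noteq> UNIV}"
  have F: "finite F" using Y(2) by (simp add: F_def)
  obtain N where N: "\<And>i. i \<in> F \<Longrightarrow> \<bar>i\<bar> \<le> int N"
  proof -
    have "finite ((\<lambda>i. nat \<bar>i\<bar>) ` F)" using F by simp
    then obtain N where "\<forall>k\<in>(\<lambda>i. nat \<bar>i\<bar>) ` F. k \<le> N" using finite_nat_set_iff_bounded_le by blast
    then show ?thesis by (intro that[of N]) force
  qed
  have "{x. win x (- int N) (2 * N + 1) = win y (- int N) (2 * N + 1)} \<subseteq> U"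
  proof
    fix x assume x: "x \<in> {x. win x (- int N) (2 * N + 1) = win y (- int N) (2 * N + 1)}"
    have "x i \<in> Y i" for i
    proof (cases "i \<in> F")
      case True
      then have "\<bar>i\<bar> \<le> int N" by (rule N)
      moreover have "\<forall>j<2 * N + 1. x (- int N + int j) = y (- int N + int j)"
        using x by (simp only: mem_Collect_eq win_eq_iff)
      moreover from calculation have "- int N + int (nat (i + int N)) = i" "nat (i + int N) < 2 * N + 1"
        by auto
      ultimately have "x i = y i" by metis
      then show ?thesis using Y(1) by auto
    qed (auto simp: F_def)
    then show "x \<in> U" using Y(3) by auto
  qed
  then show ?thesis by (rule that)
qed

lemma per_aligned:
  assumes "2 * length u \<le> N"
  shows "sublist u (win (per u) z N)"
proof (cases "u = []")
  case False
  define k where "k = (- z) mod int (length u)"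
  have k: "0 \<le> k" "k < int (length u)" using False by (auto simp: k_def)
  have eq: "z + k = (- ((- z) div int (length u))) * int (length u)"
    unfolding k_def by (simp add: minus_div_mult_eq_mod[symmetric])
  have "win (per u) (z + k) (length u) = win (per u) 0 (length u)"
  proof (rule win_cong)
    fix j
    show "per u (z + k + int j) = per u (0 + int j)"
      using per_add_period[of u "int j" "- ((- z) div int (length u))"] eq by (simp add: ac_simps)
  qed
  also have "\<dots> = u" using rep_eq_win[of 1 u] by simp
  finally have "win (per u) (z + k) (length u) = u" .
  moreover have "sublist (win (per u) (z + k) (length u)) (win (per u) z N)"
    using k assms by (intro win_sublist_win) auto
  ultimately show ?thesis by simp
qed simp

context tower
begin

definition X :: "(int \<Rightarrow> nat) set" where "X = {x. \<forall>z N. win x z N \<in> Lang}"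

lemma X_win: "x \<in> X \<Longrightarrow> win x z N \<in> Lang"
  by (simp add: X_def)

lemma closed_X: "closed X"
proof -
  have "X = (\<Inter>z. \<Inter>N. {x. win x z N \<in> Lang})" by (auto simp: X_def)
  then show ?thesis by (simp add: closed_INT closed_win)
qed

lemma win_shift_int: "win (shift_int k x) z N = win x (z + k) N"
  by (rule win_cong) (simp add: shift_int_def ac_simps)

lemma shift_int_X: "shift_int k x \<in> X \<longleftrightarrow> x \<in> X"
proof
  assume a: "shift_int k x \<in> X"
  show "x \<in> X" unfolding X_def
  proof (intro CollectI allI)
    fix z N
    show "win x z N \<in> Lang" using X_win[OF a, of "z - k" N] by (simp add: win_shift_int)
  qed
qed (simp add: X_def win_shift_int)

lemma shift_eq_shift_int: "shift x = shift_int 1 x"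
  by (simp add: shift_def shift_int_def)

lemma shift_int_add: "shift_int k (shift_int l x) = shift_int (k + l) x"
  by (simp add: shift_int_def ac_simps)

lemma shift_int_0: "shift_int 0 x = x"
  by (simp add: shift_int_def)

lemma X_letters: "x \<in> X \<Longrightarrow> x z \<le> e"
  using set_Lang[OF X_win[of x z 1]] by (simp add: win_def)

lemma v_prefix_step: "prefix (v n) (v (Suc (n + e)))" and v_suffix_step: "suffix (v n) (v (Suc (n + e)))"
proof -
  obtain m where m: "q n e = Suc m" using q_pos[of n e] by (cases "q n e") auto
  show "prefix (v n) (v (Suc (n + e)))" unfolding v_rec m rep_Suc by simp
  show "suffix (v n) (v (Suc (n + e)))" unfolding v_rec m rep_Suc_right by (simp add: suffix_def)
qed

definition chain :: "nat \<Rightarrow> nat \<Rightarrow> nat list" where "chain r k = v (r + k * Suc e)"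

lemma chain_Suc: "chain r (Suc k) = v (Suc (r + k * Suc e + e))"
  by (simp add: chain_def ac_simps)

lemma chain_prefix: "k \<le> l \<Longrightarrow> prefix (chain r k) (chain r l)"
  and chain_suffix: "k \<le> l \<Longrightarrow> suffix (chain r k) (chain r l)"
proof (induction l rule: dec_induct)
  case (step l)
  { case 1 then show ?case using step v_prefix_step[of "r + l * Suc e"] by (metis chain_Suc chain_def prefix_order.trans) }
  { case 2 then show ?case using step v_suffix_step[of "r + l * Suc e"] by (metis chain_Suc chain_def suffix_order.trans) }
qed simp_all

lemma chain_length: "k < length (chain r k)"
proof (induction k)
  case 0
  then show ?case using v_nonempty[of r] by (simp add: chain_def)
next
  case (Suc k)
  let ?m = "r + k * Suc e"
  have "length (chain r k) \<le> s ?m e"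
    using q_pos[of ?m e] by (simp add: chain_def s_def B_def)
  moreover have "length (chain r (Suc k)) \<ge> 2 * s ?m e" unfolding chain_Suc length_v_rec by simp
  ultimately show ?case using Suc by linarith
qed

lemma chain_nth: "j < length (chain r k) \<Longrightarrow> j < length (chain r l) \<Longrightarrow> chain r k ! j = chain r l ! j"
proof -
  assume j: "j < length (chain r k)" "j < length (chain r l)"
  have *: "u ! j = u' ! j" if "prefix u u'" "j < length u" for u u' :: "nat list"
    using that by (auto simp: prefix_def nth_append)
  have "chain r k ! j = chain r (max k l) ! j" "chain r l ! j = chain r (max k l) ! j"
    using j by (intro * chain_prefix; simp)+
  then show ?thesis by simp
qed

lemma chain_nth_end: "0 < j \<Longrightarrow> j \<le> length (chain r k) \<Longrightarrow> j \<le> length (chain r l) \<Longrightarrow>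
   chain r k ! (length (chain r k) - j) = chain r l ! (length (chain r l) - j)"
proof -
  assume j: "0 < j" "j \<le> length (chain r k)" "j \<le> length (chain r l)"
  have *: "u ! (length u - j) = u' ! (length u' - j)" if "suffix u u'" "j \<le> length u" for u u' :: "nat list"
    using that j(1) by (auto simp: suffix_def nth_append)
  have "chain r k ! (length (chain r k) - j) = chain r (max k l) ! (length (chain r (max k l)) - j)"
    "chain r l ! (length (chain r l) - j) = chain r (max k l) ! (length (chain r (max k l)) - j)"
    using j by (intro * chain_suffix; simp)+
  then show ?thesis by simp
qed

text \<open>The words \<open>v r, v (r + d), v (r + 2 d), \<dots>\<close> are prefixes and
suffixes of one another. The point has their limit as prefixes on the right of the origin and
their limit as suffixes on the left.\<close>

definition base_point :: "nat \<Rightarrow> int \<Rightarrow> nat" where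
  "base_point r z = (if z \<ge> 0 then chain r (nat z) ! nat z else chain r (nat (- z)) ! (length (chain r (nat (- z))) - nat (- z)))"

lemma base_point_right: "win (base_point r) 0 (length (chain r k)) = chain r k"
proof (rule nth_equalityI)
  fix j assume "j < length (win (base_point r) 0 (length (chain r k)))"
  then show "win (base_point r) 0 (length (chain r k)) ! j = chain r k ! j"
    using chain_nth[OF chain_length, of j r k] by (simp add: base_point_def)
qed simp

lemma base_point_left: "win (base_point r) (- int (length (chain r k))) (length (chain r k)) = chain r k"
proof (rule nth_equalityI)
  fix j assume "j < length (win (base_point r) (- int (length (chain r k))) (length (chain r k)))"
  then have j: "j < length (chain r k)" by simp
  define i where "i = length (chain r k) - j"
  have i: "0 < i" "i \<le> length (chain r k)" "j = length (chain r k) - i" using j by (auto simp: i_def)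
  have eq: "- int (length (chain r k)) + int j = - int i" using i by simp
  have "chain r i ! (length (chain r i) - i) = chain r k ! (length (chain r k) - i)"
    using i chain_length[of i r] by (intro chain_nth_end) auto
  then show "win (base_point r) (- int (length (chain r k))) (length (chain r k)) ! j = chain r k ! j"
    using j i by (simp add: eq base_point_def)
qed simp

lemma base_point_X: "base_point r \<in> X"
  unfolding X_def
proof (intro CollectI allI)
  fix z :: int and N :: nat
  define k where "k = nat \<bar>z\<bar> + N"
  let ?L = "length (chain r k)"
  have L: "k < ?L" by (rule chain_length)
  have "win (base_point r) (- int ?L) (?L + ?L) = chain r k @ chain r k"
    using base_point_left[of r k] base_point_right[of r k] by (simp only: win_add) simp
  then have "win (base_point r) (- int ?L) (?L + ?L) \<in> Lang" using v_square_Lang by (simp add: chain_def)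
  moreover have "sublist (win (base_point r) z N) (win (base_point r) (- int ?L) (?L + ?L))"
    using L unfolding k_def by (intro win_sublist_win) linarith+
  ultimately show "win (base_point r) z N \<in> Lang" using Lang_sublist by blast
qed

text \<open>Each factor of some \<open>v m\<close> occurs in the base point that starts with
\<open>v m\<close>, so no factor is lost in passing to points.\<close>

lemma words_X: "words X N = LangN N"
proof
  show "words X N \<subseteq> LangN N"
    by (auto simp: words_def LangN_def win_def[symmetric] X_win)
  show "LangN N \<subseteq> words X N"
  proof
    fix w assume "w \<in> LangN N"
    then obtain m where m: "sublist w (v m)" "length w = N" by (auto simp: LangN_def Lang_def)
    then have "sublist w (win (base_point m) 0 (length (chain m 0)))" unfolding base_point_right by (simp add: chain_def)
    then obtain k where "w = win (base_point m) k N" using sublist_win m(2) by metis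
    then show "w \<in> words X N" using base_point_X unfolding words_def win_def by blast
  qed
qed

lemma complexity_X: "complexity X N = P N"
  by (simp add: complexity_def words_X P_def)

lemma subshift_X: "subshift {..e} X"
proof -
  have "shift ` X = X"
  proof
    show "shift ` X \<subseteq> X" by (auto simp: shift_eq_shift_int shift_int_X)
    show "X \<subseteq> shift ` X"
    proof
      fix x assume "x \<in> X"
      then have "shift_int (-1) x \<in> X" "x = shift (shift_int (-1) x)"
        by (auto simp: shift_int_X shift_eq_shift_int shift_int_add shift_int_0)
      then show "x \<in> shift ` X" by blast
    qed
  qed
  then show ?thesis unfolding subshift_def using closed_X X_letters by auto
qed

text \<open>A long factor is a window of one change, hence contains many periods of one of the two
words involved, and each of them contains \<open>v m\<close>.\<close>

lemma recurrence:
  "\<exists>R. \<forall>u\<in>Lang. length u = R \<longrightarrow> sublist (v m) u"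
proof (intro exI[of _ "s (Suc (m + e)) 0"] ballI impI)
  fix u assume u: "u \<in> Lang" "length u = s (Suc (m + e)) 0"
  define n where "n = Suc (m + e)"
  have big: "4 * S n \<le> length u"
  proof -
    have "4 * S n \<le> T n * S n" using power_increasing[of 1 "n + 2" "4::nat"] by (intro mult_le_mono1) (simp add: T_def)
    also have "\<dots> \<le> s n 0" using s_lower[of n 0] by simp
    finally show ?thesis using u(2) by (simp add: n_def)
  qed
  have sub: "sublist (v m) (v k)" if "k \<ge> n" for k
    using that by (intro v_sublist) (auto simp: n_def)
  obtain i where i: "i \<le> e" "\<exists>a b. sublist u (rep a (v (n + i)) @ rep b (v (succ_index n i)))"
    using Lang_normal[OF u(1), of n] u(2) unfolding normal_def n_def by auto
  then obtain a b where "sublist u (rep a (v (n + i)) @ rep b (v (succ_index n i)))" by blast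
  then obtain z where z: "u = win (het (v (n + i)) [] (v (succ_index n i))) z (length u)"
    using sublist_two_het by blast
  let ?h = "het (v (n + i)) [] (v (succ_index n i))"
  have nxn: "succ_index n i \<ge> n" by (simp add: succ_index_def)
  have l1: "length (v (n + i)) \<le> S n" by (rule length_v_le_S[OF i(1)])
  have l2: "length (v (succ_index n i)) \<le> S n"
    using length_v_le_S[of "Suc i" n] length_v_le_S[of 0 n] by (auto simp: succ_index_def)
  show "sublist (v m) u"
  proof (cases "z + 2 * int (S n) \<le> 0")
    case True
    have "sublist (v (n + i)) (win (per (v (n + i))) z (2 * S n))"
      using l1 by (intro per_aligned) simp
    also have "win (per (v (n + i))) z (2 * S n) = win ?h z (2 * S n)"
      using True by (intro win_het_neg[symmetric]) simp
    finally have "sublist (v (n + i)) (win ?h z (2 * S n))" .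
    moreover have "sublist (win ?h z (2 * S n)) u"
      by (subst z, rule win_sublist_win) (use big in auto)
    ultimately show ?thesis using sub[of "n + i"] sublist_order.order_trans by (meson le_add1)
  next
    case False
    let ?z = "max z 0"
    have "sublist (v (succ_index n i)) (win (per (v (succ_index n i))) ?z (2 * S n))"
      using l2 by (intro per_aligned) simp
    also have "win (per (v (succ_index n i))) ?z (2 * S n) = win ?h ?z (2 * S n)"
      by (subst win_het_pos) auto
    finally have "sublist (v (succ_index n i)) (win ?h ?z (2 * S n))" .
    moreover have "sublist (win ?h ?z (2 * S n)) u"
      by (subst z, rule win_sublist_win) (use big False in auto)
    ultimately show ?thesis using sub[OF nxn] sublist_order.order_trans by meson
  qed
qed

lemma minimal_X: "minimal_subshift {..e} X"
  unfolding minimal_subshift_def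
proof (intro conjI ballI)
  fix x assume x: "x \<in> X"
  show "closure {shift_int n x |n. True} = X"
  proof
    show "closure {shift_int n x |n. True} \<subseteq> X"
      using x by (intro closure_minimal closed_X) (auto simp: shift_int_X)
    show "X \<subseteq> closure {shift_int n x |n. True}"
    proof
      fix y assume y: "y \<in> X"
      show "y \<in> closure {shift_int n x |n. True}"
        unfolding closure_iff_nhds_not_empty
      proof (intro allI impI)
        fix A U :: "(int \<Rightarrow> nat) set" assume U: "U \<subseteq> A" "open U" "y \<in> U"
        obtain N where N: "{x. win x (- int N) (2 * N + 1) = win y (- int N) (2 * N + 1)} \<subseteq> U"
          using open_contains_win[OF U(2,3)] .
        let ?w = "win y (- int N) (2 * N + 1)"
        obtain m where m: "sublist ?w (v m)" using X_win[OF y] unfolding Lang_def by blast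
        obtain R where R: "\<And>u. u \<in> Lang \<Longrightarrow> length u = R \<Longrightarrow> sublist (v m) u"
          using recurrence[of m] by blast
        have "sublist (v m) (win x 0 R)" using R X_win[OF x] by simp
        then have "sublist ?w (win x 0 R)" using m sublist_order.order_trans by blast
        then obtain k where k: "?w = win x (0 + int k) (2 * N + 1)"
          using sublist_win by (metis length_win)
        then have "win (shift_int (int k + int N) x) (- int N) (2 * N + 1) = ?w"
          by (simp add: win_shift_int)
        then have "shift_int (int k + int N) x \<in> U" using N by blast
        then show "{shift_int n x |n. True} \<inter> A \<noteq> {}" using U(1) by blast
      qed
    qed
  qed
qed (rule subshift_X)

end

section \<open>Frequencies\<close>

definition hits :: "(int \<Rightarrow> 'a) \<Rightarrow> int \<Rightarrow> int \<Rightarrow> nat \<Rightarrow> 'a list set \<Rightarrow> real" where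
  "hits x a b l Q = (\<Sum>z\<in>{a..<b}. indicator Q (win x z l))"

text \<open>The word is read cyclically. There are no boundary terms then, and the value is the
same for a conjugate of \<open>u\<close>, so one may start at the most convenient letter.\<close>

definition fr :: "'a list \<Rightarrow> nat \<Rightarrow> 'a list set \<Rightarrow> real" where
  "fr u l Q = hits (per u) 0 (int (length u)) l Q / real (length u)"

lemma hits_split: "a \<le> b \<Longrightarrow> b \<le> c \<Longrightarrow> hits x a c l Q = hits x a b l Q + hits x b c l Q"
  unfolding hits_def by (subst sum.union_disjoint[symmetric]) (auto simp: ivl_disj_un)

lemma hits_nonneg: "0 \<le> hits x a b l Q"
  unfolding hits_def by (intro sum_nonneg) auto

lemma hits_le: "a \<le> b \<Longrightarrow> hits x a b l Q \<le> b - a"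
proof -
  assume "a \<le> b"
  have "hits x a b l Q \<le> (\<Sum>z\<in>{a..<b}. 1)" unfolding hits_def by (intro sum_mono) (auto simp: indicator_def)
  then show ?thesis using \<open>a \<le> b\<close> by simp
qed

lemma hits_shift:
  "(\<And>z. a \<le> z \<Longrightarrow> z < b \<Longrightarrow> win x z l = win y (z + p) l) \<Longrightarrow> hits x a b l Q = hits y (a + p) (b + p) l Q"
  unfolding hits_def
  by (rule sum.reindex_bij_witness[of _ "\<lambda>z. z - p" "\<lambda>z. z + p"]) (auto simp: indicator_def)

lemma fr_bounds: "0 \<le> fr u l Q" "fr u l Q \<le> 1"
proof -
  show "0 \<le> fr u l Q" unfolding fr_def by (simp add: hits_nonneg)
  show "fr u l Q \<le> 1"
    using hits_le[of 0 "int (length u)" "per u" l Q] by (cases "length u = 0") (auto simp: fr_def field_simps)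
qed

lemma win_per_period: "win (per u) (z + k * int (length u)) l = win (per u) z l"
proof (rule win_cong)
  fix j show "per u (z + k * int (length u) + int j) = per u (z + int j)"
    using per_add_period[of u "z + int j" k] by (simp add: ac_simps)
qed

lemma hits_period: "u \<noteq> [] \<Longrightarrow> hits (per u) a (a + int (length u)) l Q = length u * fr u l Q"
proof -
  assume u: "u \<noteq> []"
  let ?L = "int (length u)" let ?h = "hits (per u)"
  have step: "?h (a + 1) (a + 1 + ?L) l Q = ?h a (a + ?L) l Q" for a
  proof -
    have L: "?L \<ge> 1" using u by (cases u) auto
    have "?h a (a + ?L + 1) l Q = ?h a (a + 1) l Q + ?h (a + 1) (a + 1 + ?L) l Q"
      using hits_split[of a "a + 1" "a + ?L + 1" "per u" l Q] L by (simp add: ac_simps)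
    moreover have "?h a (a + ?L + 1) l Q = ?h a (a + ?L) l Q + ?h (a + ?L) (a + ?L + 1) l Q"
      using hits_split[of a "a + ?L" "a + ?L + 1" "per u" l Q] by simp
    moreover have "?h a (a + 1) l Q = ?h (a + ?L) (a + 1 + ?L) l Q"
      using win_per_period[of u _ 1 l] by (intro hits_shift) simp
    ultimately show ?thesis by (simp add: ac_simps)
  qed
  have "?h a (a + ?L) l Q = ?h 0 (0 + ?L) l Q"
  proof (induction a rule: int_induct[of _ 0])
    case (step1 i)
    then show ?case using step[of i] by simp
  next
    case (step2 i)
    then show ?case using step[of "i - 1"] by simp
  qed simp
  then show ?thesis using u by (simp add: fr_def)
qed

text \<open>Complete periods are counted exactly; the rest is shorter than one period.\<close>

lemma hits_per:
  assumes u: "u \<noteq> []" and "a \<le> b"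
  shows "\<bar>hits (per u) a b l Q - of_int (b - a) * fr u l Q\<bar> \<le> length u"
proof -
  let ?L = "int (length u)" let ?f = "fr u l Q"
  have L: "?L > 0" using u by simp
  have mult: "hits (per u) a (a + int m * ?L) l Q = int m * ?L * ?f" for m
  proof (induction m)
    case (Suc m)
    have "hits (per u) a (a + int (Suc m) * ?L) l Q =
        hits (per u) a (a + int m * ?L) l Q + hits (per u) (a + int m * ?L) (a + int m * ?L + ?L) l Q"
      using hits_split[of a "a + int m * ?L" "a + int (Suc m) * ?L" "per u" l Q]
      by (simp add: algebra_simps)
    then show ?case using Suc hits_period[OF u, of "a + int m * ?L" l Q] by (simp add: algebra_simps)
  qed (simp add: hits_def)
  define m where "m = nat ((b - a) div ?L)"
  define c where "c = a + int m * ?L"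
  have m: "int m = (b - a) div ?L" using assms L by (simp add: m_def pos_imp_zdiv_nonneg_iff)
  have c: "c \<le> b" "b - c < ?L" "a \<le> c"
  proof -
    have "b - c = (b - a) mod ?L" unfolding c_def m by (simp add: minus_div_mult_eq_mod[symmetric])
    then show "c \<le> b" "b - c < ?L" using L pos_mod_bound[OF L, of "b - a"] pos_mod_sign[OF L, of "b - a"] by linarith+
    show "a \<le> c" by (simp add: c_def)
  qed
  have "hits (per u) a b l Q = (c - a) * ?f + hits (per u) c b l Q"
    using hits_split[OF c(3,1), of "per u" l Q] mult[of m] by (simp add: c_def)
  then have "hits (per u) a b l Q - (b - a) * ?f = hits (per u) c b l Q - (b - c) * ?f"
    by (simp add: algebra_simps)
  moreover have "0 \<le> hits (per u) c b l Q" "hits (per u) c b l Q \<le> b - c"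
    using hits_nonneg hits_le[OF c(1)] by auto
  moreover have "0 \<le> (b - c) * ?f" "(b - c) * ?f \<le> b - c"
    using c(1) fr_bounds[of u l Q] by (auto intro: mult_left_le)
  moreover have "real_of_int (b - c) \<le> real (length u)" using c(2) by linarith
  ultimately show ?thesis unfolding abs_le_iff by linarith
qed

text \<open>Only windows that reach beyond the right end of the segment can differ.\<close>

lemma hits_close:
  assumes "a \<le> b" and x: "\<And>z. a \<le> z \<Longrightarrow> z < b \<Longrightarrow> x z = y (z + p)"
  shows "\<bar>hits x a b l Q - hits y (a + p) (b + p) l Q\<bar> \<le> l"
proof -
  define c where "c = max a (b - int l)"
  have c: "a \<le> c" "c \<le> b" "b - c \<le> int l" using assms by (auto simp: c_def)
  have eq: "hits x a c l Q = hits y (a + p) (c + p) l Q"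
  proof (rule hits_shift)
    fix z assume z: "a \<le> z" "z < c"
    show "win x z l = win y (z + p) l"
    proof (rule win_cong)
      fix j assume "j < l"
      then have "x (z + int j) = y (z + int j + p)" using z by (intro x) (auto simp: c_def)
      then show "x (z + int j) = y (z + p + int j)" by (simp add: ac_simps)
    qed
  qed
  have "hits x a b l Q = hits x a c l Q + hits x c b l Q"
    "hits y (a + p) (b + p) l Q = hits y (a + p) (c + p) l Q + hits y (c + p) (b + p) l Q"
    using hits_split c by (metis add_le_cancel_right)+
  moreover have "0 \<le> hits x c b l Q" "hits x c b l Q \<le> b - c" "0 \<le> hits y (c + p) (b + p) l Q"
    "hits y (c + p) (b + p) l Q \<le> b - c"
    using hits_nonneg hits_le[OF c(2)] hits_le[of "c + p" "b + p"] c(2) by auto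
  moreover have "real_of_int (b - c) \<le> real l" using c(3) by linarith
  ultimately show ?thesis using eq unfolding abs_le_iff by linarith
qed

lemma hits_run:
  assumes u: "u \<noteq> []" and "a \<le> b" and x: "\<And>z. a \<le> z \<Longrightarrow> z < b \<Longrightarrow> x z = per u (z + p)"
  shows "\<bar>hits x a b l Q - of_int (b - a) * fr u l Q\<bar> \<le> length u + l"
  using hits_close[of a b x "per u" p l Q] hits_per[OF u, of "a + p" "b + p" l Q] assms by simp

lemma geometric_convergent:
  fixes f :: "nat \<Rightarrow> real"
  assumes "\<And>k. \<bar>f (Suc k) - f k\<bar> \<le> c * (1/4) ^ k"
  obtains L where "f \<longlonglongrightarrow> L" "\<bar>f 0 - L\<bar> \<le> c * 4 / 3"
proof -
  have g: "(\<lambda>k. c * (1/4::real) ^ k) sums (c * (1 / (1 - 1/4)))"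
    by (intro sums_mult geometric_sums) simp
  have sm: "summable (\<lambda>k. norm (f (Suc k) - f k))"
    using assms sums_summable[OF g] by (intro summable_comparison_test[OF _ sums_summable[OF g]]) auto
  then have s: "summable (\<lambda>k. f (Suc k) - f k)" by (rule summable_norm_cancel)
  have "(\<lambda>n. \<Sum>k<n. f (Suc k) - f k) \<longlonglongrightarrow> (\<Sum>k. f (Suc k) - f k)" by (rule summable_LIMSEQ[OF s])
  then have "(\<lambda>n. f n - f 0) \<longlonglongrightarrow> (\<Sum>k. f (Suc k) - f k)" by (simp add: sum_lessThan_telescope)
  from tendsto_add[OF this tendsto_const[of "f 0"]]
  have "f \<longlonglongrightarrow> (\<Sum>k. f (Suc k) - f k) + f 0" by simp
  moreover have "\<bar>\<Sum>k. f (Suc k) - f k\<bar> \<le> c * 4 / 3"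
  proof -
    have "\<bar>\<Sum>k. f (Suc k) - f k\<bar> \<le> (\<Sum>k. norm (f (Suc k) - f k))" using summable_norm[OF sm] by simp
    also have "\<dots> \<le> (\<Sum>k. c * (1/4) ^ k)" using assms by (intro suminf_le sm sums_summable[OF g]) simp
    also have "\<dots> = c * 4 / 3" using sums_unique[OF g] by simp
    finally show ?thesis .
  qed
  ultimately show ?thesis by (intro that) auto
qed

context tower
begin

text \<open>The cyclic word \<open>v (n + d)\<close> is a power of \<open>v n\<close> of length
\<open>2 * s n e\<close> followed by \<open>C n e\<close>, whose length is at most \<open>s n e /
T n\<close>.\<close>

lemma fr_step: "\<bar>fr (v (Suc (n + e))) l Q - fr (v n) l Q\<bar> \<le> (1 + real l) / T n"
proof -
  let ?u = "v (Suc (n + e))" and ?s = "int (s n e)" and ?c = "int (length (C n e))"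
  have u: "?u \<noteq> []" "v n \<noteq> []" by (rule v_nonempty)+
  have s: "length (rep (q n e) (v n)) = s n e" by (simp add: s_def B_def)
  have len: "int (length ?u) = 2 * ?s + ?c" by (simp add: length_v_rec)
  \<comment> \<open>The period is read from the second long run of \<open>v n\<close> on: the
    first long run of the next period follows at once.\<close>
  let ?a = "?s + ?c"
  have "hits (per ?u) ?a (?a + int (length ?u)) l Q =
     hits (per ?u) ?a (?a + 2 * ?s) l Q + hits (per ?u) (?a + 2 * ?s) (?a + int (length ?u)) l Q"
    by (rule hits_split) (auto simp: len)
  moreover have "hits (per ?u) ?a (?a + int (length ?u)) l Q = length ?u * fr ?u l Q"
    by (rule hits_period[OF u(1)])
  moreover have "\<bar>hits (per ?u) ?a (?a + 2 * ?s) l Q - real_of_int (?a + 2 * ?s - ?a) * fr (v n) l Q\<bar> \<le> length (v n) + l"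
  proof (rule hits_run[OF u(2), of _ _ _ "- ?a"])
    fix z assume z: "?a \<le> z" "z < ?a + 2 * ?s"
    have "per ?u z = per (C n e @ rep (q n e + q n e) (v n)) (z - ?s)"
      unfolding v_rec by (subst per_rotate) (simp only: s rep_add append.assoc)
    also have "\<dots> = per (v n) (z - ?s - ?c)"
    proof (rule per_tail_run)
      have "length (C n e) + (q n e + q n e) * length (v n) = length (C n e) + 2 * s n e"
        using s by (simp add: algebra_simps)
      then show "z - ?s < int (length (C n e) + (q n e + q n e) * length (v n))" using z by simp
    qed (use z in simp)
    finally show "per ?u z = per (v n) (z + - ?a)" by (simp add: algebra_simps)
  qed simp
  moreover have "0 \<le> hits (per ?u) (?a + 2 * ?s) (?a + int (length ?u)) l Q" by (rule hits_nonneg)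
  moreover have "hits (per ?u) (?a + 2 * ?s) (?a + int (length ?u)) l Q \<le> real_of_int (?a + int (length ?u) - (?a + 2 * ?s))"
    using hits_le[of "?a + 2 * ?s" "?a + int (length ?u)" "per ?u" l Q] by (simp add: len)
  moreover have "0 \<le> length (C n e) * fr (v n) l Q" "length (C n e) * fr (v n) l Q \<le> length (C n e)"
    using fr_bounds[of "v n" l Q] by (auto intro: mult_left_le)
  moreover have "length ?u * fr (v n) l Q = 2 * s n e * fr (v n) l Q + length (C n e) * fr (v n) l Q"
    unfolding length_v_rec by (simp add: algebra_simps)
  ultimately have main: "\<bar>length ?u * fr ?u l Q - length ?u * fr (v n) l Q\<bar> \<le> length (v n) + l + length (C n e)"
    by (simp add: len)
  have D: "real (length ?u) \<ge> T n * (length (C n e) + S n)"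
  proof -
    have "T n * (length (C n e) + S n) \<le> s n e" by (rule s_lower)
    also have "\<dots> \<le> length ?u" by (simp add: length_v_rec)
    finally show ?thesis by (simp only: of_nat_le_iff)
  qed
  have "length (v n) \<le> S n" using length_v_le_S[of 0 n] by simp
  then have num: "real (length (v n) + l + length (C n e)) \<le> (1 + real l) * (length (C n e) + S n)"
  proof -
    assume a: "length (v n) \<le> S n"
    have "real l * 1 \<le> real l * real (length (C n e) + S n)"
      using S_pos[of n] by (intro mult_left_mono) auto
    moreover have "(1 + real l) * real (length (C n e) + S n) =
        real (length (C n e)) + real (S n) + real l * real (length (C n e) + S n)"
      by (simp add: distrib_right)
    ultimately show ?thesis using a by simp
  qed
  have Tp: "real (T n) > 0" using T_pos[of n] by simp
  have up: "real (length ?u) > 0" using u(1) by simp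
  have "real (length ?u) * \<bar>fr ?u l Q - fr (v n) l Q\<bar> = \<bar>length ?u * fr ?u l Q - length ?u * fr (v n) l Q\<bar>"
    by (simp add: abs_mult flip: right_diff_distrib)
  also have "\<dots> \<le> (1 + real l) * (length (C n e) + S n)" using main num by linarith
  also have "\<dots> \<le> (1 + real l) * (length ?u / T n)"
  proof (rule mult_left_mono)
    show "real (length (C n e) + S n) \<le> length ?u / T n" using D Tp by (simp add: field_simps)
  qed simp
  also have "\<dots> = real (length ?u) * ((1 + real l) / T n)" by simp
  finally show ?thesis using up mult_le_cancel_left_pos by blast
qed

definition phi :: "nat \<Rightarrow> nat \<Rightarrow> nat list set \<Rightarrow> real" where
  "phi r l Q = lim (\<lambda>k. fr (v (r + k * Suc e)) l Q)"

lemma phi: "(\<lambda>k. fr (v (r + k * Suc e)) l Q) \<longlonglongrightarrow> phi r l Q"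
  and phi_fr: "\<bar>fr (v r) l Q - phi r l Q\<bar> \<le> (1 + real l) / 12"
proof -
  let ?f = "\<lambda>k. fr (v (r + k * Suc e)) l Q"
  have "\<bar>?f (Suc k) - ?f k\<bar> \<le> (1 + real l) / 16 * (1/4) ^ k" for k
  proof -
    let ?m = "r + k * Suc e"
    have "\<bar>?f (Suc k) - ?f k\<bar> \<le> (1 + real l) / T ?m"
      using fr_step[of ?m l Q] by (simp add: ac_simps)
    also have "\<dots> \<le> (1 + real l) / T k"
    proof -
      have "T k \<le> T ?m" by (rule T_mono) simp
      then show ?thesis using T_pos[of k] by (intro divide_left_mono mult_pos_pos) auto
    qed
    \<comment> \<open>The sum of these bounds is \<open>(1 + l) / 12\<close>.\<close>
    also have "\<dots> = (1 + real l) / 16 * (1/4) ^ k" by (simp add: T_def power_add power_divide)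
    finally show ?thesis .
  qed
  then obtain L where L: "?f \<longlonglongrightarrow> L" "\<bar>?f 0 - L\<bar> \<le> (1 + real l) / 16 * 4 / 3"
    by (rule geometric_convergent)
  then show "?f \<longlonglongrightarrow> phi r l Q" unfolding phi_def by (simp add: limI)
  then have "L = phi r l Q" using L(1) LIMSEQ_unique by blast
  then show "\<bar>fr (v r) l Q - phi r l Q\<bar> \<le> (1 + real l) / 12" using L(2) by simp
qed

text \<open>Cylinders are described by arbitrary sets \<open>Q\<close> of windows and not by
single words, so that they form a ring of sets.\<close>

section \<open>Cylinder sets and the limit measures\<close>

definition cyl :: "int \<Rightarrow> nat \<Rightarrow> nat list set \<Rightarrow> (int \<Rightarrow> nat) set" where
  "cyl a l Q = {x \<in> X. win x a l \<in> Q}"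

definition Cyl :: "(int \<Rightarrow> nat) set set" where
  "Cyl = {cyl a l Q | a l Q. True}"

lemma cyl_Cyl [simp, intro]: "cyl a l Q \<in> Cyl"
  by (auto simp: Cyl_def)

lemma cyl_widen:
  assumes "a0 \<le> a" "a + int l \<le> a0 + int m"
  shows "\<exists>Q'. cyl a l Q = cyl a0 m Q'"
proof -
  have "win x a l = take l (drop (nat (a - a0)) (win x a0 m))" for x :: "int \<Rightarrow> nat"
    using assms by (intro nth_equalityI) auto
  then have "cyl a l Q = cyl a0 m {w. take l (drop (nat (a - a0)) w) \<in> Q}"
    by (auto simp: cyl_def)
  then show ?thesis by blast
qed

lemma cyl_common:
  assumes "A \<in> Cyl" "A' \<in> Cyl"
  obtains a l Q Q' where "A = cyl a l Q" "A' = cyl a l Q'"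
proof -
  obtain a l Q a' l' Q' where A: "A = cyl a l Q" "A' = cyl a' l' Q'"
    using assms by (auto simp: Cyl_def)
  let ?a = "min a a'" let ?l = "nat (max (a + int l) (a' + int l') - ?a)"
  have "\<exists>Q1. A = cyl ?a ?l Q1" unfolding A by (rule cyl_widen) auto
  moreover have "\<exists>Q1. A' = cyl ?a ?l Q1" unfolding A by (rule cyl_widen) auto
  ultimately show ?thesis using that by blast
qed

lemma cyl_Un: "cyl a l Q \<union> cyl a l Q' = cyl a l (Q \<union> Q')"
  and cyl_Int: "cyl a l Q \<inter> cyl a l Q' = cyl a l (Q \<inter> Q')"
  and cyl_Diff: "cyl a l Q - cyl a l Q' = cyl a l (Q - Q')"
  and cyl_empty: "cyl a l {} = {}" and cyl_UNIV: "cyl a l UNIV = X"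
  by (auto simp: cyl_def)

lemma Cyl_ring: "ring_of_sets X Cyl"
  unfolding ring_of_sets_iff
proof (intro conjI ballI)
  show "Cyl \<subseteq> Pow X" by (auto simp: Cyl_def cyl_def)
  show "{} \<in> Cyl" using cyl_Cyl[of 0 0 "{}"] by (simp add: cyl_empty)
  fix a b assume "a \<in> Cyl" "b \<in> Cyl"
  then obtain i l Q Q' where "a = cyl i l Q" "b = cyl i l Q'" by (rule cyl_common)
  then show "a \<union> b \<in> Cyl" "a - b \<in> Cyl" by (auto simp: cyl_Un cyl_Diff)
qed

lemma Cyl_Int_stable: "Int_stable Cyl"
proof (rule Int_stableI)
  fix a b assume "a \<in> Cyl" "b \<in> Cyl"
  then obtain i l Q Q' where "a = cyl i l Q" "b = cyl i l Q'" by (rule cyl_common)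
  then show "a \<inter> b \<in> Cyl" by (auto simp: cyl_Int)
qed

lemma X_Cyl: "X \<in> Cyl"
  using cyl_Cyl[of 0 0 UNIV] by (simp add: cyl_UNIV)

abbreviation "BX \<equiv> sets (restrict_space borel X)"

text \<open>An open set is the union of the countably many centred cylinders inside it.\<close>

lemma BX_eq: "BX = sigma_sets X Cyl"
proof -
  have "BX = (\<inter>) X ` sigma_sets UNIV {S. open S}"
    by (simp add: sets_restrict_space borel_def)
  also have "\<dots> = sigma_sets X ((\<inter>) X ` {S. open S})"
  proof (rule sigma_sets_Int)
    have "- (- X) \<in> sigma_sets UNIV {S. open S}"
      using closed_X unfolding closed_def Compl_eq_Diff_UNIV
      by (intro sigma_sets.Compl sigma_sets.Basic) simp
    then show "X \<in> sigma_sets UNIV {S. open S}" by simp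
  qed simp
  also have "\<dots> = sigma_sets X Cyl"
  proof (rule sigma_sets_eqI)
    fix A assume "A \<in> (\<inter>) X ` {S. open S}"
    then obtain U where U: "open U" "A = X \<inter> U" by auto
    define I where "I = {(N, w). cyl (- int N) (2 * N + 1) {w} \<subseteq> U}"
    have "A = (\<Union>(N, w)\<in>I. cyl (- int N) (2 * N + 1) {w})"
    proof
      show "A \<subseteq> (\<Union>(N, w)\<in>I. cyl (- int N) (2 * N + 1) {w})"
      proof
        fix y assume y: "y \<in> A"
        then obtain N where "{x. win x (- int N) (2 * N + 1) = win y (- int N) (2 * N + 1)} \<subseteq> U"
          using open_contains_win[OF U(1)] U(2) by blast
        then have "(N, win y (- int N) (2 * N + 1)) \<in> I" by (auto simp: I_def cyl_def)
        moreover have "y \<in> cyl (- int N) (2 * N + 1) {win y (- int N) (2 * N + 1)}"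
          using y U(2) by (simp add: cyl_def)
        ultimately show "y \<in> (\<Union>(N, w)\<in>I. cyl (- int N) (2 * N + 1) {w})" by blast
      qed
      show "(\<Union>(N, w)\<in>I. cyl (- int N) (2 * N + 1) {w}) \<subseteq> A"
        unfolding U(2) I_def by (auto simp: cyl_def)
    qed
    moreover have "(\<Union>(N, w)\<in>I. cyl (- int N) (2 * N + 1) {w}) \<in> sigma_sets X Cyl"
      by (rule sigma_sets_UNION) auto
    ultimately show "A \<in> sigma_sets X Cyl" by simp
  next
    fix A assume "A \<in> Cyl"
    then obtain a l Q where "A = X \<inter> {x. win x a l \<in> Q}" by (auto simp: Cyl_def cyl_def)
    then show "A \<in> sigma_sets X ((\<inter>) X ` {S. open S})"
      using open_win by (intro sigma_sets.Basic) blast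
  qed
  finally show ?thesis .
qed

lemma cyl_sets: "cyl a l Q \<in> BX"
  unfolding BX_eq by (intro sigma_sets.Basic cyl_Cyl)

lemma space_BX: "sets M = BX \<Longrightarrow> space M = X"
  using sets_eq_imp_space_eq[of M "restrict_space borel X"] by (simp add: space_restrict_space)

lemma measure_combination:
  assumes M: "prob_space M" "sets M = BX"
    and N: "\<And>i. i \<in> I \<Longrightarrow> prob_space (N i) \<and> sets (N i) = BX"
    and c: "finite I" "(\<Sum>i\<in>I. c i) = 1"
    and eq: "\<And>a l Q. measure M (cyl a l Q) = (\<Sum>i\<in>I. c i * measure (N i) (cyl a l Q))"
    and D: "D \<in> BX"
  shows "measure M D = (\<Sum>i\<in>I. c i * measure (N i) D)"
proof -
  interpret M: prob_space M by fact
  have sp: "space M = X" "\<And>i. i \<in> I \<Longrightarrow> space (N i) = X" using space_BX M N by auto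
  have sub: "Cyl \<subseteq> Pow X" by (auto simp: Cyl_def cyl_def)
  have "D \<in> sigma_sets X Cyl" using D BX_eq by simp
  with Cyl_Int_stable sub show ?thesis
  proof (induction D rule: sigma_sets_induct_disjoint[consumes 3, case_names basic empty compl union])
    case (basic A)
    then show ?case using eq by (auto simp: Cyl_def)
  next
    case empty
    then show ?case by simp
  next
    case (compl A)
    then have A: "A \<in> sets M" "\<And>i. i \<in> I \<Longrightarrow> A \<in> sets (N i)" using M N BX_eq by auto
    have "measure M (X - A) = 1 - measure M A" using M.prob_compl[OF A(1)] sp by simp
    moreover have "measure (N i) (X - A) = 1 - measure (N i) A" if "i \<in> I" for i
      using prob_space.prob_compl[of "N i" A] N[OF that] A(2)[OF that] sp(2)[OF that] by simp
    ultimately show ?case using compl c by (simp add: right_diff_distrib sum_subtractf)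
  next
    case (union A)
    have A: "range A \<subseteq> sets M" "\<And>i. i \<in> I \<Longrightarrow> range A \<subseteq> sets (N i)" using union M N BX_eq by auto
    have "(\<lambda>n. measure M (A n)) sums measure M (\<Union>n. A n)"
      using M.finite_measure_UNION[OF A(1)] union by simp
    moreover have "(\<lambda>n. \<Sum>i\<in>I. c i * measure (N i) (A n)) sums (\<Sum>i\<in>I. c i * measure (N i) (\<Union>n. A n))"
    proof (intro sums_sum sums_mult)
      fix i assume i: "i \<in> I"
      interpret N: prob_space "N i" using N i by blast
      show "(\<lambda>n. measure (N i) (A n)) sums measure (N i) (\<Union>n. A n)"
        using N.finite_measure_UNION[OF A(2)[OF i]] union by simp
    qed
    ultimately show ?case using union sums_unique2 by simp
  qed
qed

lemma measure_eq_from_cyl: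
  assumes M: "prob_space M" "sets M = BX" and N: "prob_space N" "sets N = BX"
    and eq: "\<And>a l Q. measure M (cyl a l Q) = measure N (cyl a l Q)"
  shows "M = N"
proof (rule measure_eqI)
  show "sets M = sets N" using M N by simp
  fix B assume "B \<in> sets M"
  have eq1: "measure M B = (\<Sum>i\<in>{()}. 1 * measure N B)"
    by (rule measure_combination[OF M]) (use M N eq \<open>B \<in> sets M\<close> in auto)
  interpret M: prob_space M by fact
  interpret N: prob_space N by fact
  show "emeasure M B = emeasure N B"
    using eq1 by (simp add: M.emeasure_eq_measure N.emeasure_eq_measure)
qed

lemma shift_vimage_cyl: "shift -` cyl a l Q \<inter> X = cyl (a + 1) l Q"
  by (auto simp: cyl_def shift_eq_shift_int shift_int_X win_shift_int)

lemma shift_int_vimage_cyl: "shift_int k -` cyl a l Q \<inter> X = cyl (a + k) l Q"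
  by (auto simp: cyl_def shift_int_X win_shift_int)

lemma shift_int_measurable: "sets M = BX \<Longrightarrow> shift_int k \<in> measurable M M"
proof -
  assume M: "sets M = BX"
  note sp = space_BX[OF M]
  have "shift_int k \<in> measurable M (sigma X Cyl)"
  proof (rule measurable_measure_of)
    show "Cyl \<subseteq> Pow X" by (auto simp: Cyl_def cyl_def)
    show "shift_int k \<in> space M \<rightarrow> X" using sp shift_int_X by auto
    fix A assume "A \<in> Cyl"
    then show "shift_int k -` A \<inter> space M \<in> sets M"
      using shift_int_vimage_cyl sp cyl_sets M by (auto simp: Cyl_def)
  qed
  moreover have "sets (sigma X Cyl) = sets M"
    using BX_eq M by (subst sets_measure_of) (auto simp: Cyl_def cyl_def)
  ultimately show ?thesis using measurable_cong_sets by blast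
qed

lemma invariant_cyl:
  assumes "invariant_measure X M"
  shows "measure M (cyl a l Q) = measure M (cyl 0 l Q)"
proof -
  have step: "measure M (cyl (a + 1) l Q) = measure M (cyl a l Q)" for a
    using assms cyl_sets[of a l Q] unfolding invariant_measure_def
    by (metis measure_def shift_vimage_cyl)
  show ?thesis
  proof (induction a rule: int_induct[of _ 0])
    case (step1 i)
    then show ?case using step[of i] by simp
  next
    case (step2 i)
    then show ?case using step[of "i - 1"] by simp
  qed simp
qed

lemma invariantI:
  assumes M: "prob_space M" "sets M = BX"
    and eq: "\<And>a l Q. measure M (cyl (a + 1) l Q) = measure M (cyl a l Q)"
  shows "invariant_measure X M"
proof -
  interpret M: prob_space M by fact
  have "shift = (shift_int 1 :: (int \<Rightarrow> nat) \<Rightarrow> _)" by (rule ext) (rule shift_eq_shift_int)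
  then have sh: "shift \<in> measurable M M" using shift_int_measurable[OF M(2)] by metis
  note sp = space_BX[OF M(2)]
  have "distr M M shift = M"
  proof (rule measure_eq_from_cyl)
    show "prob_space (distr M M shift)" by (rule M.prob_space_distr[OF sh])
    show "measure (distr M M shift) (cyl a l Q) = measure M (cyl a l Q)" for a l Q
      using cyl_sets M(2) sh sp eq shift_vimage_cyl by (subst measure_distr) auto
  qed (use M in auto)
  then have "emeasure M (shift -` B \<inter> X) = emeasure M B" if "B \<in> sets M" for B
    using emeasure_distr[OF sh that] sp by simp
  then show ?thesis unfolding invariant_measure_def using M by auto
qed

lemma invariant_eqI:
  assumes "invariant_measure X M" "invariant_measure X N"
    and "\<And>l Q. measure M (cyl 0 l Q) = measure N (cyl 0 l Q)"
  shows "M = N"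
proof (rule measure_eq_from_cyl)
  show "measure M (cyl a l Q) = measure N (cyl a l Q)" for a l Q
    using assms(3)[of l Q] invariant_cyl[OF assms(1), of a] invariant_cyl[OF assms(2), of a] by simp
qed (use assms in \<open>auto simp: invariant_measure_def\<close>)

lemma compact_X: "compact X"
proof -
  have "compactin (product_topology (\<lambda>_::int. euclidean :: nat topology) UNIV) (PiE UNIV (\<lambda>_. {..e}))"
    unfolding compactin_PiE by (simp add: compactin_euclidean_iff finite_imp_compact)
  then have "compact (PiE UNIV (\<lambda>_::int. {..e}))"
    by (simp add: euclidean_product_topology)
  moreover have "X = PiE UNIV (\<lambda>_::int. {..e}) \<inter> X" using X_letters by auto
  ultimately show ?thesis using closed_X compact_Int_closed by metis
qed

text \<open>Orbits in \<open>X\<close> are used here, and not the periodic sequences themselves,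
because the latter do not belong to \<open>X\<close>: the empirical measures, and with them their
limits, then live on \<open>X\<close>.\<close>

definition freq :: "nat \<Rightarrow> nat \<Rightarrow> (int \<Rightarrow> nat) set \<Rightarrow> real" where
  "freq r k A = (\<Sum>z\<in>{0..<int (length (chain r k))}. indicator A (shift_int z (base_point r))) / length (chain r k)"

lemma freq_cyl: "freq r k (cyl a l Q) = hits (base_point r) a (a + int (length (chain r k))) l Q / length (chain r k)"
proof -
  have "(\<Sum>z\<in>{0..<int (length (chain r k))}. indicator (cyl a l Q) (shift_int z (base_point r)) :: real) =
    hits (base_point r) a (a + int (length (chain r k))) l Q"
    unfolding hits_def
    by (rule sum.reindex_bij_witness[of _ "\<lambda>z. z - a" "\<lambda>z. z + a"])
      (auto simp: cyl_def shift_int_X base_point_X win_shift_int indicator_def ac_simps)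
  then show ?thesis by (simp add: freq_def)
qed

lemma freq_lim: "(\<lambda>k. freq r k (cyl a l Q)) \<longlonglongrightarrow> phi r l Q"
proof -
  let ?L = "\<lambda>k. int (length (chain r k))"
  have W: "chain r k \<noteq> []" for k by (simp add: chain_def v_nonempty)
  have close: "\<bar>freq r k (cyl a l Q) - fr (chain r k) l Q\<bar> \<le> (2 * \<bar>a\<bar> + l) / real (Suc k)" for k
  proof -
    have L: "real (length (chain r k)) \<ge> real (Suc k)" using chain_length[of k r] by simp
    have 1: "\<bar>hits (base_point r) 0 (?L k) l Q - hits (per (chain r k)) (0 + 0) (?L k + 0) l Q\<bar> \<le> l"
    proof (rule hits_close)
      fix z assume z: "0 \<le> z" "z < ?L k"
      then obtain j where j: "z = int j" "j < length (chain r k)" using nonneg_int_cases by (metis of_nat_less_iff)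
      have "base_point r z = win (base_point r) 0 (length (chain r k)) ! j" using j by simp
      also have "\<dots> = chain r k ! j" by (simp only: base_point_right)
      also have "\<dots> = per (chain r k) (z + 0)" using j by (simp add: per_of_nat)
      finally show "base_point r z = per (chain r k) (z + 0)" .
    qed simp
    have 2: "\<bar>hits (base_point r) a (a + ?L k) l Q - hits (base_point r) 0 (?L k) l Q\<bar> \<le> 2 * \<bar>real_of_int a\<bar>"
    proof (cases "a \<ge> 0")
      case True
      have "hits (base_point r) 0 (a + ?L k) l Q = hits (base_point r) 0 a l Q + hits (base_point r) a (a + ?L k) l Q"
        "hits (base_point r) 0 (a + ?L k) l Q = hits (base_point r) 0 (?L k) l Q + hits (base_point r) (?L k) (a + ?L k) l Q"
        using True by (intro hits_split; simp)+
      moreover have "0 \<le> hits (base_point r) 0 a l Q" "hits (base_point r) 0 a l Q \<le> a"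
        "0 \<le> hits (base_point r) (?L k) (a + ?L k) l Q" "hits (base_point r) (?L k) (a + ?L k) l Q \<le> a"
        using True hits_nonneg hits_le[of 0 a "base_point r" l Q] hits_le[of "?L k" "a + ?L k" "base_point r" l Q] by auto
      ultimately show ?thesis using True unfolding abs_le_iff by linarith
    next
      case False
      have "hits (base_point r) a (?L k) l Q = hits (base_point r) a 0 l Q + hits (base_point r) 0 (?L k) l Q"
        "hits (base_point r) a (?L k) l Q = hits (base_point r) a (a + ?L k) l Q + hits (base_point r) (a + ?L k) (?L k) l Q"
        using False by (intro hits_split; simp)+
      moreover have "0 \<le> hits (base_point r) a 0 l Q" "hits (base_point r) a 0 l Q \<le> - a"
        "0 \<le> hits (base_point r) (a + ?L k) (?L k) l Q" "hits (base_point r) (a + ?L k) (?L k) l Q \<le> - a"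
        using False hits_nonneg hits_le[of a 0 "base_point r" l Q] hits_le[of "a + ?L k" "?L k" "base_point r" l Q] by auto
      ultimately show ?thesis using False unfolding abs_le_iff by linarith
    qed
    have "\<bar>hits (base_point r) a (a + ?L k) l Q - hits (per (chain r k)) 0 (?L k) l Q\<bar> \<le> 2 * \<bar>real_of_int a\<bar> + l"
      using 1 2 by simp
    then have "\<bar>hits (base_point r) a (a + ?L k) l Q - hits (per (chain r k)) 0 (?L k) l Q\<bar> / length (chain r k)
      \<le> (2 * \<bar>real_of_int a\<bar> + l) / length (chain r k)"
      by (intro divide_right_mono) auto
    also have "\<dots> \<le> (2 * \<bar>real_of_int a\<bar> + l) / real (Suc k)"
      using L by (intro divide_left_mono mult_pos_pos) auto
    finally show ?thesis
      by (simp add: freq_cyl fr_def abs_divide flip: diff_divide_distrib)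
  qed
  have "(\<lambda>k. (2 * \<bar>a\<bar> + l) / real (Suc k)) \<longlonglongrightarrow> 0"
    by (intro LIMSEQ_Suc lim_const_over_n)
  then have "(\<lambda>k. freq r k (cyl a l Q) - fr (chain r k) l Q) \<longlonglongrightarrow> 0"
    by (rule Lim_null_comparison[rotated]) (use close in simp)
  from tendsto_add[OF this phi[of r l Q]] show ?thesis by (simp add: chain_def)
qed

lemma freq_conv: "A \<in> Cyl \<Longrightarrow> (\<lambda>k. freq r k A) \<longlonglongrightarrow> lim (\<lambda>k. freq r k A)"
  using freq_lim convergent_def convergent_LIMSEQ_iff by (fastforce simp: Cyl_def)

lemma freq_nonneg: "0 \<le> freq r k A"
  by (auto simp: freq_def intro!: divide_nonneg_nonneg sum_nonneg)

text \<open>On the ring of cylinders the limits of the frequencies are finitely additive. A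
decreasing sequence of cylinders with empty intersection is eventually empty, since
\<open>X\<close> is compact; so the theorem of Caratheodory applies.\<close>

theorem mu_exists:
  "\<exists>M. prob_space M \<and> sets M = BX \<and> (\<forall>a l Q. measure M (cyl a l Q) = phi r l Q)"
proof -
  define F where "F A = lim (\<lambda>k. freq r k A)" for A
  have F0: "0 \<le> F A" if "A \<in> Cyl" for A
    using freq_conv[OF that, of r] freq_nonneg unfolding F_def by (intro LIMSEQ_le_const) auto
  have F_empty: "F {} = 0" unfolding F_def freq_def by simp
  have F_add: "F (A \<union> A') = F A + F A'" if "A \<in> Cyl" "A' \<in> Cyl" "A \<inter> A' = {}" for A A'
  proof -
    have "freq r k (A \<union> A') = freq r k A + freq r k A'" for k
      using that(3) by (simp add: freq_def indicator_disj_union sum.distrib add_divide_distrib)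
    then have "(\<lambda>k. freq r k (A \<union> A')) \<longlonglongrightarrow> F A + F A'"
      using tendsto_add[OF freq_conv[OF that(1), of r] freq_conv[OF that(2), of r]] by (simp add: F_def)
    then show ?thesis unfolding F_def by (rule limI)
  qed
  have F_cyl: "F (cyl a l Q) = phi r l Q" for a l Q
    unfolding F_def using freq_lim by (rule limI)
  interpret ring_of_sets X Cyl by (rule Cyl_ring)
  have "\<exists>\<mu> :: (int \<Rightarrow> nat) set \<Rightarrow> ennreal. (\<forall>s \<in> Cyl. \<mu> s = ennreal (F s)) \<and> measure_space X (sigma_sets X Cyl) \<mu>"
  proof (rule caratheodory_empty_continuous)
    show "positive Cyl (\<lambda>s. ennreal (F s))" by (simp add: positive_def F_empty)
    show "additive Cyl (\<lambda>s. ennreal (F s))"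
      unfolding additive_def
    proof (intro ballI impI)
      fix A A' assume "A \<in> Cyl" "A' \<in> Cyl" "A \<inter> A' = {}"
      then show "ennreal (F (A \<union> A')) = ennreal (F A) + ennreal (F A')"
        by (simp only: F_add ennreal_plus[OF F0 F0])
    qed
    fix A :: "nat \<Rightarrow> (int \<Rightarrow> nat) set"
    assume A: "range A \<subseteq> Cyl" "decseq A" "(\<Inter>i. A i) = {}"
    have "\<exists>i. A i = {}"
    proof (rule ccontr)
      assume ne: "\<nexists>i. A i = {}"
      have "X \<inter> (\<Inter>i\<in>UNIV. A i) \<noteq> {}"
      proof (rule compact_imp_fip_image[OF compact_X])
        fix i
        have "A i \<in> Cyl" using A(1) by auto
        then obtain a l Q where "A i = cyl a l Q" by (auto simp: Cyl_def)
        then have "A i = X \<inter> {x. win x a l \<in> Q}" by (auto simp: cyl_def)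
        then show "closed (A i)" using closed_X closed_win by auto
      next
        fix I' :: "nat set" assume I': "finite I'"
        then obtain m where "\<forall>i\<in>I'. i \<le> m" using finite_nat_set_iff_bounded_le by blast
        then have "A m \<subseteq> (\<Inter>i\<in>I'. A i)" using A(2) by (auto simp: decseq_def)
        moreover have "A m \<subseteq> X" using A(1) sets_into_space by blast
        ultimately show "X \<inter> (\<Inter>i\<in>I'. A i) \<noteq> {}" using ne by blast
      qed
      then show False using A(3) by simp
    qed
    then obtain i where "A i = {}" by blast
    then have "eventually (\<lambda>j. A j = {}) sequentially"
      using A(2) unfolding eventually_sequentially decseq_def by blast
    then have "eventually (\<lambda>j. ennreal (F (A j)) = 0) sequentially"
      by eventually_elim (simp add: F_empty)
    then show "(\<lambda>i. ennreal (F (A i))) \<longlonglongrightarrow> 0" by (rule tendsto_eventually)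
  qed simp
  then obtain \<mu> :: "(int \<Rightarrow> nat) set \<Rightarrow> ennreal"
    where \<mu>: "\<And>s. s \<in> Cyl \<Longrightarrow> \<mu> s = ennreal (F s)" "measure_space X (sigma_sets X Cyl) \<mu>"
    by blast
  define M where "M = measure_of X (sigma_sets X Cyl) \<mu>"
  have sa: "sigma_algebra X (sigma_sets X Cyl)" using \<mu>(2) by (simp add: measure_space_def)
  have sM: "sets M = BX" unfolding M_def BX_eq using sa by (simp add: sigma_algebra.sets_measure_of_eq)
  have em: "emeasure M A = ennreal (F A)" if "A \<in> Cyl" for A
  proof -
    have "emeasure M A = \<mu> A"
      unfolding M_def using \<mu>(2) that by (intro emeasure_measure_of_sigma) (auto simp: measure_space_def)
    then show ?thesis using \<mu>(1)[OF that] by simp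
  qed
  have pr: "prob_space M"
  proof
    have "F X = 1"
    proof -
      have "freq r k X = 1" for k
        using v_nonempty by (simp add: freq_def shift_int_X base_point_X chain_def)
      then show ?thesis unfolding F_def by simp
    qed
    then show "emeasure M (space M) = 1" using em[OF X_Cyl] space_BX[OF sM] by simp
  qed
  have "measure M (cyl a l Q) = phi r l Q" for a l Q
    using em[of "cyl a l Q"] F0[of "cyl a l Q"] by (simp add: measure_def F_cyl)
  then show ?thesis using pr sM by blast
qed

definition mu :: "nat \<Rightarrow> (int \<Rightarrow> nat) measure" where
  "mu r = (SOME M. prob_space M \<and> sets M = BX \<and> (\<forall>a l Q. measure M (cyl a l Q) = phi r l Q))"

lemma mu: "prob_space (mu r)" "sets (mu r) = BX" "measure (mu r) (cyl a l Q) = phi r l Q"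
  using someI_ex[OF mu_exists[of r]] unfolding mu_def by blast+

lemma mu_invariant: "invariant_measure X (mu r)"
  by (rule invariantI) (simp_all add: mu)

text \<open>The word \<open>v r\<close> is the letter \<open>r\<close>, and the total change of
frequencies along its residue class is at most \<open>1/6\<close>.\<close>

lemma phi_letter:
  assumes "r \<le> e"
  shows "phi r (Suc 0) {[r]} \<ge> 5/6" "i \<noteq> r \<Longrightarrow> phi r (Suc 0) {[i]} \<le> 1/6"
proof -
  have "fr (v r) (Suc 0) {[i]} = (if i = r then 1 else 0)" for i
    using assms by (simp add: fr_def hits_def v_base win_def per_def)
  then have *: "\<bar>(if i = r then 1 else 0) - phi r (Suc 0) {[i]}\<bar> \<le> 1/6" for i
    using phi_fr[of r "Suc 0" "{[i]}"] by simp
  have "\<bar>1 - phi r (Suc 0) {[r]}\<bar> \<le> 1/6" using *[of r] by simp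
  then show "phi r (Suc 0) {[r]} \<ge> 5/6" by linarith
  assume "i \<noteq> r"
  then have "\<bar>0 - phi r (Suc 0) {[i]}\<bar> \<le> 1/6" using *[of i] by simp
  then show "phi r (Suc 0) {[i]} \<le> 1/6" by linarith
qed

end

section \<open>Invariant, ergodic and generic measures\<close>

lemma simultaneous_subsequence:
  fixes C :: "nat \<Rightarrow> nat \<Rightarrow> real"
  assumes C: "\<And>k i. 0 \<le> C k i \<and> C k i \<le> 1"
  shows "\<exists>r. strict_mono (r :: nat \<Rightarrow> nat) \<and> (\<forall>i<m. convergent (\<lambda>k. C (r k) i))"
proof (induction m)
  case 0
  show ?case by (intro exI[of _ id]) (auto simp: strict_mono_def)
next
  case (Suc m)
  then obtain r :: "nat \<Rightarrow> nat" where r: "strict_mono r" "\<And>i. i < m \<Longrightarrow> convergent (\<lambda>k. C (r k) i)" by blast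
  have "bounded (range (\<lambda>k. C (r k) m))"
    using C by (intro boundedI[where B = 1]) auto
  then obtain l r' where r': "strict_mono r'" "((\<lambda>k. C (r k) m) \<circ> r') \<longlonglongrightarrow> l"
    using bounded_imp_convergent_subsequence by blast
  have "convergent (\<lambda>k. C ((r \<circ> r') k) i)" if "i < Suc m" for i
  proof (cases "i = m")
    case True
    then show ?thesis using r'(2) by (auto simp: convergent_def o_def)
  next
    case False
    then have "convergent (\<lambda>k. C (r k) i)" using r(2) that by simp
    then have "convergent ((\<lambda>k. C (r k) i) \<circ> r')" using convergent_subseq_convergent r'(1) by blast
    then show ?thesis by (simp add: o_def)
  qed
  then show ?case using strict_mono_o[OF r(1) r'(1)] by blast
qed

lemma continuous_on_indicator_clopen:
  assumes "open U" "closed U"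
  shows "continuous_on S (indicator U :: 'a::topological_space \<Rightarrow> real)"
  unfolding continuous_on_open_invariant
proof (intro allI impI)
  fix D :: "real set"
  let ?f = "indicator U :: 'a \<Rightarrow> real"
  have "?f -` D = (if 1 \<in> D then U else {}) \<union> (if 0 \<in> D then - U else {})"
    by (auto simp: indicator_def of_bool_def split: if_splits)
  moreover have "open \<dots>" using assms by (auto simp: open_Compl)
  ultimately have "open (?f -` D)" by simp
  then show "\<exists>A. open A \<and> A \<inter> S = ?f -` D \<inter> S" by blast
qed

lemma prob_le_imp_eq:
  assumes "prob_space M" "prob_space N" "sets N = sets M"
    and le: "\<And>B. B \<in> sets M \<Longrightarrow> emeasure N B \<le> emeasure M B"
  shows "N = M"
proof (rule measure_eqI)
  interpret M: prob_space M by fact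
  interpret N: prob_space N by fact
  have sp: "space N = space M" using assms(3) by (rule sets_eq_imp_space_eq)
  fix B assume "B \<in> sets N"
  then have B: "B \<in> sets M" "B \<in> sets N" using assms(3) by auto
  have "measure N A \<le> measure M A" if "A \<in> sets M" for A
    using le[OF that] by (simp add: M.emeasure_eq_measure N.emeasure_eq_measure)
  from this[OF B(1)] this[of "space M - B"] have "measure N B = measure M B"
    using B M.prob_compl[OF B(1)] N.prob_compl[OF B(2)] sp by auto
  then show "emeasure N B = emeasure M B" by (simp add: M.emeasure_eq_measure N.emeasure_eq_measure)
qed (use assms in simp)

lemma strict_mono_mult_Suc: "strict_mono (r :: nat \<Rightarrow> nat) \<Longrightarrow> strict_mono (\<lambda>k. r k * Suc e)"
  by (rule strict_monoI, rule mult_less_mono1) (auto simp: strict_mono_def)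

lemma abs_scaled: "c > 0 \<Longrightarrow> \<bar>a - c * f\<bar> / c = \<bar>a / c - f\<bar>" for a c f :: real
proof -
  assume c: "c > 0"
  then have "a / c - f = (a - c * f) / c" by (simp add: diff_divide_distrib)
  then show ?thesis using c by (simp add: abs_divide)
qed

context tower
begin

definition succ_pos :: "nat \<Rightarrow> nat" where "succ_pos i = (if i < e then Suc i else 0)"

lemma succ_index_eq: "succ_index n i = n + succ_pos i" and succ_pos_le: "succ_pos i \<le> e"
  by (auto simp: succ_index_def succ_pos_def)

lemma X_window:
  assumes "x \<in> X"
  obtains i b p where "i \<le> e" "0 \<le> b" "b \<le> int (s n 0)"
    "\<And>z. 0 \<le> z \<Longrightarrow> z < b \<Longrightarrow> x z = per (v (n + i)) (z + p)"
    "\<And>z. b \<le> z \<Longrightarrow> z < int (s n 0) \<Longrightarrow> x z = per (v (n + succ_pos i)) (z + p)"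
proof -
  let ?W = "s n 0"
  have "normal n (win x 0 ?W)" using Lang_normal X_win[OF assms] by simp
  then obtain i a c where i: "i \<le> e" "sublist (win x 0 ?W) (rep a (v (n + i)) @ rep c (v (succ_index n i)))"
    unfolding normal_def by blast
  then obtain p where p: "win x 0 ?W = win (het (v (n + i)) [] (v (succ_index n i))) p ?W"
    using sublist_two_het by (metis length_win)
  have x: "x z = het (v (n + i)) [] (v (succ_index n i)) (p + z)" if z: "0 \<le> z" "z < int ?W" for z
  proof -
    obtain j where j: "z = int j" using nonneg_int_cases[OF z(1)] by blast
    then show ?thesis using p z by (auto simp: win_eq_iff)
  qed
  show ?thesis
  proof (rule that[of i "max 0 (min (int ?W) (- p))" p])
    fix z assume "0 \<le> z" "z < max 0 (min (int ?W) (- p))"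
    then have "0 \<le> z" "z < int ?W" "p + z < 0" by auto
    then show "x z = per (v (n + i)) (z + p)" using x[of z] by (simp add: het_def ac_simps)
  next
    fix z assume "max 0 (min (int ?W) (- p)) \<le> z" "z < int ?W"
    then have "0 \<le> z" "z < int ?W" "p + z \<ge> 0" by auto
    then show "x z = per (v (n + succ_pos i)) (z + p)" using x[of z] by (simp add: het_def succ_index_eq ac_simps)
  qed (use i in auto)
qed

text \<open>The window \<open>u\<close> consists of two periodic pieces, and \<open>\<rho>\<close>
gives their relative lengths. The weights depend on the window only, which makes them measurable
functions of the point.\<close>

definition good_weights :: "nat \<Rightarrow> nat list \<Rightarrow> (nat \<Rightarrow> real) \<Rightarrow> bool" where
  "good_weights n u \<rho> \<longleftrightarrow> (\<forall>i. 0 \<le> \<rho> i \<and> \<rho> i \<le> 1) \<and> (\<Sum>i\<le>e. \<rho> i) = 1 \<and>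
     (\<forall>y. win y 0 (s n 0) = u \<longrightarrow> (\<forall>l Q.
       \<bar>hits y 0 (int (s n 0)) l Q - s n 0 * (\<Sum>i\<le>e. \<rho> i * fr (v (n + i)) l Q)\<bar> \<le> 2 * S n + 2 * l))"

lemma weights_exist:
  assumes "x \<in> X"
  shows "\<exists>\<rho>. good_weights n (win x 0 (s n 0)) \<rho>"
proof -
  let ?W = "s n 0"
  obtain i b p where i: "i \<le> e" and b: "0 \<le> b" "b \<le> int ?W"
    and x1: "\<And>z. 0 \<le> z \<Longrightarrow> z < b \<Longrightarrow> x z = per (v (n + i)) (z + p)"
    and x2: "\<And>z. b \<le> z \<Longrightarrow> z < int ?W \<Longrightarrow> x z = per (v (n + succ_pos i)) (z + p)"
    using X_window[OF assms, of n] by blast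
  define t where "t = real_of_int b / ?W"
  have W: "real ?W > 0" using s_ge_1[of n 0] by simp
  have t: "0 \<le> t" "t \<le> 1" using b W by (auto simp: t_def field_simps)
  define \<rho> where "\<rho> j = (if j = i then t else 0) + (if j = succ_pos i then 1 - t else 0)" for j
  have sum: "(\<Sum>j\<le>e. \<rho> j * f j) = t * f i + (1 - t) * f (succ_pos i)" for f :: "nat \<Rightarrow> real"
  proof -
    have "(\<Sum>j\<le>e. \<rho> j * f j) = (\<Sum>j\<le>e. (if j = i then t * f j else 0) + (if j = succ_pos i then (1 - t) * f j else 0))"
      by (intro sum.cong) (auto simp: \<rho>_def algebra_simps)
    also have "\<dots> = t * f i + (1 - t) * f (succ_pos i)"
      using i succ_pos_le[of i] by (simp add: sum.distrib)
    finally show ?thesis .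
  qed
  have "\<bar>hits y 0 (int ?W) l Q - ?W * (\<Sum>i\<le>e. \<rho> i * fr (v (n + i)) l Q)\<bar> \<le> 2 * S n + 2 * l"
    if y: "win y 0 ?W = win x 0 ?W" for y l Q
  proof -
    have yx: "y z = x z" if z: "0 \<le> z" "z < int ?W" for z
    proof -
      obtain j where "z = int j" using nonneg_int_cases[OF z(1)] by blast
      then show ?thesis using y z by (auto simp: win_eq_iff)
    qed
    have 1: "\<bar>hits y 0 b l Q - of_int (b - 0) * fr (v (n + i)) l Q\<bar> \<le> length (v (n + i)) + l"
      using yx x1 b by (intro hits_run[OF v_nonempty, where p = p]) auto
    have 2: "\<bar>hits y b (int ?W) l Q - of_int (int ?W - b) * fr (v (n + succ_pos i)) l Q\<bar> \<le> length (v (n + succ_pos i)) + l"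
      using yx x2 b by (intro hits_run[OF v_nonempty, where p = p]) auto
    have "length (v (n + i)) \<le> S n" "length (v (n + succ_pos i)) \<le> S n"
      using length_v_le_S i succ_pos_le by auto
    then have 3: "real (length (v (n + i)) + l) \<le> S n + l" "real (length (v (n + succ_pos i)) + l) \<le> S n + l"
      by linarith+
    have 4: "hits y 0 (int ?W) l Q = hits y 0 b l Q + hits y b (int ?W) l Q"
      using b by (rule hits_split)
    have "?W * (\<Sum>i\<le>e. \<rho> i * fr (v (n + i)) l Q)
        = ?W * t * fr (v (n + i)) l Q + (?W - ?W * t) * fr (v (n + succ_pos i)) l Q"
      unfolding sum by (simp add: algebra_simps)
    also have "?W * t = b" using W by (simp add: t_def)
    finally have 5: "?W * (\<Sum>i\<le>e. \<rho> i * fr (v (n + i)) l Q)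
        = of_int (b - 0) * fr (v (n + i)) l Q + of_int (int ?W - b) * fr (v (n + succ_pos i)) l Q" by simp
    show ?thesis using 1 2 3 unfolding 4 5 by linarith
  qed
  moreover have "(\<Sum>j\<le>e. \<rho> j) = 1" using sum[of "\<lambda>_. 1"] by simp
  moreover have "0 \<le> \<rho> j \<and> \<rho> j \<le> 1" for j using t by (simp add: \<rho>_def)
  ultimately show ?thesis unfolding good_weights_def by blast
qed

text \<open>By invariance, the measure of a cylinder is the integral of its average over the
window \<open>[0, s n 0)\<close>, and the average is nearly a convex combination of frequencies in
\<open>v n, \<dots>, v (n + e)\<close>. The coefficients are the integrals of the weights.\<close>

lemma invariant_approx:
  assumes "invariant_measure X M"
  shows "\<exists>C. (\<forall>i. 0 \<le> C i \<and> C i \<le> 1) \<and> (\<Sum>i\<le>e. C i) = 1 \<and>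
    (\<forall>l Q. \<bar>measure M (cyl 0 l Q) - (\<Sum>i\<le>e. C i * fr (v (n + i)) l Q)\<bar> \<le> (2 + 2 * real l) / T n)"
proof -
  let ?W = "s n 0"
  have M: "prob_space M" "sets M = BX" using assms by (auto simp: invariant_measure_def)
  interpret prob_space M by (rule M)
  have sp: "space M = X" by (rule space_BX[OF M(2)])
  define \<rho> where "\<rho> u = (SOME r. good_weights n u r)" for u
  have good: "good_weights n (win x 0 ?W) (\<rho> (win x 0 ?W))" if "x \<in> X" for x
    unfolding \<rho>_def using weights_exist[OF that] by (rule someI_ex)
  have wm: "(\<lambda>x. win x 0 ?W) \<in> measurable M (count_space UNIV)"
  proof (rule measurableI)
    fix Q :: "nat list set"
    have "(\<lambda>x. win x 0 ?W) -` Q \<inter> space M = cyl 0 ?W Q" by (auto simp: sp cyl_def)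
    then show "(\<lambda>x. win x 0 ?W) -` Q \<inter> space M \<in> sets M" using cyl_sets M(2) by simp
  qed simp
  have \<rho>m: "(\<lambda>x. \<rho> (win x 0 ?W) i) \<in> borel_measurable M" for i
    using measurable_compose[OF wm, of "\<lambda>u. \<rho> u i" borel] by simp
  have \<rho>b: "0 \<le> \<rho> (win x 0 ?W) i \<and> \<rho> (win x 0 ?W) i \<le> 1" if "x \<in> X" for x i
    using good[OF that] unfolding good_weights_def by blast
  have \<rho>i: "integrable M (\<lambda>x. \<rho> (win x 0 ?W) i)" for i
    by (rule integrable_const_bound[where B = 1]) (use \<rho>b \<rho>m sp in auto)
  define C where "C i = (\<integral>x. \<rho> (win x 0 ?W) i \<partial>M)" for i
  have C01: "0 \<le> C i \<and> C i \<le> 1" for i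
    unfolding C_def using \<rho>b sp \<rho>i by (auto intro!: integral_le_const integral_ge_const)
  have C1: "(\<Sum>i\<le>e. C i) = 1"
  proof -
    have "(\<Sum>i\<le>e. C i) = (\<integral>x. (\<Sum>i\<le>e. \<rho> (win x 0 ?W) i) \<partial>M)"
      unfolding C_def by (subst Bochner_Integration.integral_sum) (use \<rho>i in auto)
    also have "\<dots> = (\<integral>x. 1 \<partial>M)"
      by (rule Bochner_Integration.integral_cong) (use good sp in \<open>auto simp: good_weights_def\<close>)
    finally show ?thesis by (simp add: prob_space)
  qed
  have "\<bar>measure M (cyl 0 l Q) - (\<Sum>i\<le>e. C i * fr (v (n + i)) l Q)\<bar> \<le> (2 + 2 * real l) / T n" for l Q
  proof -
    let ?h = "\<lambda>x. hits x 0 (int ?W) l Q"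
    let ?g = "\<lambda>x. ?W * (\<Sum>i\<le>e. \<rho> (win x 0 ?W) i * fr (v (n + i)) l Q)"
    let ?c = "\<lambda>x. (\<Sum>z\<in>{0..<int ?W}. indicator (cyl z l Q) x) :: real"
    have hc: "?h x = ?c x" if "x \<in> space M" for x
      using that sp unfolding hits_def by (intro sum.cong) (auto simp: cyl_def indicator_def)
    have ind: "integrable M (indicator (cyl z l Q) :: _ \<Rightarrow> real)" for z
      by (rule integrable_real_indicator) (use cyl_sets M(2) in \<open>simp_all add: less_top[symmetric]\<close>)
    have ci: "integrable M ?c" by (rule Bochner_Integration.integrable_sum) (rule ind)
    have hi: "integrable M ?h" by (rule iffD2[OF Bochner_Integration.integrable_cong[OF refl hc] ci])
    have "(\<integral>x. ?h x \<partial>M) = (\<integral>x. ?c x \<partial>M)" using hc by (intro Bochner_Integration.integral_cong) auto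
    also have "\<dots> = (\<Sum>z\<in>{0..<int ?W}. measure M (cyl z l Q))"
    proof (subst Bochner_Integration.integral_sum)
      show "integrable M (indicator (cyl z l Q) :: _ \<Rightarrow> real)" for z by (rule ind)
      show "(\<Sum>z\<in>{0..<int ?W}. \<integral>x. indicator (cyl z l Q) x \<partial>M) = (\<Sum>z\<in>{0..<int ?W}. measure M (cyl z l Q))"
        using cyl_sets M(2) sp by (intro sum.cong) (auto simp: cyl_def Int_absorb2)
    qed
    also have "\<dots> = (\<Sum>z\<in>{0..<int ?W}. measure M (cyl 0 l Q))"
      by (intro sum.cong invariant_cyl[OF assms]) auto
    finally have H: "(\<integral>x. ?h x \<partial>M) = ?W * measure M (cyl 0 l Q)" by simp
    have gi: "integrable M ?g" using \<rho>i by auto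
    have G: "(\<integral>x. ?g x \<partial>M) = ?W * (\<Sum>i\<le>e. C i * fr (v (n + i)) l Q)"
      unfolding C_def using \<rho>i by simp
    have dev: "\<bar>?h x - ?g x\<bar> \<le> 2 * S n + 2 * l" if "x \<in> space M" for x
      using good[of x] that sp unfolding good_weights_def by blast
    have "(\<integral>x. ?h x - ?g x \<partial>M) \<le> 2 * S n + 2 * l"
      using hi gi dev by (intro integral_le_const AE_I2) (auto simp: abs_le_iff)
    moreover have "- (2 * S n + 2 * real l) \<le> (\<integral>x. ?h x - ?g x \<partial>M)"
    proof (intro integral_ge_const AE_I2)
      fix x assume "x \<in> space M"
      from dev[OF this] show "- (2 * S n + 2 * real l) \<le> ?h x - ?g x" by (simp add: abs_le_iff)
    qed (use hi gi in auto)
    moreover have "(\<integral>x. ?h x - ?g x \<partial>M) = ?W * measure M (cyl 0 l Q) - ?W * (\<Sum>i\<le>e. C i * fr (v (n + i)) l Q)"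
      by (simp only: Bochner_Integration.integral_diff[OF hi gi] H G)
    ultimately have "\<bar>?W * measure M (cyl 0 l Q) - ?W * (\<Sum>i\<le>e. C i * fr (v (n + i)) l Q)\<bar> \<le> 2 * S n + 2 * l"
      unfolding abs_le_iff of_nat_add of_nat_mult of_nat_numeral by linarith
    then have "?W * \<bar>measure M (cyl 0 l Q) - (\<Sum>i\<le>e. C i * fr (v (n + i)) l Q)\<bar> \<le> 2 * S n + 2 * real l"
      by (simp add: abs_mult flip: right_diff_distrib)
    also have "\<dots> \<le> (2 + 2 * real l) * S n"
    proof -
      have "real l * 1 \<le> real l * real (S n)" using S_pos[of n] by (intro mult_left_mono) auto
      then show ?thesis by (simp add: algebra_simps)
    qed
    also have "\<dots> \<le> (2 + 2 * real l) * (?W / T n)"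
    proof (rule mult_left_mono)
      have "T n * S n \<le> ?W" using s_lower[of n 0] by simp
      then have "real (T n) * real (S n) \<le> real ?W" by (metis of_nat_le_iff of_nat_mult)
      then show "real (S n) \<le> ?W / T n" using T_pos[of n] by (simp add: field_simps)
    qed simp
    also have "\<dots> = ?W * ((2 + 2 * real l) / T n)" by simp
    finally show ?thesis by (rule mult_left_le_imp_le) (use s_ge_1[of n 0] in simp)
  qed
  then show ?thesis using C01 C1 by blast
qed

text \<open>The coefficients at the stages \<open>k * d\<close> have a convergent subsequence, and
the frequencies at these stages tend to \<open>phi\<close>.\<close>

theorem invariant_decomposition:
  assumes "invariant_measure X M"
  obtains c where "\<And>i. 0 \<le> c i" "(\<Sum>i\<le>e. c i) = 1"
    "\<And>l Q. measure M (cyl 0 l Q) = (\<Sum>i\<le>e. c i * phi i l Q)"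
proof -
  have "\<forall>k. \<exists>C. (\<forall>i. 0 \<le> C i \<and> C i \<le> 1) \<and> (\<Sum>i\<le>e. C i) = 1 \<and>
    (\<forall>l Q. \<bar>measure M (cyl 0 l Q) - (\<Sum>i\<le>e. C i * fr (v (k * Suc e + i)) l Q)\<bar> \<le> (2 + 2 * real l) / T (k * Suc e))"
    using invariant_approx[OF assms] by blast
  from choice[OF this] obtain C where *: "\<forall>k. (\<forall>i. 0 \<le> C k i \<and> C k i \<le> 1) \<and> (\<Sum>i\<le>e. C k i) = 1 \<and>
    (\<forall>l Q. \<bar>measure M (cyl 0 l Q) - (\<Sum>i\<le>e. C k i * fr (v (k * Suc e + i)) l Q)\<bar> \<le> (2 + 2 * real l) / T (k * Suc e))" ..
  have C: "\<And>k i. 0 \<le> C k i \<and> C k i \<le> 1" "\<And>k. (\<Sum>i\<le>e. C k i) = 1"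
    "\<And>k l Q. \<bar>measure M (cyl 0 l Q) - (\<Sum>i\<le>e. C k i * fr (v (k * Suc e + i)) l Q)\<bar> \<le> (2 + 2 * real l) / T (k * Suc e)"
    using * by blast+
  obtain r where r: "strict_mono r" "\<And>i. i < Suc e \<Longrightarrow> convergent (\<lambda>k. C (r k) i)"
    using simultaneous_subsequence[of C "Suc e"] C(1) by blast
  define c where "c i = (if i \<le> e then lim (\<lambda>k. C (r k) i) else 0)" for i
  have c: "(\<lambda>k. C (r k) i) \<longlonglongrightarrow> c i" if "i \<le> e" for i
    using r(2)[of i] that by (simp add: c_def convergent_LIMSEQ_iff)
  have c0: "0 \<le> c i" for i
  proof (cases "i \<le> e")
    case True
    then show ?thesis using C(1) by (intro LIMSEQ_le_const[OF c]) auto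
  qed (simp add: c_def)
  have "(\<lambda>k. \<Sum>i\<le>e. C (r k) i) \<longlonglongrightarrow> (\<Sum>i\<le>e. c i)" using c by (intro tendsto_sum) auto
  then have "(\<lambda>k. 1) \<longlonglongrightarrow> (\<Sum>i\<le>e. c i)" using C(2) by simp
  from LIMSEQ_unique[OF this tendsto_const] have c1: "(\<Sum>i\<le>e. c i) = 1" .
  have "measure M (cyl 0 l Q) = (\<Sum>i\<le>e. c i * phi i l Q)" for l Q
  proof -
    have "(\<lambda>k. fr (v (r k * Suc e + i)) l Q) \<longlonglongrightarrow> phi i l Q" for i
      using LIMSEQ_subseq_LIMSEQ[OF phi[of i l Q] r(1)] by (simp add: o_def add.commute)
    then have 1: "(\<lambda>k. \<Sum>i\<le>e. C (r k) i * fr (v (r k * Suc e + i)) l Q) \<longlonglongrightarrow> (\<Sum>i\<le>e. c i * phi i l Q)"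
      using c by (intro tendsto_sum tendsto_mult) auto
    have "(\<lambda>k. (2 + 2 * real l) / T (r k * Suc e)) \<longlonglongrightarrow> 0"
    proof -
      have "strict_mono (\<lambda>k. r k * Suc e)" by (rule strict_mono_mult_Suc[OF r(1)])
      from LIMSEQ_subseq_LIMSEQ[OF T_lim this] show ?thesis by (simp add: o_def)
    qed
    then have "(\<lambda>k. measure M (cyl 0 l Q) - (\<Sum>i\<le>e. C (r k) i * fr (v (r k * Suc e + i)) l Q)) \<longlonglongrightarrow> 0"
      by (rule Lim_null_comparison[rotated]) (use C(3) in auto)
    from tendsto_add[OF this 1] have "(\<lambda>k. measure M (cyl 0 l Q)) \<longlonglongrightarrow> (\<Sum>i\<le>e. c i * phi i l Q)" by simp
    then show ?thesis using LIMSEQ_const_iff by blast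
  qed
  then show ?thesis using c0 c1 that by blast
qed

lemma concentrated:
  fixes c f :: "nat \<Rightarrow> real"
  assumes "\<And>j. 0 \<le> c j" "(\<Sum>j\<le>e. c j) = 1" "i \<le> e" "c i = 1"
  shows "(\<Sum>j\<le>e. c j * f j) = f i"
proof -
  have "(\<Sum>j\<le>e. c j) = c i + (\<Sum>j\<in>{..e} - {i}. c j)" using assms(3) by (intro sum.remove) auto
  then have "(\<Sum>j\<in>{..e} - {i}. c j) = 0" using assms by simp
  then have "c j = 0" if "j \<in> {..e} - {i}" for j
    using that assms(1) sum_nonneg_eq_0_iff[of "{..e} - {i}" c] by auto
  then have "(\<Sum>j\<in>{..e} - {i}. c j * f j) = 0" by (intro sum.neutral) auto
  moreover have "(\<Sum>j\<le>e. c j * f j) = c i * f i + (\<Sum>j\<in>{..e} - {i}. c j * f j)"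
    using assms(3) by (intro sum.remove) auto
  ultimately show ?thesis using assms(4) by simp
qed

lemma phi_extreme:
  assumes c: "\<And>j. 0 \<le> c j" "(\<Sum>j\<le>e. c j) = 1" and i: "i \<le> e"
    and eq: "phi i (Suc 0) {[i]} = (\<Sum>j\<le>e. c j * phi j (Suc 0) {[i]})"
  shows "c i = 1"
proof -
  let ?f = "\<lambda>j. phi j (Suc 0) {[i]}"
  have R: "(\<Sum>j\<in>{..e} - {i}. c j) = 1 - c i"
    using c(2) i sum.remove[of "{..e}" i c] by simp
  have "(\<Sum>j\<in>{..e} - {i}. c j * ?f j) \<le> (\<Sum>j\<in>{..e} - {i}. c j * (1/6))"
    using c(1) phi_letter(2)[of _ i] by (intro sum_mono mult_left_mono) auto
  also have "\<dots> = (1 - c i) / 6" using R by (simp flip: sum_divide_distrib)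
  finally have "?f i \<le> c i * ?f i + (1 - c i) / 6"
    using eq i sum.remove[of "{..e}" i "\<lambda>j. c j * ?f j"] by (simp only: finite_atMost atMost_iff)
  then have le: "(1 - c i) * (?f i - 1/6) \<le> 0" by (simp add: algebra_simps)
  have "?f i - 1/6 > 0" using phi_letter(1)[OF i] by linarith
  then have "1 - c i \<le> 0" using le by (metis less_eq_real_def linorder_not_less mult_pos_pos)
  moreover have "0 \<le> 1 - c i" unfolding R[symmetric] using c(1) by (intro sum_nonneg) auto
  ultimately show ?thesis by linarith
qed

lemma shift_X: "x \<in> X \<Longrightarrow> shift x \<in> X"
  by (simp add: shift_eq_shift_int shift_int_X)

lemma uniform_invariant:
  assumes M: "invariant_measure X M" and D: "D \<in> sets M" "shift -` D \<inter> X = D" "measure M D > 0"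
  shows "invariant_measure X (uniform_measure M D)"
proof (rule invariantI)
  have P: "prob_space M" "sets M = BX" using M by (auto simp: invariant_measure_def)
  interpret prob_space M by (rule P)
  have em: "emeasure M D \<noteq> 0" "emeasure M D \<noteq> \<infinity>" using D(3) by (auto simp: emeasure_eq_measure)
  show "prob_space (uniform_measure M D)" using em by (rule prob_space_uniform_measure)
  show "sets (uniform_measure M D) = BX" using P by simp
  fix a l Q
  have c: "cyl a l Q \<in> sets M" "cyl (a + 1) l Q \<in> sets M" using cyl_sets P by auto
  have "D \<inter> cyl (a + 1) l Q = shift -` (D \<inter> cyl a l Q) \<inter> X"
    using D(2) shift_vimage_cyl[of a l Q] by blast
  then have "measure M (D \<inter> cyl (a + 1) l Q) = measure M (D \<inter> cyl a l Q)"
    using M D(1) c unfolding invariant_measure_def by (metis measure_def sets.Int)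
  then show "measure (uniform_measure M D) (cyl (a + 1) l Q) = measure (uniform_measure M D) (cyl a l Q)"
    using em D(1) c by simp
qed

text \<open>An invariant set \<open>D\<close> of measure strictly between \<open>0\<close> and
\<open>1\<close> writes \<open>mu i\<close> as a proper convex combination of its two conditional
measures. These are convex combinations of all the \<open>mu j\<close>, so by extremality the
first of them is equal to \<open>mu i\<close>; but it gives mass \<open>1\<close> to
\<open>D\<close>.\<close>

theorem mu_ergodic:
  assumes i: "i \<le> e"
  shows "ergodic_measure X (mu i)"
  unfolding ergodic_measure_def
proof (intro conjI mu_invariant ballI impI)
  interpret prob_space "mu i" by (rule mu)
  have sp: "space (mu i) = X" by (rule space_BX[OF mu(2)])
  fix D assume D: "D \<in> sets (mu i)" "shift -` D \<inter> X = D"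
  show "prob D = 0 \<or> prob D = 1"
  proof (rule ccontr)
    assume n: "\<not> (prob D = 0 \<or> prob D = 1)"
    define p where "p = prob D"
    have p: "0 < p" "p < 1" using n prob_le_1[of D] measure_nonneg[of "mu i" D] by (auto simp: p_def less_le)
    have DX: "D \<subseteq> X" using D(1) sets.sets_into_space sp by blast
    let ?E = "X - D"
    have E: "?E \<in> sets (mu i)" "prob ?E = 1 - p"
      using D(1) prob_compl[OF D(1)] sets.compl_sets[OF D(1)] by (simp_all add: sp p_def)
    have Einv: "shift -` ?E \<inter> X = ?E" using D(2) shift_X by auto
    let ?M = "uniform_measure (mu i) D" and ?N = "uniform_measure (mu i) ?E"
    have iM: "invariant_measure X ?M" by (rule uniform_invariant[OF mu_invariant D]) (use p in \<open>simp add: p_def\<close>)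
    have iN: "invariant_measure X ?N" by (rule uniform_invariant[OF mu_invariant E(1) Einv]) (use p E in simp)
    obtain a where a: "\<And>j. 0 \<le> a j" "(\<Sum>j\<le>e. a j) = 1" "\<And>l Q. measure ?M (cyl 0 l Q) = (\<Sum>j\<le>e. a j * phi j l Q)"
      using invariant_decomposition[OF iM] by metis
    obtain b where b: "\<And>j. 0 \<le> b j" "(\<Sum>j\<le>e. b j) = 1" "\<And>l Q. measure ?N (cyl 0 l Q) = (\<Sum>j\<le>e. b j * phi j l Q)"
      using invariant_decomposition[OF iN] by metis
    define c where "c j = p * a j + (1 - p) * b j" for j
    have em: "emeasure (mu i) D \<noteq> 0" "emeasure (mu i) D \<noteq> \<infinity>" "emeasure (mu i) ?E \<noteq> 0" "emeasure (mu i) ?E \<noteq> \<infinity>"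
      using p E(2) by (auto simp: emeasure_eq_measure p_def)
    have comb: "phi i l Q = (\<Sum>j\<le>e. c j * phi j l Q)" for l Q
    proof -
      let ?c = "cyl 0 l Q"
      have cs: "?c \<in> sets (mu i)" using cyl_sets mu(2) by simp
      have "prob ?c = prob (D \<inter> ?c) + prob (?E \<inter> ?c)"
      proof -
        have "?c = (D \<inter> ?c) \<union> (?E \<inter> ?c)" using sets.sets_into_space[OF cs] sp by auto
        moreover have "prob ((D \<inter> ?c) \<union> (?E \<inter> ?c)) = prob (D \<inter> ?c) + prob (?E \<inter> ?c)"
          by (rule finite_measure_Union) (use cs D(1) E(1) in auto)
        ultimately show ?thesis by (simp only:)
      qed
      also have "prob (D \<inter> ?c) = p * measure ?M ?c" using em D(1) cs p by (simp add: p_def)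
      also have "prob (?E \<inter> ?c) = (1 - p) * measure ?N ?c" using em E cs p by simp
      finally show ?thesis
        by (simp add: mu(3) a(3) b(3) c_def sum_distrib_left algebra_simps sum.distrib sum_subtractf)
    qed
    have c0: "0 \<le> c j" for j using a(1)[of j] b(1)[of j] p by (simp add: c_def)
    have c1: "(\<Sum>j\<le>e. c j) = 1"
      unfolding c_def by (simp add: sum.distrib a(2) b(2) flip: sum_distrib_left)
    have ci: "c i = 1" by (rule phi_extreme[OF c0 c1 i comb])
    have ab: "a i \<le> 1" "b i \<le> 1"
      using member_le_sum[of i "{..e}" a] member_le_sum[of i "{..e}" b] a b i by auto
    have "a i = 1"
    proof (rule ccontr)
      assume "a i \<noteq> 1"
      then have "p * a i < p * 1" using ab p by (intro mult_strict_left_mono) auto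
      moreover have "(1 - p) * b i \<le> (1 - p) * 1" using ab p by (intro mult_left_mono) auto
      ultimately show False using ci by (simp add: c_def)
    qed
    then have "measure ?M (cyl 0 l Q) = measure (mu i) (cyl 0 l Q)" for l Q
      using concentrated[OF a(1,2) i] a(3) mu(3) by simp
    then have "?M = mu i" by (rule invariant_eqI[OF iM mu_invariant])
    moreover have "measure ?M D = 1" using em D(1) p by (simp add: p_def)
    ultimately show False using p by (simp add: p_def)
  qed
qed

lemma shift_int_invariant:
  assumes M: "invariant_measure X M" and D: "D \<in> BX"
  shows "shift_int k -` D \<inter> X \<in> BX" "emeasure M (shift_int k -` D \<inter> X) = emeasure M D"
proof -
  have P: "prob_space M" "sets M = BX" using M by (auto simp: invariant_measure_def)
  interpret prob_space M by (rule P)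
  note sp = space_BX[OF P(2)]
  have sh: "shift_int k \<in> measurable M M" by (rule shift_int_measurable[OF P(2)])
  show "shift_int k -` D \<inter> X \<in> BX" using measurable_sets[OF sh, of D] D P sp by simp
  have "distr M M (shift_int k) = M"
  proof (rule measure_eq_from_cyl)
    show "prob_space (distr M M (shift_int k))" by (rule prob_space_distr[OF sh])
    show "measure (distr M M (shift_int k)) (cyl a l Q) = measure M (cyl a l Q)" for a l Q
    proof -
      have "measure (distr M M (shift_int k)) (cyl a l Q) = measure M (cyl (a + k) l Q)"
        using cyl_sets P(2) sh sp shift_int_vimage_cyl by (subst measure_distr) auto
      then show ?thesis using invariant_cyl[OF M, of a] invariant_cyl[OF M, of "a + k"] by simp
    qed
  qed (use P in auto)
  then show "emeasure M (shift_int k -` D \<inter> X) = emeasure M D"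
    using emeasure_distr[OF sh, of D] D P(2) sp by simp
qed

text \<open>Let \<open>Y\<close> be the negative part of a Hahn decomposition of \<open>N -
M\<close>. As both measures are invariant, each translate of \<open>Y\<close> is a set on which
\<open>N \<le> M\<close>, and so is the union \<open>U\<close> of all translates; outside of
\<open>U\<close>, and hence outside of \<open>Y\<close>, one has \<open>M \<le> N\<close>. The set
\<open>U\<close> is strictly invariant, so \<open>M\<close> is concentrated on \<open>U\<close>,
and then so is \<open>N\<close> by absolute continuity, or on the complement of \<open>U\<close>.
In both cases one of the two probability measures is below the other, and they are equal.\<close>

lemma ergodic_dominates:
  assumes M: "ergodic_measure X M" and N: "invariant_measure X N"
    and ac: "\<And>B. B \<in> BX \<Longrightarrow> emeasure M B = 0 \<Longrightarrow> emeasure N B = 0"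
  shows "N = M"
proof -
  have iM: "invariant_measure X M" using M by (simp add: ergodic_measure_def)
  have PM: "prob_space M" "sets M = BX" using iM by (auto simp: invariant_measure_def)
  have PN: "prob_space N" "sets N = BX" using N by (auto simp: invariant_measure_def)
  interpret M: prob_space M by (rule PM)
  interpret N: prob_space N by (rule PN)
  note sp = space_BX[OF PM(2)]
  have eqs: "sets N = sets M" using PM PN by simp
  from finite_unsigned_Hahn_decomposition[OF M.finite_measure_axioms N.finite_measure_axioms eqs]
  obtain Y where Y: "Y \<in> sets M"
    and Hahn: "(\<forall>Z\<in>sets M. Z \<subseteq> Y \<longrightarrow> emeasure N Z \<le> emeasure M Z) \<and>
      (\<forall>Z\<in>sets M. Z \<inter> Y = {} \<longrightarrow> emeasure M Z \<le> emeasure N Z)"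
    by (rule bexE)
  have below: "emeasure N Z \<le> emeasure M Z" if "Z \<in> sets M" "Z \<subseteq> Y" for Z
    using Hahn that by simp
  have above: "emeasure M Z \<le> emeasure N Z" if "Z \<in> sets M" "Z \<inter> Y = {}" for Z
    using Hahn that by simp
  define A where "A k = shift_int k -` Y \<inter> X" for k
  have A: "A k \<in> sets M" for k
    unfolding A_def PM(2) using Y PM(2) by (intro shift_int_invariant(1)[OF iM]) simp
  have leA: "emeasure N Z \<le> emeasure M Z" if Z: "Z \<in> sets M" "Z \<subseteq> A k" for Z k
  proof -
    let ?Z = "shift_int (- k) -` Z \<inter> X"
    have ZX: "Z \<subseteq> X" using sets.sets_into_space[OF Z(1)] sp by simp
    have "?Z \<subseteq> Y"
    proof
      fix x assume "x \<in> ?Z"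
      then have "shift_int (- k) x \<in> A k" using Z(2) by auto
      then show "x \<in> Y" by (simp add: A_def shift_int_add shift_int_0)
    qed
    moreover have "?Z \<in> sets M" using shift_int_invariant(1)[OF iM] Z(1) PM(2) by simp
    ultimately have "emeasure N ?Z \<le> emeasure M ?Z" by (rule below[rotated])
    then show ?thesis using shift_int_invariant(2)[OF iM, of Z "- k"] shift_int_invariant(2)[OF N, of Z "- k"] Z(1) PM(2) by simp
  qed
  define U where "U = (\<Union>k. A k)"
  have U: "U \<in> sets M" unfolding U_def using A by auto
  have UX: "U \<subseteq> X" by (auto simp: U_def A_def)
  have leU: "emeasure N Z \<le> emeasure M Z" if Z: "Z \<in> sets M" "Z \<subseteq> U" for Z
  proof -
    define F where "F n = Z \<inter> disjointed (\<lambda>n. A (from_nat n)) n" for n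
    have Fs: "range F \<subseteq> sets M"
    proof -
      have "range (disjointed (\<lambda>n. A (from_nat n))) \<subseteq> sets M"
        by (rule sets.range_disjointed_sets) (use A in auto)
      then show ?thesis using Z(1) by (auto simp: F_def)
    qed
    have Fd: "disjoint_family F"
      using disjoint_family_disjointed[of "\<lambda>n. A (from_nat n)"] by (auto simp: F_def disjoint_family_on_def)
    have "U = (\<Union>n. A (from_nat n))" unfolding U_def by (metis (no_types) UN_extend_simps(10) surj_from_nat)
    then have FZ: "(\<Union>n. F n) = Z"
      using Z(2) UN_disjointed_eq[of "\<lambda>n. A (from_nat n)"] by (auto simp: F_def)
    have "emeasure N Z = (\<Sum>n. emeasure N (F n))"
      using suminf_emeasure[of F N] Fs Fd FZ eqs by simp
    also have "\<dots> \<le> (\<Sum>n. emeasure M (F n))"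
    proof (intro suminf_le)
      fix n
      have "F n \<subseteq> A (from_nat n)" using disjointed_subset[of "\<lambda>n. A (from_nat n)" n] by (auto simp: F_def)
      then show "emeasure N (F n) \<le> emeasure M (F n)" using Fs by (intro leA) auto
    qed auto
    also have "\<dots> = emeasure M Z" using suminf_emeasure[of F M] Fs Fd FZ by simp
    finally show ?thesis .
  qed
  have "shift -` U \<inter> X = U"
  proof -
    have "x \<in> shift -` U \<inter> X \<longleftrightarrow> x \<in> U" for x
    proof -
      have "shift x \<in> U \<longleftrightarrow> shift x \<in> X \<and> (\<exists>k. shift_int (k + 1) x \<in> Y)"
        by (auto simp: U_def A_def shift_eq_shift_int shift_int_add)
      moreover have "(\<exists>k. shift_int (k + 1) x \<in> Y) \<longleftrightarrow> (\<exists>k. shift_int k x \<in> Y)"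
        by (metis diff_add_cancel)
      ultimately show ?thesis by (auto simp: U_def A_def shift_eq_shift_int shift_int_X)
    qed
    then show ?thesis by blast
  qed
  then consider "M.prob U = 0" | "M.prob U = 1" using M U unfolding ergodic_measure_def by blast
  then show ?thesis
  proof cases
    case 1
    have "M = N"
    proof (rule prob_le_imp_eq[OF PN(1) PM(1)])
      fix D assume "D \<in> sets N"
      then have D: "D \<in> sets M" using eqs by simp
      have "Y \<subseteq> U"
      proof
        fix x assume "x \<in> Y"
        then have "x \<in> A 0" using sets.sets_into_space[OF Y] sp by (auto simp: A_def shift_int_0)
        then show "x \<in> U" unfolding U_def by blast
      qed
      then have d: "(D - U) \<inter> Y = {}" by blast
      have "emeasure M D \<le> emeasure M (D - U) + emeasure M U"
        by (rule order_trans[OF emeasure_mono emeasure_subadditive]) (use D U in auto)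
      also have "\<dots> = emeasure M (D - U)" using 1 by (simp add: M.emeasure_eq_measure)
      also have "\<dots> \<le> emeasure N (D - U)" using D U d by (intro above) auto
      also have "\<dots> \<le> emeasure N D" using D eqs U by (intro emeasure_mono) auto
      finally show "emeasure M D \<le> emeasure N D" .
    qed (use eqs in simp)
    then show ?thesis ..
  next
    case 2
    show ?thesis
    proof (rule prob_le_imp_eq[OF PM(1) PN(1) eqs])
      fix D assume D: "D \<in> sets M"
      have "emeasure M (X - U) = 0"
        using M.prob_compl[OF U] 2 sp by (simp add: M.emeasure_eq_measure)
      moreover have XU: "X - U \<in> sets M" using sets.compl_sets[OF U] sp by simp
      ultimately have 0: "emeasure N (X - U) = 0" using ac PM(2) by simp
      have "D \<subseteq> X" using sets.sets_into_space[OF D] sp by simp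
      have "emeasure N D \<le> emeasure N (D \<inter> U) + emeasure N (X - U)"
        by (rule order_trans[OF emeasure_mono emeasure_subadditive]) (use \<open>D \<subseteq> X\<close> D U XU eqs in auto)
      also have "\<dots> = emeasure N (D \<inter> U)" using 0 by simp
      also have "\<dots> \<le> emeasure M (D \<inter> U)" using D U by (intro leU) auto
      also have "\<dots> \<le> emeasure M D" using D U by (intro emeasure_mono) auto
      finally show "emeasure N D \<le> emeasure M D" .
    qed
  qed
qed

theorem ergodic_is_mu:
  assumes "ergodic_measure X M"
  shows "\<exists>i\<le>e. M = mu i"
proof -
  have iM: "invariant_measure X M" using assms by (simp add: ergodic_measure_def)
  have P: "prob_space M" "sets M = BX" using iM by (auto simp: invariant_measure_def)
  interpret prob_space M by (rule P)
  obtain c where c: "\<And>j. 0 \<le> c j" "(\<Sum>j\<le>e. c j) = 1" "\<And>l Q. measure M (cyl 0 l Q) = (\<Sum>j\<le>e. c j * phi j l Q)"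
    using invariant_decomposition[OF iM] by metis
  obtain i where i: "i \<le> e" "c i > 0"
  proof -
    have "\<exists>i\<in>{..e}. c i \<noteq> 0" using c(2) sum.neutral[of "{..e}" c] by fastforce
    then show ?thesis using c(1) that by (metis atMost_iff less_eq_real_def)
  qed
  have comb: "measure M D = (\<Sum>j\<le>e. c j * measure (mu j) D)" if "D \<in> BX" for D
  proof (rule measure_combination[OF P _ _ _ _ that])
    show "measure M (cyl a l Q) = (\<Sum>j\<le>e. c j * measure (mu j) (cyl a l Q))" for a l Q
      using invariant_cyl[OF iM, of a l Q] c(3) by (simp add: mu(3))
  qed (use mu c in auto)
  have "mu i = M"
  proof (rule ergodic_dominates[OF assms mu_invariant])
    fix D assume D: "D \<in> BX" "emeasure M D = 0"
    interpret N: prob_space "mu i" by (rule mu)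
    have "c i * measure (mu i) D \<le> (\<Sum>j\<le>e. c j * measure (mu j) D)"
      using i c(1) by (intro member_le_sum) auto
    also have "\<dots> = 0" using comb[OF D(1)] D(2) by (simp add: measure_def[of M])
    finally have "measure (mu i) D \<le> 0" using i(2) by (simp add: mult_le_0_iff)
    then have "measure (mu i) D = 0" using measure_nonneg[of "mu i" D] by linarith
    then show "emeasure (mu i) D = 0" by (simp add: N.emeasure_eq_measure)
  qed
  then show ?thesis using i by blast
qed

lemma mu_inj: "inj_on mu {..e}"
proof (rule inj_onI)
  fix i j assume ij: "i \<in> {..e}" "j \<in> {..e}" "mu i = mu j"
  then have "phi i (Suc 0) {[i]} = phi j (Suc 0) {[i]}" using mu(3) by metis
  then show "i = j" using phi_letter(1)[of i] phi_letter(2)[of j i] ij by force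
qed

text \<open>If the first periodic piece of the window \<open>[0, s n 0)\<close> occupies at least
the fraction \<open>1 / 2 ^ n\<close> of it, take \<open>N\<close> as the length of this piece,
and otherwise the length of the whole window.\<close>

lemma pure_prefix:
  assumes x: "x \<in> X"
  shows "\<exists>N i. n \<le> N \<and> 0 < N \<and> i \<le> e \<and>
    (\<forall>l Q. \<bar>hits x 0 (int N) l Q / N - fr (v (n + i)) l Q\<bar> \<le> (2 + real l) / 2 ^ n)"
proof -
  let ?W = "s n 0"
  obtain i b p where i: "i \<le> e" and b: "0 \<le> b" "b \<le> int ?W"
    and x1: "\<And>z. 0 \<le> z \<Longrightarrow> z < b \<Longrightarrow> x z = per (v (n + i)) (z + p)"
    and x2: "\<And>z. b \<le> z \<Longrightarrow> z < int ?W \<Longrightarrow> x z = per (v (n + succ_pos i)) (z + p)"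
    using X_window[OF x, of n] by blast
  have l1: "length (v (n + i)) \<le> S n" and l2: "length (v (n + succ_pos i)) \<le> S n"
    using length_v_le_S i succ_pos_le by auto
  have Sp: "real (S n) \<ge> 1" using S_pos[of n] by simp
  have WS: "real ?W \<ge> 2 ^ n * (2 ^ n * real (S n))"
  proof -
    have "T n * S n \<le> ?W" using s_lower[of n 0] by simp
    then have "real (T n) * real (S n) \<le> real ?W" by (metis of_nat_le_iff of_nat_mult)
    moreover have "real (T n) = 16 * (2 ^ n * 2 ^ n)" by (simp add: T_def power_add flip: power_mult_distrib)
    moreover have "2 ^ n * 2 ^ n * real (S n) \<le> 16 * (2 ^ n * 2 ^ n) * real (S n)"
      by (intro mult_right_mono) auto
    ultimately show ?thesis by (simp only: mult.assoc)
  qed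
  have Sl: "real (S n) + real l \<le> (1 + real l) * real (S n)" for l
    using mult_left_mono[OF Sp, of "real l"] by (simp add: algebra_simps)
  have n2: "real n < 2 ^ n" by (rule of_nat_less_two_power)
  show ?thesis
  proof (cases "real_of_int b * 2 ^ n \<ge> ?W")
    case True
    have bS: "real_of_int b \<ge> 2 ^ n * real (S n)"
    proof -
      have "2 ^ n * (2 ^ n * real (S n)) \<le> 2 ^ n * real_of_int b"
        using order_trans[OF WS True] by (simp only: mult.commute[of "real_of_int b"])
      then show ?thesis by (rule mult_left_le_imp_le) simp
    qed
    have "1 * 1 \<le> 2 ^ n * real (S n)" using Sp by (intro mult_mono) auto
    then have b0: "real_of_int b > 0" using bS by linarith
    define N where "N = nat b"
    have N: "int N = b" "real N = b" using b by (auto simp: N_def)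
    have "2 ^ n * 1 \<le> 2 ^ n * real (S n)" using Sp by (intro mult_left_mono) auto
    then have "real n \<le> real N" using n2 bS N by linarith
    moreover have "0 < N" using b0 N by linarith
    moreover have "\<bar>hits x 0 (int N) l Q / N - fr (v (n + i)) l Q\<bar> \<le> (2 + real l) / 2 ^ n" for l Q
    proof -
      have "\<bar>hits x 0 b l Q - of_int (b - 0) * fr (v (n + i)) l Q\<bar> \<le> length (v (n + i)) + l"
        using x1 b by (intro hits_run[OF v_nonempty, where p = p]) auto
      then have "\<bar>hits x 0 b l Q - b * fr (v (n + i)) l Q\<bar> \<le> (1 + real l) * S n" using l1 Sl[of l] by simp
      also have "\<dots> \<le> (1 + real l) * (b / 2 ^ n)" using bS by (intro mult_left_mono) (auto simp: field_simps)
      finally have "\<bar>hits x 0 b l Q - b * fr (v (n + i)) l Q\<bar> / b \<le> (1 + real l) * (b / 2 ^ n) / b"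
        using b0 by (intro divide_right_mono) auto
      also have "\<dots> = (1 + real l) / 2 ^ n" using b0 by simp
      also have "\<dots> \<le> (2 + real l) / 2 ^ n" by (intro divide_right_mono) auto
      also have "\<bar>hits x 0 b l Q - b * fr (v (n + i)) l Q\<bar> / b = \<bar>hits x 0 b l Q / b - fr (v (n + i)) l Q\<bar>"
        by (rule abs_scaled[OF b0])
      finally show ?thesis unfolding N .
    qed
    ultimately show ?thesis using i by (intro exI[of _ N] exI[of _ i]) auto
  next
    case False
    have W0: "real ?W > 0" using s_ge_1[of n 0] by simp
    have "\<bar>hits x 0 (int ?W) l Q / ?W - fr (v (n + succ_pos i)) l Q\<bar> \<le> (2 + real l) / 2 ^ n" for l Q
    proof -
      let ?f = "fr (v (n + succ_pos i)) l Q"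
      have "\<bar>hits x b (int ?W) l Q - of_int (int ?W - b) * ?f\<bar> \<le> length (v (n + succ_pos i)) + l"
        using x2 b by (intro hits_run[OF v_nonempty, where p = p]) auto
      moreover have "real (length (v (n + succ_pos i)) + l) \<le> (1 + real l) * S n" using l2 Sl[of l] by simp
      moreover have "hits x 0 (int ?W) l Q = hits x 0 b l Q + hits x b (int ?W) l Q" using b by (rule hits_split)
      moreover have "0 \<le> hits x 0 b l Q" "hits x 0 b l Q \<le> b" using hits_nonneg hits_le[OF b(1), of x l Q] by auto
      moreover have "0 \<le> b * ?f" "b * ?f \<le> b" using b fr_bounds[of "v (n + succ_pos i)" l Q] by (auto intro: mult_left_le)
      moreover have "?W * ?f = b * ?f + of_int (int ?W - b) * ?f" by (simp add: algebra_simps)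
      ultimately have "\<bar>hits x 0 (int ?W) l Q - ?W * ?f\<bar> \<le> b + (1 + real l) * S n"
        unfolding abs_le_iff by linarith
      also have "\<dots> \<le> ?W / 2 ^ n + (1 + real l) * (?W / 2 ^ n)"
      proof (intro add_mono mult_left_mono)
        show "real_of_int b \<le> ?W / 2 ^ n" using False by (simp add: field_simps)
        have "1 * (2 ^ n * real (S n)) \<le> 2 ^ n * (2 ^ n * real (S n))" by (intro mult_right_mono) auto
        then have "2 ^ n * real (S n) \<le> ?W" using WS by linarith
        then show "real (S n) \<le> ?W / 2 ^ n" by (simp add: field_simps)
      qed simp
      also have "\<dots> = (2 + real l) / 2 ^ n * ?W" by (simp add: field_simps)
      finally have "\<bar>hits x 0 (int ?W) l Q - ?W * ?f\<bar> / ?W \<le> (2 + real l) / 2 ^ n"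
        using W0 by (simp add: pos_divide_le_eq)
      moreover have "\<bar>hits x 0 (int ?W) l Q - ?W * ?f\<bar> / ?W = \<bar>hits x 0 (int ?W) l Q / ?W - ?f\<bar>"
        by (rule abs_scaled[OF W0])
      ultimately show ?thesis by simp
    qed
    then show ?thesis using n_le_s[of n] W0 succ_pos_le[of i] by (intro exI[of _ ?W] exI[of _ "succ_pos i"]) auto
  qed
qed

lemma generic_averages:
  assumes M: "sets M = BX" and x: "generic_point X M x"
  shows "(\<lambda>N. hits x 0 (int N) l Q / N) \<longlonglongrightarrow> measure M (cyl 0 l Q)"
proof -
  let ?U = "{y :: int \<Rightarrow> nat. win y 0 l \<in> Q}"
  have sp: "space M = X" by (rule space_BX[OF M])
  have "continuous_on X (indicator ?U :: _ \<Rightarrow> real)"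
    by (rule continuous_on_indicator_clopen[OF open_win closed_win])
  then have lim: "(\<lambda>N. 1 / real N * (\<Sum>n<N. indicator ?U ((shift ^^ n) x))) \<longlonglongrightarrow> (\<integral>y. indicator ?U y \<partial>M)"
    using x unfolding generic_point_def by blast
  have "(\<Sum>n<N. indicator ?U ((shift ^^ n) x) :: real) = hits x 0 (int N) l Q" for N
    unfolding hits_def
    by (rule sum.reindex_bij_witness[of _ nat int])
      (auto simp: shift_int_of_nat[symmetric] win_shift_int indicator_def)
  moreover have "(\<integral>y. indicator ?U y \<partial>M) = measure M (cyl 0 l Q)"
  proof -
    have "(\<integral>y. indicator ?U y \<partial>M) = (\<integral>y. indicator (cyl 0 l Q) y \<partial>M :: real)"
      by (rule Bochner_Integration.integral_cong) (auto simp: sp cyl_def indicator_def)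
    also have "\<dots> = measure M (cyl 0 l Q)"
      using cyl_sets M sp by (auto simp: cyl_def Int_absorb2)
    finally show ?thesis .
  qed
  ultimately show ?thesis using lim by simp
qed

text \<open>The stages \<open>k * d\<close> provide initial segments that are almost pure of type
\<open>i\<close>, with \<open>i \<le> e\<close> depending on \<open>k\<close>; some
\<open>i\<close> occurs for infinitely many \<open>k\<close>.\<close>

theorem generic_is_mu:
  assumes M: "invariant_measure X M" and x: "generic_point X M x"
  shows "\<exists>i\<le>e. M = mu i"
proof -
  have P: "prob_space M" "sets M = BX" using M by (auto simp: invariant_measure_def)
  have xX: "x \<in> X" using x by (simp add: generic_point_def)
  have "\<forall>k. \<exists>N i. k * Suc e \<le> N \<and> 0 < N \<and> i \<le> e \<and>
    (\<forall>l Q. \<bar>hits x 0 (int N) l Q / N - fr (v (k * Suc e + i)) l Q\<bar> \<le> (2 + real l) / 2 ^ (k * Suc e))"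
    using pure_prefix[OF xX] by blast
  then obtain N I where NI: "\<And>k. k * Suc e \<le> N k" "\<And>k. I k \<le> e"
    "\<And>k l Q. \<bar>hits x 0 (int (N k)) l Q / N k - fr (v (k * Suc e + I k)) l Q\<bar> \<le> (2 + real l) / 2 ^ (k * Suc e)"
    by metis
  have "finite (range I)" by (rule finite_subset[of _ "{..e}"]) (use NI(2) in auto)
  then obtain k0 where "infinite {k. I k = I k0}"
    using pigeonhole_infinite[of UNIV I] by auto
  from infinite_enumerate[OF this] obtain r :: "nat \<Rightarrow> nat"
    where r: "strict_mono r" "\<And>k. I (r k) = I k0" by auto
  define i where "i = I k0"
  have "measure M (cyl 0 l Q) = measure (mu i) (cyl 0 l Q)" for l Q
  proof -
    have "filterlim N at_top sequentially"
    proof (rule filterlim_at_top_mono[OF filterlim_ident], rule always_eventually, rule allI)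
      fix k
      have "k \<le> k * Suc e" by simp
      then show "k \<le> N k" using NI(1) by (rule order_trans)
    qed
    then have "filterlim (\<lambda>k. N (r k)) at_top sequentially"
      using filterlim_compose filterlim_subseq[OF r(1)] by blast
    from filterlim_compose[OF generic_averages[OF P(2) x, of l Q] this]
    have 1: "(\<lambda>k. hits x 0 (int (N (r k))) l Q / N (r k)) \<longlonglongrightarrow> measure M (cyl 0 l Q)" .
    have 2: "(\<lambda>k. fr (v (r k * Suc e + i)) l Q) \<longlonglongrightarrow> phi i l Q"
      using LIMSEQ_subseq_LIMSEQ[OF phi[of i l Q] r(1)] by (simp add: o_def add.commute)
    have 3: "(\<lambda>k. (2 + real l) / 2 ^ (r k * Suc e)) \<longlonglongrightarrow> 0"
    proof -
      have "strict_mono (\<lambda>k. r k * Suc e)" by (rule strict_mono_mult_Suc[OF r(1)])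
      moreover have "(\<lambda>k. (2 + real l) * (1/2) ^ k) \<longlonglongrightarrow> (2 + real l) * 0"
        by (intro tendsto_mult tendsto_const LIMSEQ_realpow_zero) auto
      ultimately have "((\<lambda>k. (2 + real l) * (1/2) ^ k) \<circ> (\<lambda>k. r k * Suc e)) \<longlonglongrightarrow> 0"
        by (intro LIMSEQ_subseq_LIMSEQ) auto
      then show ?thesis by (simp add: o_def power_divide)
    qed
    have "(\<lambda>k. hits x 0 (int (N (r k))) l Q / N (r k) - fr (v (r k * Suc e + i)) l Q) \<longlonglongrightarrow> 0"
    proof (rule Lim_null_comparison[OF _ 3], rule always_eventually, rule allI)
      fix k
      show "norm (hits x 0 (int (N (r k))) l Q / N (r k) - fr (v (r k * Suc e + i)) l Q) \<le> (2 + real l) / 2 ^ (r k * Suc e)"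
        using NI(3)[of "r k" l Q] r(2)[of k] by (simp only: i_def real_norm_def)
    qed
    from tendsto_add[OF this 2] have "(\<lambda>k. hits x 0 (int (N (r k))) l Q / N (r k)) \<longlonglongrightarrow> phi i l Q" by simp
    then have "measure M (cyl 0 l Q) = phi i l Q" using 1 LIMSEQ_unique by blast
    then show ?thesis by (simp add: mu(3))
  qed
  then have "M = mu i" by (rule invariant_eqI[OF M mu_invariant])
  then show ?thesis using NI(2) by (auto simp: i_def)
qed

lemma ergodic_measures: "{M. ergodic_measure X M} = mu ` {..e}"
  using ergodic_is_mu mu_ergodic by auto

end

theorem theorem1p3:
  fixes d :: nat
  assumes "d > 1"
  shows "\<exists>(A :: nat set) (X :: (int \<Rightarrow> nat) set).
    minimal_subshift A X \<and>
    finite {M. ergodic_measure X M} \<and> card {M. ergodic_measure X M} = d \<and>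
    \<not> (\<exists>M. generic_measure X M \<and> \<not> ergodic_measure X M) \<and>
    liminf (\<lambda>n. ereal (real (complexity X n) / real n)) = ereal (real d) \<and>
    limsup (\<lambda>n. ereal (real (complexity X n) / real n)) = ereal (real d + 1)"
proof -
  obtain e where e: "d = Suc e" "e \<ge> 1" using assms by (cases d) auto
  interpret tower e by unfold_locales (rule e)
  have "\<not> (\<exists>M. generic_measure X M \<and> \<not> ergodic_measure X M)"
    using generic_is_mu mu_ergodic unfolding generic_measure_def by blast
  moreover have "finite {M. ergodic_measure X M}" "card {M. ergodic_measure X M} = d"
    unfolding ergodic_measures using card_image[OF mu_inj] e by auto
  ultimately show ?thesis
    using minimal_X liminf_P limsup_P unfolding complexity_X[symmetric] e(1) by blast
qed

end
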